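(* Let $B\in\mathbb R$ and let $(M,g,J)$ be a connected Kähler manifold of real dimension $2m\ge 4$ whose metric is $\mathrm{C}_{\mathbb C}(B)$ (e.g., with $D(g,J)\ge3$ and $\mathrm{Sol}(g,J)$ containing a non-parallel element). If $g$ is weakly Bochner-flat, then $g$ is Kähler–Einstein. If $g$ is Bochner-flat, then $g$ has constant holomorphic sectional curvature.
   Context: $\nabla$ is the Levi-Civita connection of $g$; $X^\flat=g(X,\cdot)$, $JX^\flat:=(JX)^\flat$, and $(\alpha\otimes V)(Y)=\alpha(Y)V$. An endomorphism of $TM$ is hermitian if it is $g$-symmetric and commutes with $J$. $\mathrm{Sol}(g,J)$ is the real vector space of hermitian endomorphisms $A$ of $TM$ for which there is a vector field $\Lambda$ (necessarily $\frac14\mathrm{grad}_g\mathrm{tr}A$) with $\nabla_X A=X^\flat\otimes\Lambda+\Lambda^\flat\otimes X+JX^\flat\otimes J\Lambda+J\Lambda^\flat\otimes JX$ for all $X$; the mobility is $D(g,J)=\dim\mathrm{Sol}(g,J)$. $(g,J)$ is called $\mathrm{C}_{\mathbb C}(B)$ if there is a triple $(A,\Lambda,\mu)$ ($A$ a hermitian endomorphism, $\Lambda$ a vector field not identically zero, $\mu$ a function) with $\nabla_X A=X^\flat\otimes\Lambda+\Lambda^\flat\otimes X+JX^\flat\otimes J\Lambda+J\Lambda^\flat\otimes JX$ for all $X$, $\nabla\Lambda=\mu\,\mathrm{Id}+BA$ and $\nabla\mu=2B\Lambda^\flat$. A Kähler metric is Bochner-flat if its Bochner tensor (the totally trace-free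 part of the Kähler curvature tensor) vanishes, and weakly Bochner-flat if its Bochner tensor is co-closed (divergence-free). *)

theory Defs
  imports "HOL-Analysis.Analysis"
begin

section \<open>Smooth maps between open sets of Euclidean spaces\<close>

(* For open S and finite-dimensional domain this is the usual class C^k: all iterated directional
   derivatives exist up to order k and are continuous. *)
fun Ck_on :: "nat \<Rightarrow> ('e::real_normed_vector \<Rightarrow> 'f::real_normed_vector) \<Rightarrow> 'e set \<Rightarrow> bool" where
  "Ck_on 0 f S \<longleftrightarrow> continuous_on S f"
| "Ck_on (Suc k) f S \<longleftrightarrow>
     (\<forall>x\<in>S. f differentiable (at x)) \<and>
     (\<forall>v. Ck_on k (\<lambda>x. frechet_derivative f (at x) v) S)"

definition smooth_on_open :: "('e::real_normed_vector \<Rightarrow> 'f::real_normed_vector) \<Rightarrow> 'e set \<Rightarrow> bool" where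
  "smooth_on_open f S \<longleftrightarrow> (\<forall>k. Ck_on k f S)"

section \<open>Smooth manifolds and tensor fields\<close>

(* A chart is a pair (U, phi) of its domain and its coordinate map; the values of phi outside U are
   irrelevant. *)
type_synonym ('a, 'n) chart = "'a set \<times> ('a \<Rightarrow> real ^ 'n)"

definition coord_dom :: "('a, 'n::finite) chart \<Rightarrow> (real ^ 'n) set" where
  "coord_dom c = snd c ` fst c"

definition coord_overlap :: "('a, 'n::finite) chart \<Rightarrow> ('a, 'n) chart \<Rightarrow> (real ^ 'n) set" where
  "coord_overlap c d = snd c ` (fst c \<inter> fst d)"

definition chart_inv :: "('a, 'n::finite) chart \<Rightarrow> real ^ 'n \<Rightarrow> 'a" where
  "chart_inv c = inv_into (fst c) (snd c)"

definition transition :: "('a, 'n::finite) chart \<Rightarrow> ('a, 'n) chart \<Rightarrow> real ^ 'n \<Rightarrow> real ^ 'n" where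
  "transition c d = snd d \<circ> chart_inv c"

definition jacobian ::
  "('a, 'n::finite) chart \<Rightarrow> ('a, 'n) chart \<Rightarrow> real ^ 'n \<Rightarrow> real ^ 'n \<Rightarrow> real ^ 'n" where
  "jacobian c d x = frechet_derivative (transition c d) (at x)"

definition is_chart :: "'a topology \<Rightarrow> ('a, 'n::finite) chart \<Rightarrow> bool" where
  "is_chart M c \<longleftrightarrow>
     openin M (fst c) \<and> open (coord_dom c) \<and>
     homeomorphic_map (subtopology M (fst c)) (top_of_set (coord_dom c)) (snd c)"

definition smooth_manifold :: "'a topology \<Rightarrow> ('a, 'n::finite) chart set \<Rightarrow> bool" where
  "smooth_manifold M \<A> \<longleftrightarrow>
     Hausdorff_space M \<and> second_countable M \<and>
     (\<forall>c\<in>\<A>. is_chart M c) \<and> (\<Union>c\<in>\<A>. fst c) = topspace M \<and>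
     (\<forall>c\<in>\<A>. \<forall>d\<in>\<A>. smooth_on_open (transition c d) (coord_overlap c d))"

(* A tensor field is given by its coordinate representations in the charts of the atlas, subject to
   the transformation law.  In a chart, tangent vectors are elements of real ^ 'n (components with
   respect to the coordinate frame) and a tensor of rank > 1 at a point is a multilinear map. *)

definition smooth_function :: "('a, 'n::finite) chart set \<Rightarrow> ('a \<Rightarrow> real) \<Rightarrow> bool" where
  "smooth_function \<A> f \<longleftrightarrow> (\<forall>c\<in>\<A>. smooth_on_open (f \<circ> chart_inv c) (coord_dom c))"

type_synonym ('a, 'n) vfield = "('a, 'n) chart \<Rightarrow> real ^ 'n \<Rightarrow> real ^ 'n"
type_synonym ('a, 'n) endofield = "('a, 'n) chart \<Rightarrow> real ^ 'n \<Rightarrow> real ^ 'n \<Rightarrow> real ^ 'n"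
type_synonym ('a, 'n) formfield = "('a, 'n) chart \<Rightarrow> real ^ 'n \<Rightarrow> real ^ 'n \<Rightarrow> real ^ 'n \<Rightarrow> real"

definition vector_field :: "('a, 'n::finite) chart set \<Rightarrow> ('a, 'n) vfield \<Rightarrow> bool" where
  "vector_field \<A> V \<longleftrightarrow>
     (\<forall>c\<in>\<A>. smooth_on_open (V c) (coord_dom c)) \<and>
     (\<forall>c\<in>\<A>. \<forall>d\<in>\<A>. \<forall>x\<in>coord_overlap c d. V d (transition c d x) = jacobian c d x (V c x))"

definition endomorphism_field :: "('a, 'n::finite) chart set \<Rightarrow> ('a, 'n) endofield \<Rightarrow> bool" where
  "endomorphism_field \<A> A \<longleftrightarrow>
     (\<forall>c\<in>\<A>. (\<forall>x\<in>coord_dom c. linear (A c x)) \<and>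
             (\<forall>u. smooth_on_open (\<lambda>x. A c x u) (coord_dom c))) \<and>
     (\<forall>c\<in>\<A>. \<forall>d\<in>\<A>. \<forall>x\<in>coord_overlap c d. \<forall>u.
        A d (transition c d x) (jacobian c d x u) = jacobian c d x (A c x u))"

definition riemannian_metric :: "('a, 'n::finite) chart set \<Rightarrow> ('a, 'n) formfield \<Rightarrow> bool" where
  "riemannian_metric \<A> g \<longleftrightarrow>
     (\<forall>c\<in>\<A>. (\<forall>x\<in>coord_dom c. bilinear (g c x) \<and> (\<forall>u v. g c x u v = g c x v u) \<and>
                              (\<forall>u. u \<noteq> 0 \<longrightarrow> g c x u u > 0)) \<and>
             (\<forall>u v. smooth_on_open (\<lambda>x. g c x u v) (coord_dom c))) \<and>
     (\<forall>c\<in>\<A>. \<forall>d\<in>\<A>. \<forall>x\<in>coord_overlap c d. \<forall>u v.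
        g d (transition c d x) (jacobian c d x u) (jacobian c d x v) = g c x u v)"

section \<open>Levi-Civita connection and curvature in a chart\<close>

(* Throughout, G is the coordinate representation of a Riemannian metric in one chart. *)

(* The coordinate form of the unique torsion-free (symmetric) connection preserving the metric:
   nabla_w v = christoffel G x w v for constant (coordinate) fields w, v. *)
definition christoffel ::
  "(real ^ 'n::finite \<Rightarrow> real ^ 'n \<Rightarrow> real ^ 'n \<Rightarrow> real) \<Rightarrow> real ^ 'n \<Rightarrow> real ^ 'n \<Rightarrow> real ^ 'n \<Rightarrow> real ^ 'n" where
  "christoffel G x = (THE \<Gamma>. bilinear \<Gamma> \<and> (\<forall>u v. \<Gamma> u v = \<Gamma> v u) \<and>
     (\<forall>w u v. frechet_derivative (\<lambda>y. G y u v) (at x) w = G x (\<Gamma> w u) v + G x u (\<Gamma> w v)))"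

definition nabla_vec ::
  "(real ^ 'n::finite \<Rightarrow> real ^ 'n \<Rightarrow> real ^ 'n \<Rightarrow> real) \<Rightarrow> (real ^ 'n \<Rightarrow> real ^ 'n) \<Rightarrow>
   real ^ 'n \<Rightarrow> real ^ 'n \<Rightarrow> real ^ 'n" where
  "nabla_vec G V x w = frechet_derivative V (at x) w + christoffel G x w (V x)"

(* nabla_endo G A x w u = (nabla_w A) u at x *)
definition nabla_endo ::
  "(real ^ 'n::finite \<Rightarrow> real ^ 'n \<Rightarrow> real ^ 'n \<Rightarrow> real) \<Rightarrow> (real ^ 'n \<Rightarrow> real ^ 'n \<Rightarrow> real ^ 'n) \<Rightarrow>
   real ^ 'n \<Rightarrow> real ^ 'n \<Rightarrow> real ^ 'n \<Rightarrow> real ^ 'n" where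
  "nabla_endo G A x w u = frechet_derivative (\<lambda>y. A y u) (at x) w
     + christoffel G x w (A x u) - A x (christoffel G x w u)"

type_synonym 'n tensor4 = "real ^ 'n \<Rightarrow> real ^ 'n \<Rightarrow> real ^ 'n \<Rightarrow> real ^ 'n \<Rightarrow> real"

definition nabla_tensor4 ::
  "(real ^ 'n::finite \<Rightarrow> real ^ 'n \<Rightarrow> real ^ 'n \<Rightarrow> real) \<Rightarrow> (real ^ 'n \<Rightarrow> 'n tensor4) \<Rightarrow>
   real ^ 'n \<Rightarrow> real ^ 'n \<Rightarrow> 'n tensor4" where
  "nabla_tensor4 G T x w a b c d = frechet_derivative (\<lambda>y. T y a b c d) (at x) w
     - T x (christoffel G x w a) b c d - T x a (christoffel G x w b) c d
     - T x a b (christoffel G x w c) d - T x a b c (christoffel G x w d)"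

(* R(u,v)w = nabla_u nabla_v w - nabla_v nabla_u w for coordinate (hence commuting) fields u, v, w. *)
definition curvature_endo ::
  "(real ^ 'n::finite \<Rightarrow> real ^ 'n \<Rightarrow> real ^ 'n \<Rightarrow> real) \<Rightarrow>
   real ^ 'n \<Rightarrow> real ^ 'n \<Rightarrow> real ^ 'n \<Rightarrow> real ^ 'n \<Rightarrow> real ^ 'n" where
  "curvature_endo G x u v w =
     nabla_vec G (\<lambda>y. christoffel G y v w) x u - nabla_vec G (\<lambda>y. christoffel G y u w) x v"

definition riemann ::
  "(real ^ 'n::finite \<Rightarrow> real ^ 'n \<Rightarrow> real ^ 'n \<Rightarrow> real) \<Rightarrow> real ^ 'n \<Rightarrow> 'n tensor4" where
  "riemann G x u v w z = G x (curvature_endo G x u v w) z"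

(* trace of the bilinear form b with respect to the inner product h: h^{ij} b_{ij} *)
definition metric_trace ::
  "(real ^ 'n::finite \<Rightarrow> real ^ 'n \<Rightarrow> real) \<Rightarrow> (real ^ 'n \<Rightarrow> real ^ 'n \<Rightarrow> real) \<Rightarrow> real" where
  "metric_trace h b = (\<Sum>i\<in>UNIV. \<Sum>j\<in>UNIV.
     matrix_inv (\<chi> k l. h (axis k 1) (axis l 1)) $ i $ j * b (axis i 1) (axis j 1))"

definition ricci_contraction ::
  "(real ^ 'n::finite \<Rightarrow> real ^ 'n \<Rightarrow> real) \<Rightarrow> 'n tensor4 \<Rightarrow> real ^ 'n \<Rightarrow> real ^ 'n \<Rightarrow> real" where
  "ricci_contraction h T u v = metric_trace h (\<lambda>a b. T a u v b)"

definition ricci ::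
  "(real ^ 'n::finite \<Rightarrow> real ^ 'n \<Rightarrow> real ^ 'n \<Rightarrow> real) \<Rightarrow> real ^ 'n \<Rightarrow> real ^ 'n \<Rightarrow> real ^ 'n \<Rightarrow> real" where
  "ricci G x = ricci_contraction (G x) (riemann G x)"

section \<open>Bochner tensor\<close>

(* In this section h and j are the metric and the complex structure of a single tangent space. *)

definition multilinear4 :: "'n::finite tensor4 \<Rightarrow> bool" where
  "multilinear4 T \<longleftrightarrow> (\<forall>a b c d.
     linear (\<lambda>v. T v b c d) \<and> linear (\<lambda>v. T a v c d) \<and> linear (\<lambda>v. T a b v d) \<and> linear (\<lambda>v. T a b c v))"

definition kaehler_curvature_tensor :: "(real ^ 'n::finite \<Rightarrow> real ^ 'n) \<Rightarrow> 'n tensor4 \<Rightarrow> bool" where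
  "kaehler_curvature_tensor j T \<longleftrightarrow> multilinear4 T \<and> (\<forall>a b c d.
     T a b c d = - T b a c d \<and> T a b c d = - T a b d c \<and>
     T a b c d + T b c a d + T c a b d = 0 \<and> T (j a) (j b) c d = T a b c d)"

(* By these symmetries every contraction of T, possibly after inserting j, vanishes as soon as the
   Ricci contraction does. *)
definition trace_free_kaehler_curvature_tensor ::
  "(real ^ 'n::finite \<Rightarrow> real ^ 'n \<Rightarrow> real) \<Rightarrow> (real ^ 'n \<Rightarrow> real ^ 'n) \<Rightarrow> 'n tensor4 \<Rightarrow> bool" where
  "trace_free_kaehler_curvature_tensor h j T \<longleftrightarrow>
     kaehler_curvature_tensor j T \<and> (\<forall>u v. ricci_contraction h T u v = 0)"

definition tensor4_inner ::
  "(real ^ 'n::finite \<Rightarrow> real ^ 'n \<Rightarrow> real) \<Rightarrow> 'n tensor4 \<Rightarrow> 'n tensor4 \<Rightarrow> real" where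
  "tensor4_inner h S T =
     metric_trace h (\<lambda>a a'. metric_trace h (\<lambda>b b'. metric_trace h (\<lambda>c c'. metric_trace h (\<lambda>d d'.
       S a b c d * T a' b' c' d'))))"

(* The component of T in the space of trace-free Kaehler curvature tensors, i.e. the orthogonal
   projection to that space. *)
definition trace_free_part ::
  "(real ^ 'n::finite \<Rightarrow> real ^ 'n \<Rightarrow> real) \<Rightarrow> (real ^ 'n \<Rightarrow> real ^ 'n) \<Rightarrow> 'n tensor4 \<Rightarrow> 'n tensor4" where
  "trace_free_part h j T = (THE W. trace_free_kaehler_curvature_tensor h j W \<and>
     (\<forall>S. trace_free_kaehler_curvature_tensor h j S \<longrightarrow>
        tensor4_inner h (\<lambda>a b c d. T a b c d - W a b c d) S = 0))"

definition bochner ::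
  "(real ^ 'n::finite \<Rightarrow> real ^ 'n \<Rightarrow> real ^ 'n \<Rightarrow> real) \<Rightarrow> (real ^ 'n \<Rightarrow> real ^ 'n \<Rightarrow> real ^ 'n) \<Rightarrow>
   real ^ 'n \<Rightarrow> 'n tensor4" where
  "bochner G J x = trace_free_part (G x) (J x) (riemann G x)"

section \<open>Kaehler manifolds\<close>

definition hermitian_endomorphism ::
  "('a, 'n::finite) chart set \<Rightarrow> ('a, 'n) formfield \<Rightarrow> ('a, 'n) endofield \<Rightarrow> ('a, 'n) endofield \<Rightarrow> bool" where
  "hermitian_endomorphism \<A> g J A \<longleftrightarrow> endomorphism_field \<A> A \<and>
     (\<forall>c\<in>\<A>. \<forall>x\<in>coord_dom c. \<forall>u v.
        g c x (A c x u) v = g c x u (A c x v) \<and> A c x (J c x u) = J c x (A c x u))"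

definition kaehler_manifold ::
  "'a topology \<Rightarrow> ('a, 'n::finite) chart set \<Rightarrow> ('a, 'n) formfield \<Rightarrow> ('a, 'n) endofield \<Rightarrow> bool" where
  "kaehler_manifold M \<A> g J \<longleftrightarrow>
     smooth_manifold M \<A> \<and> riemannian_metric \<A> g \<and> endomorphism_field \<A> J \<and>
     (\<forall>c\<in>\<A>. \<forall>x\<in>coord_dom c. \<forall>u v w.
        J c x (J c x u) = - u \<and> g c x (J c x u) (J c x v) = g c x u v \<and>
        nabla_endo (g c) (J c) x w u = 0)"

(* The condition C_C(B); a^flat(Y) = g(a,Y). *)
definition metric_CC ::
  "('a, 'n::finite) chart set \<Rightarrow> ('a, 'n) formfield \<Rightarrow> ('a, 'n) endofield \<Rightarrow> real \<Rightarrow> bool" where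
  "metric_CC \<A> g J B \<longleftrightarrow> (\<exists>A \<Lambda> \<mu>.
     hermitian_endomorphism \<A> g J A \<and> vector_field \<A> \<Lambda> \<and> smooth_function \<A> \<mu> \<and>
     (\<exists>c\<in>\<A>. \<exists>x\<in>coord_dom c. \<Lambda> c x \<noteq> 0) \<and>
     (\<forall>c\<in>\<A>. \<forall>x\<in>coord_dom c. \<forall>X Y.
        nabla_endo (g c) (A c) x X Y =
            g c x X Y *\<^sub>R \<Lambda> c x + g c x (\<Lambda> c x) Y *\<^sub>R X
          + g c x (J c x X) Y *\<^sub>R J c x (\<Lambda> c x) + g c x (J c x (\<Lambda> c x)) Y *\<^sub>R J c x X) \<and>
     (\<forall>c\<in>\<A>. \<forall>x\<in>coord_dom c. \<forall>X.
        nabla_vec (g c) (\<Lambda> c) x X = \<mu> (chart_inv c x) *\<^sub>R X + B *\<^sub>R A c x X) \<and>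
     (\<forall>c\<in>\<A>. \<forall>x\<in>coord_dom c. \<forall>X.
        frechet_derivative (\<mu> \<circ> chart_inv c) (at x) X = 2 * B * g c x (\<Lambda> c x) X))"

definition bochner_flat ::
  "('a, 'n::finite) chart set \<Rightarrow> ('a, 'n) formfield \<Rightarrow> ('a, 'n) endofield \<Rightarrow> bool" where
  "bochner_flat \<A> g J \<longleftrightarrow>
     (\<forall>c\<in>\<A>. \<forall>x\<in>coord_dom c. \<forall>X Y Z W. bochner (g c) (J c) x X Y Z W = 0)"

(* Divergence in the first slot; the pair symmetries make the choice of slot immaterial. *)
definition weakly_bochner_flat ::
  "('a, 'n::finite) chart set \<Rightarrow> ('a, 'n) formfield \<Rightarrow> ('a, 'n) endofield \<Rightarrow> bool" where
  "weakly_bochner_flat \<A> g J \<longleftrightarrow>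
     (\<forall>c\<in>\<A>. \<forall>x\<in>coord_dom c. \<forall>X Y Z.
        metric_trace (g c x) (\<lambda>u v. nabla_tensor4 (g c) (bochner (g c) (J c)) x u v X Y Z) = 0)"

definition einstein :: "('a, 'n::finite) chart set \<Rightarrow> ('a, 'n) formfield \<Rightarrow> bool" where
  "einstein \<A> g \<longleftrightarrow>
     (\<exists>k. \<forall>c\<in>\<A>. \<forall>x\<in>coord_dom c. \<forall>u v. ricci (g c) x u v = k * g c x u v)"

definition kaehler_einstein ::
  "'a topology \<Rightarrow> ('a, 'n::finite) chart set \<Rightarrow> ('a, 'n) formfield \<Rightarrow> ('a, 'n) endofield \<Rightarrow> bool" where
  "kaehler_einstein M \<A> g J \<longleftrightarrow> kaehler_manifold M \<A> g J \<and> einstein \<A> g"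

definition sectional_curvature ::
  "(real ^ 'n::finite \<Rightarrow> real ^ 'n \<Rightarrow> real ^ 'n \<Rightarrow> real) \<Rightarrow> real ^ 'n \<Rightarrow> real ^ 'n \<Rightarrow> real ^ 'n \<Rightarrow> real" where
  "sectional_curvature G x u v = riemann G x u v v u / (G x u u * G x v v - (G x u v)\<^sup>2)"

definition constant_holomorphic_sectional_curvature ::
  "('a, 'n::finite) chart set \<Rightarrow> ('a, 'n) formfield \<Rightarrow> ('a, 'n) endofield \<Rightarrow> bool" where
  "constant_holomorphic_sectional_curvature \<A> g J \<longleftrightarrow>
     (\<exists>k. \<forall>c\<in>\<A>. \<forall>x\<in>coord_dom c. \<forall>u. u \<noteq> 0 \<longrightarrow> sectional_curvature (g c) x u (J c x u) = k)"

end

theory Submission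
  imports Defs
begin

text \<open>
  Let \<open>K\<close> be the curvature tensor of constant holomorphic sectional curvature \<open>4\<close>. The Ricci identity
  for a solution \<open>(A, \<Lambda>, \<mu>)\<close> gives \<open>(R + B K)(X, Y) \<Lambda> = 0\<close> and \<open>[(R + B K)(X, Y), A] = 0\<close>. Contraction
  shows that the endomorphism \<open>E = Ric + (dim M + 2) B Id\<close> kills \<open>\<Lambda>\<close> and commutes with \<open>A\<close>. If the Bochner
  tensor is co-closed, then the Bianchi identities express \<open>\<nabla>Ric\<close> by a vector field \<open>V\<close> proportional to
  the gradient of the scalar curvature. Since \<open>E\<close> and \<open>\<nabla>\<Lambda> = \<mu> Id + B A\<close> commute with \<open>J\<close>, the derivative
  of \<open>E \<Lambda> = 0\<close> forces \<open>V = 0\<close> wherever \<open>\<Lambda> \<noteq> 0\<close>, so \<open>\<nabla>E = 0\<close> there, and the derivative of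
  \<open>E A = A E\<close>, applied to \<open>\<Lambda>\<close>, becomes \<open>|\<Lambda>|\<^sup>2 E = 0\<close>. The pair \<open>(\<Lambda>, \<mu> Id + B A)\<close> solves a closed linear
  first order system, so the interior of the zero set of \<open>\<Lambda>\<close> is closed, hence empty on a connected
  manifold, and \<open>E = 0\<close> holds everywhere. If the Bochner tensor vanishes, the whole curvature tensor is
  then determined by its Ricci contraction and equals \<open>- B K\<close>.
\<close>

section \<open>Calculus on open sets\<close>

text \<open>A tensor field is only a family of coordinate representations, so all geometry is done
  in one chart; the atlas enters only for the zero set of \<Lambda>. The connection and the Bochner
  tensor are definite descriptions, which must be shown to denote something: Koszul's formula and
  Riesz representation supply the connection, and the Bochner tensor turns out to be the curvature
  minus a Kaehler product, which is orthogonal to all trace-free Kaehler curvature tensors. The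
  constant in \<open>E\<close> is the Ricci factor of \<open>K\<close>: its contraction is n + 2
  times the metric, n being the real dimension. As this factor is explicit, no Schur argument is
  needed for the Einstein property. The formula for \<nabla>Ric is a rigidity statement: after
  subtraction of a tensor built from the gradient of the scalar curvature, the rest is totally
  symmetric and J-invariant in two slots, and J J = -1 forces it to vanish. At a zero of \<Lambda>
  the pointwise argument says nothing, which is why density of the nonzero points and a continuation
  estimate are required.\<close>

abbreviation dderiv :: "('e::real_normed_vector \<Rightarrow> 'f::real_normed_vector) \<Rightarrow> 'e \<Rightarrow> 'e \<Rightarrow> 'f" where
  "dderiv f x v \<equiv> frechet_derivative f (at x) v"

lemma dderiv_eqI: "(f has_derivative f') (at x) \<Longrightarrow> dderiv f x v = f' v"
  by (metis frechet_derivative_at)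

lemma has_derivative_dderiv: "f differentiable at x \<Longrightarrow> (f has_derivative (\<lambda>v. dderiv f x v)) (at x)"
  by (simp add: frechet_derivative_works[symmetric])

lemma dderiv_cong:
  assumes "f differentiable at x \<or> g differentiable at x" "open S" "x \<in> S" "\<And>y. y \<in> S \<Longrightarrow> f y = g y"
  shows "dderiv f x v = dderiv g x v"
  using assms frechet_derivative_transform_within_open[of f x S g]
    frechet_derivative_transform_within_open[of g x S f] by auto

lemma differentiable_cong:
  assumes "f differentiable at x" "open S" "x \<in> S" "\<And>y. y \<in> S \<Longrightarrow> f y = g y"
  shows "g differentiable at x"
  by (meson assms differentiable_def has_derivative_transform_within_open)

lemma dderiv_add:
  assumes "f differentiable at x" "g differentiable at x"
  shows "dderiv (\<lambda>y. f y + g y) x v = dderiv f x v + dderiv g x v"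
  by (rule dderiv_eqI) (intro has_derivative_add has_derivative_dderiv assms)

lemma dderiv_diff:
  assumes "f differentiable at x" "g differentiable at x"
  shows "dderiv (\<lambda>y. f y - g y) x v = dderiv f x v - dderiv g x v"
  by (rule dderiv_eqI) (intro has_derivative_diff has_derivative_dderiv assms)

lemma dderiv_minus:
  assumes "f differentiable at x"
  shows "dderiv (\<lambda>y. - f y) x v = - dderiv f x v"
  by (rule dderiv_eqI) (intro has_derivative_minus has_derivative_dderiv assms)

lemma dderiv_sum:
  assumes "\<And>i. i \<in> I \<Longrightarrow> f i differentiable at x"
  shows "dderiv (\<lambda>y. \<Sum>i\<in>I. f i y) x v = (\<Sum>i\<in>I. dderiv (f i) x v)"
  by (rule dderiv_eqI) (intro has_derivative_sum has_derivative_dderiv assms)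

lemma dderiv_bounded_linear:
  assumes "bounded_linear L" "f differentiable at x"
  shows "dderiv (\<lambda>y. L (f y)) x v = L (dderiv f x v)"
  by (rule dderiv_eqI)
    (intro bounded_linear.has_derivative[OF assms(1)] has_derivative_dderiv assms)

lemma dderiv_bounded_bilinear:
  assumes "bounded_bilinear p" "f differentiable at x" "g differentiable at x"
  shows "dderiv (\<lambda>y. p (f y) (g y)) x v = p (f x) (dderiv g x v) + p (dderiv f x v) (g x)"
  by (rule dderiv_eqI)
    (intro bounded_bilinear.FDERIV[OF assms(1)] has_derivative_dderiv assms)

lemmas dderiv_scaleR = dderiv_bounded_bilinear[OF bounded_bilinear_scaleR]

lemma differentiable_bounded_linear:
  assumes "bounded_linear L" "f differentiable at x"
  shows "(\<lambda>y. L (f y)) differentiable at x"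
  by (rule differentiableI[OF bounded_linear.has_derivative[OF assms(1) has_derivative_dderiv[OF assms(2)]]])

lemma differentiable_bounded_bilinear:
  assumes "bounded_bilinear p" "f differentiable at x" "g differentiable at x"
  shows "(\<lambda>y. p (f y) (g y)) differentiable at x"
  by (rule differentiableI[OF bounded_bilinear.FDERIV[OF assms(1) has_derivative_dderiv[OF assms(2)]
        has_derivative_dderiv[OF assms(3)]]])

subsection \<open>Closure properties of smooth functions\<close>

text \<open>A derivative at a point of an open set sees only nearby values, so equality on
  \<open>S\<close> passes to all iterated derivatives. The closure lemmas rely on it: their
  derivative formulas hold only at points of \<open>S\<close>.\<close>

lemma Ck_on_cong:
  assumes "open S" "\<And>x. x \<in> S \<Longrightarrow> f x = g x" "Ck_on k f S"
  shows "Ck_on k g S"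
  using assms(2,3)
proof (induction k arbitrary: f g)
  case 0
  then show ?case using continuous_on_cong[of S S f g] by simp
next
  case (Suc k)
  have d: "f differentiable (at x)" if "x \<in> S" for x using Suc that by simp
  have "g differentiable (at x)" if "x \<in> S" for x
    using differentiable_cong[OF d assms(1)] Suc.prems(1) that by blast
  moreover have "Ck_on k (\<lambda>x. dderiv g x v) S" for v
  proof (rule Suc.IH)
    show "Ck_on k (\<lambda>x. dderiv f x v) S" using Suc.prems by simp
    show "dderiv f x v = dderiv g x v" if "x \<in> S" for x
      using dderiv_cong[OF _ assms(1) that, of f g] d[OF that] Suc.prems(1) by blast
  qed
  ultimately show ?case by simp
qed

lemma Ck_on_Suc_imp: "Ck_on (Suc k) f S \<Longrightarrow> Ck_on k f S"
proof (induction k arbitrary: f)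
  case 0
  then show ?case
    by (auto intro!: continuous_at_imp_continuous_on differentiable_imp_continuous_within)
next
  case (Suc k)
  then show ?case by (metis Ck_on.simps(2))
qed

lemma Ck_on_const: "Ck_on k (\<lambda>x. c) S"
proof (induction k arbitrary: c)
  case (Suc k)
  then show ?case by simp
qed simp

lemma Ck_on_add:
  assumes "open S" "Ck_on k f S" "Ck_on k g S"
  shows "Ck_on k (\<lambda>x. f x + g x) S"
  using assms(2,3)
proof (induction k arbitrary: f g)
  case 0
  then show ?case by (auto intro: continuous_on_add)
next
  case (Suc k)
  have "Ck_on k (\<lambda>x. dderiv (\<lambda>y. f y + g y) x v) S" for v
    by (rule Ck_on_cong[OF assms(1), rotated], rule Suc.IH[of "\<lambda>x. dderiv f x v" "\<lambda>x. dderiv g x v"])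
      (use Suc.prems in \<open>auto simp: dderiv_add\<close>)
  then show ?case using Suc.prems by (auto intro: differentiable_add)
qed

lemma Ck_on_bounded_linear:
  assumes "open S" "bounded_linear L" "Ck_on k f S"
  shows "Ck_on k (\<lambda>x. L (f x)) S"
  using assms(3)
proof (induction k arbitrary: f)
  case 0
  then show ?case by (auto intro: bounded_linear.continuous_on[OF assms(2)])
next
  case (Suc k)
  have "Ck_on k (\<lambda>x. dderiv (\<lambda>y. L (f y)) x v) S" for v
    by (rule Ck_on_cong[OF assms(1), rotated], rule Suc.IH[of "\<lambda>x. dderiv f x v"])
      (use Suc.prems in \<open>auto simp: dderiv_bounded_linear[OF assms(2)]\<close>)
  then show ?case using Suc.prems by (auto intro: differentiable_bounded_linear[OF assms(2)])
qed

lemma Ck_on_bounded_bilinear: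
  assumes "open S" "bounded_bilinear p" "Ck_on k f S" "Ck_on k g S"
  shows "Ck_on k (\<lambda>x. p (f x) (g x)) S"
  using assms(3,4)
proof (induction k arbitrary: f g)
  case 0
  then show ?case by (auto intro: bounded_bilinear.continuous_on[OF assms(2)])
next
  case (Suc k)
  have "Ck_on k (\<lambda>x. dderiv (\<lambda>y. p (f y) (g y)) x v) S" for v
  proof (rule Ck_on_cong[OF assms(1)])
    show "Ck_on k (\<lambda>x. p (f x) (dderiv g x v) + p (dderiv f x v) (g x)) S"
      by (intro Ck_on_add[OF assms(1)] Suc.IH Ck_on_Suc_imp[OF Suc.prems(1)]
          Ck_on_Suc_imp[OF Suc.prems(2)]) (use Suc.prems in auto)
  qed (use Suc.prems in \<open>auto simp: dderiv_bounded_bilinear[OF assms(2)]\<close>)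
  then show ?case using Suc.prems by (auto intro: differentiable_bounded_bilinear[OF assms(2)])
qed

text \<open>The derivative of 1/f consists of 1/f and the derivative of f, each needed to one order
  less, so the induction keeps \<open>f\<close> fixed and feeds on its own conclusion.\<close>

lemma Ck_on_inverse:
  fixes f :: "'e::real_normed_vector \<Rightarrow> real"
  assumes "open S" "\<And>x. x \<in> S \<Longrightarrow> f x \<noteq> 0" "Ck_on k f S"
  shows "Ck_on k (\<lambda>x. inverse (f x)) S"
  using assms(2,3)
proof (induction k)
  case 0
  then show ?case by (auto intro: continuous_on_inverse)
next
  case (Suc k)
  have D: "((\<lambda>y. inverse (f y)) has_derivative
      (\<lambda>v. - (inverse (f x) * dderiv f x v * inverse (f x)))) (at x)" if "x \<in> S" for x
    using Suc.prems that by (intro Deriv.has_derivative_inverse has_derivative_dderiv) auto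
  have IH: "Ck_on k (\<lambda>x. inverse (f x)) S" using Suc Ck_on_Suc_imp by blast
  have "Ck_on k (\<lambda>x. dderiv (\<lambda>y. inverse (f y)) x v) S" for v
  proof (rule Ck_on_cong[OF assms(1)])
    show "Ck_on k (\<lambda>x. - (inverse (f x) * dderiv f x v * inverse (f x))) S"
      by (intro Ck_on_bounded_linear[OF assms(1) bounded_linear_minus[OF bounded_linear_ident]]
          Ck_on_bounded_bilinear[OF assms(1) bounded_bilinear_mult] IH)
        (use Suc.prems in auto)
  qed (use dderiv_eqI[OF D] in auto)
  then show ?case using D by (auto simp: differentiable_def)
qed

lemma smooth_on_open_cong:
  assumes "open S" "smooth_on_open f S" "\<And>x. x \<in> S \<Longrightarrow> f x = g x"
  shows "smooth_on_open g S"
  using assms Ck_on_cong unfolding smooth_on_open_def by blast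

lemma smooth_on_open_differentiable:
  assumes "smooth_on_open f S" "x \<in> S"
  shows "f differentiable at x"
  using assms unfolding smooth_on_open_def by (metis Ck_on.simps(2))

lemma smooth_on_open_continuous: "smooth_on_open f S \<Longrightarrow> continuous_on S f"
  unfolding smooth_on_open_def by (metis Ck_on.simps(1))

lemma smooth_on_open_dderiv:
  assumes "smooth_on_open f S"
  shows "smooth_on_open (\<lambda>x. dderiv f x v) S"
  using assms unfolding smooth_on_open_def by (metis Ck_on.simps(2))

lemma smooth_on_open_const: "smooth_on_open (\<lambda>x. c) S"
  by (simp add: smooth_on_open_def Ck_on_const)

lemma smooth_on_open_bounded_linear:
  "open S \<Longrightarrow> bounded_linear L \<Longrightarrow> smooth_on_open f S \<Longrightarrow> smooth_on_open (\<lambda>x. L (f x)) S"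
  by (simp add: smooth_on_open_def Ck_on_bounded_linear)

lemma smooth_on_open_bounded_bilinear:
  "open S \<Longrightarrow> bounded_bilinear p \<Longrightarrow> smooth_on_open f S \<Longrightarrow> smooth_on_open g S \<Longrightarrow>
    smooth_on_open (\<lambda>x. p (f x) (g x)) S"
  by (simp add: smooth_on_open_def Ck_on_bounded_bilinear)

lemma smooth_on_open_add:
  "open S \<Longrightarrow> smooth_on_open f S \<Longrightarrow> smooth_on_open g S \<Longrightarrow> smooth_on_open (\<lambda>x. f x + g x) S"
  by (simp add: smooth_on_open_def Ck_on_add)

lemma smooth_on_open_minus:
  "open S \<Longrightarrow> smooth_on_open f S \<Longrightarrow> smooth_on_open (\<lambda>x. - f x) S"
  by (rule smooth_on_open_bounded_linear[OF _ bounded_linear_minus[OF bounded_linear_ident]])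

lemma smooth_on_open_diff:
  "open S \<Longrightarrow> smooth_on_open f S \<Longrightarrow> smooth_on_open g S \<Longrightarrow> smooth_on_open (\<lambda>x. f x - g x) S"
  using smooth_on_open_add[OF _ _ smooth_on_open_minus, of S f g] by simp

lemma smooth_on_open_mult:
  fixes f g :: "'e::real_normed_vector \<Rightarrow> real"
  shows "open S \<Longrightarrow> smooth_on_open f S \<Longrightarrow> smooth_on_open g S \<Longrightarrow> smooth_on_open (\<lambda>x. f x * g x) S"
  by (rule smooth_on_open_bounded_bilinear[OF _ bounded_bilinear_mult])

lemma smooth_on_open_scaleR:
  "open S \<Longrightarrow> smooth_on_open f S \<Longrightarrow> smooth_on_open g S \<Longrightarrow> smooth_on_open (\<lambda>x. f x *\<^sub>R g x) S"
  by (rule smooth_on_open_bounded_bilinear[OF _ bounded_bilinear_scaleR])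

lemma smooth_on_open_divide:
  fixes f g :: "'e::real_normed_vector \<Rightarrow> real"
  assumes "open S" "smooth_on_open f S" "smooth_on_open g S" "\<And>x. x \<in> S \<Longrightarrow> g x \<noteq> 0"
  shows "smooth_on_open (\<lambda>x. f x / g x) S"
  unfolding divide_inverse using assms
  by (intro smooth_on_open_mult) (auto simp: smooth_on_open_def Ck_on_inverse)

lemma smooth_on_open_sum:
  assumes "open S" "\<And>i. i \<in> I \<Longrightarrow> smooth_on_open (f i) S"
  shows "smooth_on_open (\<lambda>x. \<Sum>i\<in>I. f i x) S"
  using assms(2) by (induction I rule: infinite_finite_induct)
    (auto intro!: smooth_on_open_add[OF assms(1)] simp: smooth_on_open_const)

lemma smooth_on_open_prod:
  fixes f :: "'i \<Rightarrow> 'e::real_normed_vector \<Rightarrow> real"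
  assumes "open S" "\<And>i. i \<in> I \<Longrightarrow> smooth_on_open (f i) S"
  shows "smooth_on_open (\<lambda>x. \<Prod>i\<in>I. f i x) S"
  using assms(2) by (induction I rule: infinite_finite_induct)
    (auto intro!: smooth_on_open_mult[OF assms(1)] simp: smooth_on_open_const)

lemma smooth_on_open_det:
  fixes A :: "'e::real_normed_vector \<Rightarrow> real ^ 'n::finite ^ 'n"
  assumes "open S" "\<And>i j. smooth_on_open (\<lambda>x. A x $ i $ j) S"
  shows "smooth_on_open (\<lambda>x. det (A x)) S"
  unfolding det_def
  by (intro smooth_on_open_sum smooth_on_open_mult smooth_on_open_const smooth_on_open_prod assms)

lemma smooth_on_open_nth:
  assumes "open S" "smooth_on_open f S"
  shows "smooth_on_open (\<lambda>x. f x $ i) S"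
  by (rule smooth_on_open_bounded_linear[OF assms(1) bounded_linear_vec_nth assms(2)])

lemma smooth_on_open_vec:
  fixes f :: "'e::real_normed_vector \<Rightarrow> real ^ 'n::finite"
  assumes "open S" "\<And>i. smooth_on_open (\<lambda>x. f x $ i) S"
  shows "smooth_on_open f S"
proof (rule smooth_on_open_cong[OF assms(1)])
  show "smooth_on_open (\<lambda>x. \<Sum>i\<in>UNIV. (f x $ i) *\<^sub>R (axis i 1 :: real ^ 'n)) S"
    by (intro smooth_on_open_sum smooth_on_open_scaleR smooth_on_open_const assms)
  show "(\<Sum>i\<in>UNIV. (f x $ i) *\<^sub>R axis i 1) = f x" for x
    using basis_expansion[of "f x"] by (simp add: scalar_mult_eq_scaleR)
qed

lemma dderiv_nth:
  fixes f :: "'e::real_normed_vector \<Rightarrow> real ^ 'n::finite"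
  assumes "f differentiable at x"
  shows "dderiv (\<lambda>y. f y $ i) x v = dderiv f x v $ i"
  by (rule dderiv_bounded_linear[OF bounded_linear_vec_nth assms])

lemma linear_axis_expansion:
  fixes T :: "real ^ 'n::finite \<Rightarrow> 'b::real_vector"
  assumes "linear T"
  shows "T u = (\<Sum>i\<in>UNIV. (u $ i) *\<^sub>R T (axis i 1))"
proof -
  have "T u = T (\<Sum>i\<in>UNIV. (u $ i) *\<^sub>R axis i 1)"
    using basis_expansion[of u] by (simp add: scalar_mult_eq_scaleR)
  then show ?thesis by (simp add: linear_sum[OF assms] linear_cmul[OF assms])
qed

subsection \<open>Fields of linear maps applied to vector fields\<close>

text \<open>For a field of linear maps, smoothness is only given for constant arguments. Expanding
  \<open>V\<close> in the coordinate basis reduces a moving argument to finitely many constant ones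
  and yields the product rule.\<close>

lemma
  fixes T :: "'e::real_normed_vector \<Rightarrow> real ^ 'n::finite \<Rightarrow> 'b::real_normed_vector"
  assumes S: "open S" and lin: "\<And>y. y \<in> S \<Longrightarrow> linear (T y)"
    and sm: "\<And>u. smooth_on_open (\<lambda>y. T y u) S" and V: "smooth_on_open V S"
  shows smooth_on_open_apply: "smooth_on_open (\<lambda>y. T y (V y)) S"
    and dderiv_apply: "x \<in> S \<Longrightarrow>
      dderiv (\<lambda>y. T y (V y)) x w = dderiv (\<lambda>y. T y (V x)) x w + T x (dderiv V x w)"
proof -
  have eq: "T y (V y) = (\<Sum>i\<in>UNIV. (V y $ i) *\<^sub>R T y (axis i 1))" if "y \<in> S" for y
    by (rule linear_axis_expansion[OF lin[OF that]])
  have sm': "smooth_on_open (\<lambda>y. \<Sum>i\<in>UNIV. (V y $ i) *\<^sub>R T y (axis i 1)) S"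
    by (intro smooth_on_open_sum smooth_on_open_scaleR smooth_on_open_nth S V sm)
  then show "smooth_on_open (\<lambda>y. T y (V y)) S"
    by (rule smooth_on_open_cong[OF S]) (simp add: eq)
  assume x: "x \<in> S"
  note d = smooth_on_open_differentiable[OF _ x]
  have Vi: "(\<lambda>y. V y $ i) differentiable at x" for i
    by (rule d[OF smooth_on_open_nth[OF S V]])
  have "dderiv (\<lambda>y. T y (V y)) x w = dderiv (\<lambda>y. \<Sum>i\<in>UNIV. (V y $ i) *\<^sub>R T y (axis i 1)) x w"
    by (rule dderiv_cong[OF _ S x]) (use eq d[OF sm'] in auto)
  also have "\<dots> = (\<Sum>i\<in>UNIV. (V x $ i) *\<^sub>R dderiv (\<lambda>y. T y (axis i 1)) x w)
      + (\<Sum>i\<in>UNIV. (dderiv V x w $ i) *\<^sub>R T x (axis i 1))"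
    by (simp add: dderiv_sum dderiv_scaleR Vi d[OF sm] dderiv_nth[OF d[OF V]] sum.distrib
        differentiable_bounded_bilinear[OF bounded_bilinear_scaleR])
  also have "(\<Sum>i\<in>UNIV. (dderiv V x w $ i) *\<^sub>R T x (axis i 1)) = T x (dderiv V x w)"
    by (rule linear_axis_expansion[OF lin[OF x], symmetric])
  also have "(\<Sum>i\<in>UNIV. (V x $ i) *\<^sub>R dderiv (\<lambda>y. T y (axis i 1)) x w)
      = dderiv (\<lambda>y. \<Sum>i\<in>UNIV. (V x $ i) *\<^sub>R T y (axis i 1)) x w"
    by (simp add: dderiv_sum dderiv_scaleR d[OF sm]
        differentiable_bounded_bilinear[OF bounded_bilinear_scaleR])
  also have "\<dots> = dderiv (\<lambda>y. T y (V x)) x w"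
    by (rule dderiv_cong[OF _ S x])
      (use d[OF sm] linear_axis_expansion[OF lin, of _ "V x"] in auto)
  finally show "dderiv (\<lambda>y. T y (V y)) x w = dderiv (\<lambda>y. T y (V x)) x w + T x (dderiv V x w)" .
qed

lemma linear_dderiv_param:
  fixes T :: "'e::real_normed_vector \<Rightarrow> 'a::real_vector \<Rightarrow> 'b::real_normed_vector"
  assumes "open S" "x \<in> S" "\<And>y. y \<in> S \<Longrightarrow> linear (T y)" "\<And>u. (\<lambda>y. T y u) differentiable at x"
  shows "linear (\<lambda>u. dderiv (\<lambda>y. T y u) x w)"
proof (rule linearI)
  fix u v :: 'a and c :: real
  have "dderiv (\<lambda>y. T y (u + v)) x w = dderiv (\<lambda>y. T y u + T y v) x w"
    by (rule dderiv_cong[OF _ assms(1,2)]) (use assms in \<open>auto simp: linear_add\<close>)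
  then show "dderiv (\<lambda>y. T y (u + v)) x w = dderiv (\<lambda>y. T y u) x w + dderiv (\<lambda>y. T y v) x w"
    by (simp add: dderiv_add assms)
  have "dderiv (\<lambda>y. T y (c *\<^sub>R u)) x w = dderiv (\<lambda>y. c *\<^sub>R T y u) x w"
    by (rule dderiv_cong[OF _ assms(1,2)]) (use assms in \<open>auto simp: linear_cmul\<close>)
  then show "dderiv (\<lambda>y. T y (c *\<^sub>R u)) x w = c *\<^sub>R dderiv (\<lambda>y. T y u) x w"
    by (simp add: dderiv_bounded_linear[OF bounded_linear_scaleR_right] assms)
qed

lemma linear_dderiv: "f differentiable at x \<Longrightarrow> linear (\<lambda>v. dderiv f x v)"
  using linear_frechet_derivative by blast

subsection \<open>Symmetry of second derivatives\<close>

lemma has_real_derivative_along: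
  fixes f :: "'e::real_normed_vector \<Rightarrow> real"
  assumes "f differentiable at (p + t *\<^sub>R v)"
  shows "((\<lambda>s. f (p + s *\<^sub>R v)) has_real_derivative dderiv f (p + t *\<^sub>R v) v) (at t)"
proof -
  have "((\<lambda>s. p + s *\<^sub>R v) has_derivative (\<lambda>s. s *\<^sub>R v)) (at t)"
    by (auto intro!: derivative_eq_intros)
  from has_derivative_compose[OF this has_derivative_dderiv[OF assms]]
  have "((\<lambda>s. f (p + s *\<^sub>R v)) has_derivative (\<lambda>s. dderiv f (p + t *\<^sub>R v) (s *\<^sub>R v))) (at t)" .
  then show ?thesis
    by (simp add: has_field_derivative_def linear_cmul[OF linear_dderiv[OF assms]] mult_commute_abs)
qed

text \<open>The mean value theorem is used twice: along \<open>v\<close> for the difference of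
  \<open>f\<close> over the shift by h w, then along \<open>w\<close> for the first derivative. The
  second difference itself is symmetric in \<open>v\<close> and \<open>w\<close>.\<close>

lemma second_difference_mean_value:
  fixes f :: "'e::real_normed_vector \<Rightarrow> real"
  assumes h: "h > 0"
    and mem: "\<And>s t. 0 \<le> s \<Longrightarrow> s \<le> h \<Longrightarrow> 0 \<le> t \<Longrightarrow> t \<le> h \<Longrightarrow> x + s *\<^sub>R v + t *\<^sub>R w \<in> S"
    and f: "\<And>y. y \<in> S \<Longrightarrow> f differentiable at y"
    and f': "\<And>y. y \<in> S \<Longrightarrow> (\<lambda>y. dderiv f y v) differentiable at y"
  shows "\<exists>s t. 0 \<le> s \<and> s \<le> h \<and> 0 \<le> t \<and> t \<le> h \<and>
    f (x + h *\<^sub>R v + h *\<^sub>R w) - f (x + h *\<^sub>R v) - f (x + h *\<^sub>R w) + f x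
       = h * h * dderiv (\<lambda>y. dderiv f y v) (x + s *\<^sub>R v + t *\<^sub>R w) w"
proof -
  define \<psi> where "\<psi> s = f ((x + h *\<^sub>R w) + s *\<^sub>R v) - f (x + s *\<^sub>R v)" for s
  have d\<psi>: "(\<psi> has_real_derivative
      (dderiv f ((x + h *\<^sub>R w) + s *\<^sub>R v) v - dderiv f (x + s *\<^sub>R v) v)) (at s)"
    if "0 \<le> s" "s \<le> h" for s
    unfolding \<psi>_def using mem[of s h] mem[of s 0] that h
    by (intro DERIV_diff has_real_derivative_along f) (auto simp: add_ac)
  obtain s where s: "0 < s" "s < h" "\<psi> h - \<psi> 0 =
      (h - 0) * (dderiv f ((x + h *\<^sub>R w) + s *\<^sub>R v) v - dderiv f (x + s *\<^sub>R v) v)"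
    using MVT2[OF h d\<psi>] by blast
  have d\<chi>: "((\<lambda>t. dderiv f ((x + s *\<^sub>R v) + t *\<^sub>R w) v) has_real_derivative
      dderiv (\<lambda>y. dderiv f y v) ((x + s *\<^sub>R v) + t *\<^sub>R w) w) (at t)" if "0 \<le> t" "t \<le> h" for t
    using mem[of s t] that s by (intro has_real_derivative_along f') auto
  obtain t where t: "0 < t" "t < h"
    "dderiv f ((x + s *\<^sub>R v) + h *\<^sub>R w) v - dderiv f ((x + s *\<^sub>R v) + 0 *\<^sub>R w) v =
      (h - 0) * dderiv (\<lambda>y. dderiv f y v) ((x + s *\<^sub>R v) + t *\<^sub>R w) w"
    using MVT2[OF h d\<chi>] by blast
  have "f (x + h *\<^sub>R v + h *\<^sub>R w) - f (x + h *\<^sub>R v) - f (x + h *\<^sub>R w) + f x = \<psi> h - \<psi> 0"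
    by (simp add: \<psi>_def add_ac)
  also have "\<dots> = h * h * dderiv (\<lambda>y. dderiv f y v) (x + s *\<^sub>R v + t *\<^sub>R w) w"
    using s(3) t(3) by (simp add: add_ac)
  finally show ?thesis using s t by (intro exI[of _ s] exI[of _ t]) auto
qed

text \<open>Schwarz's theorem: one and the same second difference is h^2 times either mixed
  derivative at some intermediate point, so a gap at \<open>x\<close> contradicts the continuity of
  both.\<close>

lemma dderiv_commute_real:
  fixes f :: "'e::real_normed_vector \<Rightarrow> real"
  assumes S: "open S" "x \<in> S" and f: "smooth_on_open f S"
  shows "dderiv (\<lambda>y. dderiv f y v) x w = dderiv (\<lambda>y. dderiv f y w) x v"
proof (rule ccontr)
  let ?F = "\<lambda>p. dderiv (\<lambda>y. dderiv f y v) p w" and ?G = "\<lambda>p. dderiv (\<lambda>y. dderiv f y w) p v"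
  assume ne: "?F x \<noteq> ?G x"
  \<comment> \<open>Half the gap: two errors below \<open>e\<close> cannot bridge it.\<close>
  define e where "e = \<bar>?F x - ?G x\<bar> / 2"
  have e: "e > 0" using ne by (simp add: e_def)
  have "continuous_on S ?F" "continuous_on S ?G"
    by (intro smooth_on_open_continuous smooth_on_open_dderiv f)+
  then have "isCont ?F x" "isCont ?G x" using S continuous_on_eq_continuous_at by blast+
  then obtain d1 d2 where d: "d1 > 0" "\<And>y. dist y x < d1 \<Longrightarrow> \<bar>?F y - ?F x\<bar> < e"
    "d2 > 0" "\<And>y. dist y x < d2 \<Longrightarrow> \<bar>?G y - ?G x\<bar> < e"
    unfolding continuous_at_eps_delta dist_real_def using e by metis
  obtain d3 where d3: "d3 > 0" "ball x d3 \<subseteq> S" using S open_contains_ball by blast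
  define r where "r = min d1 (min d2 d3)"
  \<comment> \<open>The added 1 covers the case that both vectors vanish and keeps the parallelogram
    strictly inside the ball of radius \<open>r\<close>.\<close>
  define h where "h = r / (norm v + norm w + 1)"
  have r: "r > 0" using d d3 by (simp add: r_def)
  have np: "norm v + norm w + 1 > 0" by (smt (verit) norm_ge_zero)
  have h: "h > 0" using r np by (simp add: h_def)
  have hr: "h * (norm v + norm w) < r"
  proof -
    have "h * (norm v + norm w) < h * (norm v + norm w + 1)" using h by simp
    also have "\<dots> = r" using np by (simp add: h_def)
    finally show ?thesis .
  qed
  have near: "dist (x + s *\<^sub>R a + t *\<^sub>R b) x < r"
    if "0 \<le> s" "s \<le> h" "0 \<le> t" "t \<le> h" "norm a + norm b = norm v + norm w" for s t a b
  proof -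
    have "dist (x + s *\<^sub>R a + t *\<^sub>R b) x \<le> s * norm a + t * norm b"
      using norm_triangle_ineq[of "s *\<^sub>R a" "t *\<^sub>R b"] that by (simp add: dist_norm)
    also have "\<dots> \<le> h * norm a + h * norm b"
      using that by (intro add_mono mult_right_mono) auto
    also have "\<dots> < r" using hr that(5) by (simp flip: distrib_left)
    finally show ?thesis .
  qed
  have mem: "x + s *\<^sub>R a + t *\<^sub>R b \<in> S"
    if "0 \<le> s" "s \<le> h" "0 \<le> t" "t \<le> h" "norm a + norm b = norm v + norm w" for s t a b
    using near[OF that] d3 by (auto simp: r_def subset_iff dist_commute)
  note sm = smooth_on_open_differentiable[OF f]
    smooth_on_open_differentiable[OF smooth_on_open_dderiv[OF f]]
  have "\<exists>s t. 0 \<le> s \<and> s \<le> h \<and> 0 \<le> t \<and> t \<le> h \<and>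
    f (x + h *\<^sub>R v + h *\<^sub>R w) - f (x + h *\<^sub>R v) - f (x + h *\<^sub>R w) + f x
       = h * h * ?F (x + s *\<^sub>R v + t *\<^sub>R w)"
    by (intro second_difference_mean_value[where S = S] h mem sm) auto
  then obtain s t where 1: "0 \<le> s" "s \<le> h" "0 \<le> t" "t \<le> h"
    "f (x + h *\<^sub>R v + h *\<^sub>R w) - f (x + h *\<^sub>R v) - f (x + h *\<^sub>R w) + f x
       = h * h * ?F (x + s *\<^sub>R v + t *\<^sub>R w)" by blast
  have "\<exists>s' t'. 0 \<le> s' \<and> s' \<le> h \<and> 0 \<le> t' \<and> t' \<le> h \<and>
    f (x + h *\<^sub>R w + h *\<^sub>R v) - f (x + h *\<^sub>R w) - f (x + h *\<^sub>R v) + f x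
       = h * h * ?G (x + s' *\<^sub>R w + t' *\<^sub>R v)"
    by (intro second_difference_mean_value[where S = S] h mem sm) auto
  then obtain s' t' where 2: "0 \<le> s'" "s' \<le> h" "0 \<le> t'" "t' \<le> h"
    "f (x + h *\<^sub>R w + h *\<^sub>R v) - f (x + h *\<^sub>R w) - f (x + h *\<^sub>R v) + f x
       = h * h * ?G (x + s' *\<^sub>R w + t' *\<^sub>R v)" by blast
  have "h * h * ?F (x + s *\<^sub>R v + t *\<^sub>R w) = h * h * ?G (x + s' *\<^sub>R w + t' *\<^sub>R v)"
    using 1(5) 2(5) unfolding add.assoc add.commute[of "h *\<^sub>R v" "h *\<^sub>R w"] by linarith
  then have "?F (x + s *\<^sub>R v + t *\<^sub>R w) = ?G (x + s' *\<^sub>R w + t' *\<^sub>R v)" using h by simp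
  moreover have "\<bar>?F (x + s *\<^sub>R v + t *\<^sub>R w) - ?F x\<bar> < e" "\<bar>?G (x + s' *\<^sub>R w + t' *\<^sub>R v) - ?G x\<bar> < e"
    using near[OF 1(1-4), of v w] near[OF 2(1-4), of w v] d by (auto simp: r_def add_ac)
  ultimately show False unfolding e_def by (smt (verit) field_sum_of_halves)
qed

lemma dderiv_commute:
  fixes f :: "'e::real_normed_vector \<Rightarrow> real ^ 'n::finite"
  assumes S: "open S" "x \<in> S" and f: "smooth_on_open f S"
  shows "dderiv (\<lambda>y. dderiv f y v) x w = dderiv (\<lambda>y. dderiv f y w) x v"
proof (rule vec_eq_iff[THEN iffD2, rule_format])
  fix i
  have *: "dderiv (\<lambda>y. dderiv f y v) x w $ i = dderiv (\<lambda>y. dderiv (\<lambda>z. f z $ i) y v) x w" for v w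
  proof -
    have "dderiv (\<lambda>y. dderiv (\<lambda>z. f z $ i) y v) x w = dderiv (\<lambda>y. dderiv f y v $ i) x w"
      by (rule dderiv_cong[OF _ S])
        (use smooth_on_open_differentiable[OF smooth_on_open_dderiv[OF smooth_on_open_nth[OF S(1) f]] S(2)]
          dderiv_nth[OF smooth_on_open_differentiable[OF f]] in auto)
    then show ?thesis
      using dderiv_nth[OF smooth_on_open_differentiable[OF smooth_on_open_dderiv[OF f] S(2)]] by simp
  qed
  show "dderiv (\<lambda>y. dderiv f y v) x w $ i = dderiv (\<lambda>y. dderiv f y w) x v $ i"
    unfolding * by (rule dderiv_commute_real[OF S smooth_on_open_nth[OF S(1) f]])
qed

section \<open>Algebra of a tangent space\<close>

text \<open>The metric at a point is unrelated to the standard inner product of the coordinate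
  space, so orthonormality and traces are developed for an arbitrary positive definite
  \<open>h\<close>.\<close>

locale inner_form =
  fixes h :: "real ^ 'n::finite \<Rightarrow> real ^ 'n \<Rightarrow> real"
  assumes h_bilinear: "bilinear h"
    and h_sym: "h u v = h v u"
    and h_pos: "u \<noteq> 0 \<Longrightarrow> h u u > 0"
begin

lemmas h_simps = bilinear_ladd[OF h_bilinear] bilinear_radd[OF h_bilinear]
  bilinear_lsub[OF h_bilinear] bilinear_rsub[OF h_bilinear]
  bilinear_lmul[OF h_bilinear, unfolded real_scaleR_def]
  bilinear_rmul[OF h_bilinear, unfolded real_scaleR_def]
  bilinear_lneg[OF h_bilinear] bilinear_rneg[OF h_bilinear]
  bilinear_lzero[OF h_bilinear] bilinear_rzero[OF h_bilinear]

lemma linear_h: "linear (h u)" "linear (\<lambda>v. h v u)"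
  using h_bilinear by (auto simp: bilinear_def)

lemma h_sum: "h (\<Sum>i\<in>I. f i) v = (\<Sum>i\<in>I. h (f i) v)" "h v (\<Sum>i\<in>I. f i) = (\<Sum>i\<in>I. h v (f i))"
  using linear_sum[OF linear_h(2)] linear_sum[OF linear_h(1)] by auto

lemma h_eqI: "(\<And>v. h u v = h w v) \<Longrightarrow> u = w"
  using h_pos[of "u - w"] by (auto simp: h_simps)

definition orthonormal :: "(real ^ 'n) set \<Rightarrow> bool" where
  "orthonormal E \<longleftrightarrow> finite E \<and> (\<forall>e\<in>E. \<forall>f\<in>E. h e f = (if e = f then 1 else 0))"

lemma orthonormal_independent:
  assumes "orthonormal E"
  shows "independent E"
proof -
  have "finite E" using assms by (simp add: orthonormal_def)
  moreover have "c e = 0" if "e \<in> E" "(\<Sum>f\<in>E. c f *\<^sub>R f) = 0" for c e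
  proof -
    have "0 = h (\<Sum>f\<in>E. c f *\<^sub>R f) e" using that(2) by (simp add: h_simps)
    also have "\<dots> = (\<Sum>f\<in>E. if f = e then c f else 0)"
      unfolding h_sum by (intro sum.cong refl) (use assms that(1) in \<open>auto simp: h_simps orthonormal_def\<close>)
    also have "\<dots> = c e" using \<open>finite E\<close> that(1) by simp
    finally show ?thesis by simp
  qed
  ultimately show ?thesis by (auto simp: independent_explicit)
qed

text \<open>One basis is fixed by choice, so that contractions become plain sums. It depends on the
  point without any regularity; derivatives are therefore never taken of such sums, only of
  coordinate traces.\<close>

definition onb :: "(real ^ 'n) set" where
  "onb = (SOME E. orthonormal E \<and> (\<forall>x. x = (\<Sum>e\<in>E. h x e *\<^sub>R e)))"

text \<open>An orthonormal set of largest size does it: a vector different from its expansion leaves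
  a remainder orthogonal to the set, and normalizing that remainder would enlarge the set.\<close>

lemma ex_onb: "\<exists>E. orthonormal E \<and> (\<forall>x. x = (\<Sum>e\<in>E. h x e *\<^sub>R e))"
proof -
  let ?P = "\<lambda>k. \<exists>E. orthonormal E \<and> card E = k"
  have bound: "k \<le> CARD('n)" if "?P k" for k
    using that independent_bound[OF orthonormal_independent] by auto
  have "?P 0" by (auto simp: orthonormal_def intro!: exI[of _ "{}"])
  then obtain k where k: "?P k" "\<And>l. ?P l \<Longrightarrow> l \<le> k"
    using GreatestI_nat[of ?P 0 "CARD('n)"] Greatest_le_nat[of ?P _ "CARD('n)"] bound by blast
  then obtain E where E: "orthonormal E" "card E = k" by blast
  note fin = E(1)[unfolded orthonormal_def, THEN conjunct1]
  have "x = (\<Sum>e\<in>E. h x e *\<^sub>R e)" for x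
  proof (rule ccontr)
    assume ne: "x \<noteq> (\<Sum>e\<in>E. h x e *\<^sub>R e)"
    define y where "y = x - (\<Sum>e\<in>E. h x e *\<^sub>R e)"
    have y: "h y y > 0" using ne by (intro h_pos) (simp add: y_def)
    have orth: "h y f = 0" if "f \<in> E" for f
    proof -
      have "h (\<Sum>e\<in>E. h x e *\<^sub>R e) f = (\<Sum>e\<in>E. if e = f then h x f else 0)"
        unfolding h_sum by (intro sum.cong refl) (use E that in \<open>auto simp: h_simps orthonormal_def\<close>)
      then show ?thesis using fin that by (simp add: y_def h_simps)
    qed
    define z where "z = inverse (sqrt (h y y)) *\<^sub>R y"
    have "inverse (sqrt (h y y)) * inverse (sqrt (h y y)) * h y y = 1"
      using y by (simp add: field_simps)
    then have z: "h z z = 1" "\<And>f. f \<in> E \<Longrightarrow> h z f = 0" "\<And>f. f \<in> E \<Longrightarrow> h f z = 0"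
      using orth h_sym by (auto simp: z_def h_simps mult.assoc)
    have "z \<notin> E" using z by force
    moreover have "orthonormal (insert z E)"
      using E(1) z unfolding orthonormal_def by auto
    ultimately have "?P (Suc k)" using E(2) fin by (intro exI[of _ "insert z E"]) auto
    then show False using k(2) by force
  qed
  then show ?thesis using E by blast
qed

lemma onb: "orthonormal onb" "x = (\<Sum>e\<in>onb. h x e *\<^sub>R e)"
  using someI_ex[OF ex_onb] unfolding onb_def by blast+

lemma finite_onb [simp]: "finite onb"
  using onb(1) by (simp add: orthonormal_def)

lemma onb_delta: "e \<in> onb \<Longrightarrow> f \<in> onb \<Longrightarrow> h e f = (if e = f then 1 else 0)"
  using onb(1) by (simp add: orthonormal_def)

lemma card_onb: "card onb = CARD('n)"
proof -
  have "span onb = UNIV"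
  proof -
    have "(\<Sum>e\<in>onb. h x e *\<^sub>R e) \<in> span onb" for x
      by (intro span_sum span_scale span_base)
    then have "x \<in> span onb" for x by (simp add: onb(2)[symmetric])
    then show ?thesis by auto
  qed
  then have "card onb = dim (UNIV :: (real ^ 'n) set)"
    using dim_span_eq_card_independent[OF orthonormal_independent[OF onb(1)]] by simp
  then show ?thesis by simp
qed

lemma onb_expand:
  assumes "linear f"
  shows "(\<Sum>e\<in>onb. h x e * f e) = f x" "(\<Sum>e\<in>onb. h e x * f e) = f x"
    "(\<Sum>e\<in>onb. f e * h x e) = f x" "(\<Sum>e\<in>onb. f e * h e x) = f x"
proof -
  have "f x = f (\<Sum>e\<in>onb. h x e *\<^sub>R e)" by (rule arg_cong[OF onb(2)])
  then show *: "(\<Sum>e\<in>onb. h x e * f e) = f x"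
    by (simp add: linear_sum[OF assms] linear_cmul[OF assms])
  then show "(\<Sum>e\<in>onb. h e x * f e) = f x" by (simp add: h_sym[of _ x])
  with * show "(\<Sum>e\<in>onb. f e * h x e) = f x" "(\<Sum>e\<in>onb. f e * h e x) = f x"
    by (simp_all add: mult.commute)
qed

text \<open>Expanding \<open>S e\<close> in the basis and exchanging the two sums moves an operator
  from one slot to its adjoint in the other.\<close>

lemma trace_adjoint:
  assumes b: "bilinear b" and S: "\<And>u v. h (S u) v = h u (S' v)"
  shows "(\<Sum>e\<in>onb. b (S e) e) = (\<Sum>e\<in>onb. b e (S' e :: real ^ 'n) :: real)"
proof -
  have lin: "linear (\<lambda>x. b x e)" "linear (b e)" for e using b by (auto simp: bilinear_def)
  have "(\<Sum>e\<in>onb. b (S e) e) = (\<Sum>e\<in>onb. \<Sum>f\<in>onb. h (S e) f * b f e)"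
    using onb_expand(1)[OF lin(1)] by simp
  also have "\<dots> = (\<Sum>f\<in>onb. \<Sum>e\<in>onb. h e (S' f) * b f e)"
    by (subst sum.swap) (simp add: S)
  also have "\<dots> = (\<Sum>f\<in>onb. b f (S' f))"
    using onb_expand(2)[OF lin(2)] by simp
  finally show ?thesis .
qed

lemma trace_h: "(\<Sum>e\<in>onb. h e e) = real CARD('n)"
  using onb_delta card_onb by simp

lemma metric_trace_eq:
  assumes b: "bilinear b"
  shows "metric_trace h b = (\<Sum>e\<in>onb. b e e)"
proof -
  define M :: "real ^ 'n ^ 'n" where "M = (\<chi> k l. h (axis k 1) (axis l 1))"
  have M: "(M *v x) $ i = h (axis i 1) x" for x i
    using linear_axis_expansion[OF linear_h(1), of "axis i 1" x]
    by (simp add: M_def matrix_vector_mult_def mult.commute)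
  have "x = 0" if "M *v x = 0" for x
  proof -
    have "h x x = 0"
      using linear_axis_expansion[OF linear_h(2), of x x] M[of x] that by simp
    then show ?thesis using h_pos by force
  qed
  then have "invertible M"
    using matrix_left_invertible_ker invertible_left_inverse by blast
  then have inv: "matrix_inv M ** M = mat 1"
    unfolding invertible_def matrix_inv_def by (rule someI2_ex) simp
  have lin: "linear (\<lambda>x. b x e)" "linear (b e)" for e using b by (auto simp: bilinear_def)
  \<comment> \<open>The inverse Gram matrix turns the covector of \<open>f\<close> back into the
    components of \<open>f\<close>; this identifies the coordinate contraction with the orthonormal
    one.\<close>
  have key: "(\<Sum>i\<in>UNIV. \<Sum>j\<in>UNIV. matrix_inv M $ i $ j * (h (axis i 1) e * h (axis j 1) f)) = h e f"
    for e f
  proof -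
    have "(\<Sum>j\<in>UNIV. matrix_inv M $ i $ j * h (axis j 1) f) = f $ i" for i
    proof -
      have "(\<Sum>j\<in>UNIV. matrix_inv M $ i $ j * h (axis j 1) f) = (matrix_inv M *v (M *v f)) $ i"
        by (simp add: matrix_vector_mult_def[of "matrix_inv M"] M)
      then show ?thesis by (simp add: matrix_vector_mul_assoc inv)
    qed
    then have "(\<Sum>i\<in>UNIV. \<Sum>j\<in>UNIV. matrix_inv M $ i $ j * (h (axis i 1) e * h (axis j 1) f))
        = (\<Sum>i\<in>UNIV. h (axis i 1) e * f $ i)"
      by (simp add: mult.left_commute sum_distrib_left[symmetric])
    also have "\<dots> = h e f"
      using linear_axis_expansion[OF linear_h(1), of e f] by (simp add: mult.commute h_sym[of e])
    finally show ?thesis .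
  qed
  have bxy: "b x y = (\<Sum>e\<in>onb. \<Sum>f\<in>onb. h x e * h y f * b e f)" for x y
    by (subst onb_expand(1)[OF lin(1), symmetric], subst onb_expand(1)[OF lin(2), symmetric])
      (simp add: mult.assoc sum_distrib_left)
  have "metric_trace h b = (\<Sum>i\<in>UNIV. \<Sum>j\<in>UNIV. matrix_inv M $ i $ j *
      (\<Sum>e\<in>onb. \<Sum>f\<in>onb. h (axis i 1) e * h (axis j 1) f * b e f))"
    unfolding metric_trace_def M_def[symmetric]
    by (intro sum.cong refl arg_cong2[where f = "(*)"] bxy)
  also have "\<dots> = (\<Sum>i\<in>UNIV. \<Sum>j\<in>UNIV. \<Sum>e\<in>onb. \<Sum>f\<in>onb.
      (matrix_inv M $ i $ j * (h (axis i 1) e * h (axis j 1) f)) * b e f)"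
    by (simp add: sum_distrib_left mult.assoc)
  also have "\<dots> = (\<Sum>e\<in>onb. \<Sum>f\<in>onb. \<Sum>i\<in>UNIV. \<Sum>j\<in>UNIV.
      (matrix_inv M $ i $ j * (h (axis i 1) e * h (axis j 1) f)) * b e f)"
    by (simp only: sum.swap[of _ UNIV onb])
  also have "\<dots> = (\<Sum>e\<in>onb. \<Sum>f\<in>onb. h e f * b e f)"
    by (simp add: sum_distrib_right[symmetric] key)
  also have "\<dots> = (\<Sum>e\<in>onb. b e e)"
    using onb_expand(1)[OF lin(2)] by simp
  finally show ?thesis .
qed

text \<open>The left-hand side can be differentiated without differentiating the inverse metric.\<close>

lemma coordinate_trace:
  assumes "linear T"
  shows "(\<Sum>i\<in>UNIV. T (axis i 1) $ i) = (\<Sum>e\<in>onb. h (T e) e)"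
proof -
  have l: "linear (\<lambda>x. T x $ i)" for i
    using linear_compose[OF assms bounded_linear.linear[OF bounded_linear_vec_nth[of i]]] by (simp add: o_def)
  have "(\<Sum>i\<in>UNIV. T (axis i 1) $ i) = (\<Sum>i\<in>UNIV. \<Sum>e\<in>onb. h (axis i 1) e * T e $ i)"
    using onb_expand(1)[OF l] by simp
  also have "\<dots> = (\<Sum>e\<in>onb. \<Sum>i\<in>UNIV. T e $ i * h (axis i 1) e)"
    by (subst sum.swap) (simp add: mult.commute)
  also have "\<dots> = (\<Sum>e\<in>onb. h (T e) e)"
    by (simp add: linear_axis_expansion[OF linear_h(2), symmetric, unfolded real_scaleR_def])
  finally show ?thesis .
qed

lemma riesz:
  assumes "linear f"
  shows "\<exists>!t. \<forall>v. h t v = f v"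
proof (rule ex_ex1I)
  show "\<exists>t. \<forall>v. h t v = f v"
    by (rule exI[of _ "\<Sum>e\<in>onb. f e *\<^sub>R e"]) (simp add: h_sum h_simps onb_expand(4)[OF assms])
  show "t = t'" if "\<forall>v. h t v = f v" "\<forall>v. h t' v = f v" for t t'
    by (rule h_eqI) (use that in simp)
qed

end

text \<open>The Kaehler analogue of the Kulkarni-Nomizu product of \<open>h\<close> and
  \<open>F\<close>. For \<open>F = h\<close> it is twice the tensor of constant holomorphic
  sectional curvature 4.\<close>

definition kaehler_product ::
  "(real ^ 'n::finite \<Rightarrow> real ^ 'n \<Rightarrow> real) \<Rightarrow> (real ^ 'n \<Rightarrow> real ^ 'n) \<Rightarrow>
   (real ^ 'n \<Rightarrow> real ^ 'n \<Rightarrow> real) \<Rightarrow> 'n tensor4" where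
  "kaehler_product h j F a b c d =
     h b c * F a d - h a c * F b d + F b c * h a d - F a c * h b d
   + h (j b) c * F (j a) d - h (j a) c * F (j b) d + F (j b) c * h (j a) d - F (j a) c * h (j b) d
   - 2 * (h (j a) b * F (j c) d) - 2 * (F (j a) b * h (j c) d)"

section \<open>Multilinear bookkeeping and symmetries of curvature tensors\<close>

lemma bilinearI:
  "(\<And>v. linear (\<lambda>u. b u v)) \<Longrightarrow> (\<And>u. linear (b u)) \<Longrightarrow> bilinear b"
  by (simp add: bilinear_def)

lemma linear_real_simps:
  fixes f :: "'a::real_vector \<Rightarrow> real"
  assumes "linear f"
  shows "f (u + v) = f u + f v" "f (u - v) = f u - f v" "f (- u) = - f u" "f (c *\<^sub>R u) = c * f u"
    "f 0 = 0" "f (\<Sum>i\<in>I. g i) = (\<Sum>i\<in>I. f (g i))"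
  using linear_add[OF assms] linear_diff[OF assms] linear_neg[OF assms] linear_cmul[OF assms]
    linear_0[OF assms] linear_sum[OF assms] by auto

lemma linear_rmult: "linear f \<Longrightarrow> linear (\<lambda>x. f x * (c::real))"
  by (intro linearI) (simp_all add: linear_real_simps algebra_simps)

lemma linear_lmult: "linear f \<Longrightarrow> linear (\<lambda>x. (c::real) * f x)"
  by (intro linearI) (simp_all add: linear_real_simps algebra_simps)

lemma linear_comp: "linear f \<Longrightarrow> linear g \<Longrightarrow> linear (\<lambda>x. f (g x))"
  using linear_compose[of g f] by (simp add: o_def)

lemmas linear_intros = linear_compose_add linear_compose_sub linear_compose_neg linear_rmult
  linear_lmult linear_compose_sum

lemma multilinear4D:
  assumes "multilinear4 T"
  shows "linear (\<lambda>v. T v b c d)" "linear (\<lambda>v. T a v c d)" "linear (\<lambda>v. T a b v d)"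
    "linear (\<lambda>v. T a b c v)" "linear (T a b c)"
  using assms unfolding multilinear4_def by auto

lemma kaehler_curvature_tensorD:
  assumes "kaehler_curvature_tensor j T"
  shows "multilinear4 T" "T a b c d = - T b a c d" "T a b c d = - T a b d c"
    "T a b c d + T b c a d + T c a b d = 0" "T (j a) (j b) c d = T a b c d"
  using assms unfolding kaehler_curvature_tensor_def by blast+

text \<open>The octahedron argument: the first Bianchi identities of the four cyclic shifts of a, b,
  c, d combine, by the two antisymmetries, to twice the claim.\<close>

lemma curvature_pair_symmetry:
  fixes T :: "'n::finite tensor4"
  assumes 1: "\<And>a b c d. T a b c d = - T b a c d" and 2: "\<And>a b c d. T a b c d = - T a b d c"
    and 3: "\<And>a b c d. T a b c d + T b c a d + T c a b d = 0"
  shows "T a b c d = T c d a b"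
  using 3[of a b c d] 3[of b c d a] 3[of c d a b] 3[of d a b c]
    2[of b c a d] 2[of c d a b] 1[of d b c a] 1[of d a c b] 2[of a d c b]
    1[of a c d b] 2[of c a d b] 1[of d a b c] 2[of a b c d] 2[of b d c a] 2[of c a b d]
  by linarith

lemma kaehler_curvature_tensor_pair:
  assumes "kaehler_curvature_tensor j T"
  shows "T a b c d = T c d a b"
  by (rule curvature_pair_symmetry) (use kaehler_curvature_tensorD[OF assms] in blast)+

lemma kaehler_curvature_tensor_diff:
  assumes "kaehler_curvature_tensor j S" "kaehler_curvature_tensor j T"
  shows "kaehler_curvature_tensor j (\<lambda>a b c d. S a b c d - T a b c d)"
proof -
  note S = kaehler_curvature_tensorD[OF assms(1)] and T = kaehler_curvature_tensorD[OF assms(2)]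
  have "multilinear4 (\<lambda>a b c d. S a b c d - T a b c d)"
    using S(1) T(1) by (simp add: multilinear4_def linear_compose_sub)
  moreover have "S a b c d - T a b c d = - (S b a c d - T b a c d)"
    "S a b c d - T a b c d = - (S a b d c - T a b d c)"
    "S a b c d - T a b c d + (S b c a d - T b c a d) + (S c a b d - T c a b d) = 0"
    "S (j a) (j b) c d - T (j a) (j b) c d = S a b c d - T a b c d" for a b c d
    using S(2)[of a b c d] T(2)[of a b c d] S(3)[of a b c d] T(3)[of a b c d]
      S(4)[of a b c d] T(4)[of a b c d] S(5)[of a b c d] T(5)[of a b c d] by simp_all
  ultimately show ?thesis unfolding kaehler_curvature_tensor_def by blast
qed

locale hermitian_form = inner_form h for h :: "real ^ 'n::finite \<Rightarrow> real ^ 'n \<Rightarrow> real" +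
  fixes j :: "real ^ 'n \<Rightarrow> real ^ 'n"
  assumes linear_j: "linear j"
    and jj: "j (j u) = - u"
    and h_j: "h (j u) (j v) = h u v"
begin

lemma h_j_skew: "h (j u) v = - h u (j v)"
  using h_j[of u "j v"] by (simp add: jj h_simps)

lemma h_j_right: "h u (j v) = - h (j u) v"
  by (simp add: h_j_skew)

lemma h_j_swap: "h (j u) v = - h (j v) u"
  using h_j_skew[of u v] h_sym[of u "j v"] by simp

lemma h_j_self: "h (j u) u = 0" "h u (j u) = 0"
  using h_j_swap[of u u] h_sym[of u "j u"] by simp_all

lemmas j_simps = linear_add[OF linear_j] linear_diff[OF linear_j] linear_neg[OF linear_j]
  linear_cmul[OF linear_j]

definition hermitian_sym :: "(real ^ 'n \<Rightarrow> real ^ 'n \<Rightarrow> real) \<Rightarrow> bool" where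
  "hermitian_sym F \<longleftrightarrow> bilinear F \<and> (\<forall>u v. F u v = F v u) \<and> (\<forall>u v. F (j u) (j v) = F u v)"

lemma hermitian_symD:
  assumes "hermitian_sym F"
  shows "bilinear F" "F u v = F v u" "F (j u) (j v) = F u v" "F u (j v) = - F (j u) v"
    "F (j u) v = - F (j v) u" "linear (F u)" "linear (\<lambda>v. F v u)"
proof -
  show b: "bilinear F" and s: "F u v = F v u" and i: "F (j u) (j v) = F u v" for u v
    using assms unfolding hermitian_sym_def by blast+
  show sk: "F u (j v) = - F (j u) v"
    using i[of u "j v"] by (simp add: jj bilinear_rneg[OF b])
  show "F (j u) v = - F (j v) u" using sk s[of u "j v"] by simp
  show "linear (F u)" "linear (\<lambda>v. F v u)" using b by (auto simp: bilinear_def)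
qed

lemma hermitian_sym_h: "hermitian_sym h"
  unfolding hermitian_sym_def using h_bilinear h_sym h_j by blast

lemma trace_j:
  assumes "bilinear b"
  shows "(\<Sum>e\<in>onb. b (j e) e) = - (\<Sum>e\<in>onb. b e (j e) :: real)"
proof -
  have "(\<Sum>e\<in>onb. b (j e) e) = (\<Sum>e\<in>onb. b e (- j e))"
    by (rule trace_adjoint[OF assms]) (simp add: h_j_skew h_simps)
  then show ?thesis by (simp add: bilinear_rneg[OF assms] sum_negf)
qed

lemma trace_jj:
  assumes "bilinear b"
  shows "(\<Sum>e\<in>onb. b (j e) (j e)) = (\<Sum>e\<in>onb. b e e :: real)"
proof -
  have "bilinear (\<lambda>x y. b x (j y))"
    using assms linear_comp[OF _ linear_j] by (auto simp: bilinear_def)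
  from trace_j[OF this] show ?thesis by (simp add: jj bilinear_rneg[OF assms] sum_negf)
qed

lemma trace_hermitian_j: "hermitian_sym F \<Longrightarrow> (\<Sum>e\<in>onb. F (j e) e) = 0"
  by (rule sum.neutral) (metis hermitian_symD(5) equal_neg_zero)

subsection \<open>The Kaehler product\<close>

lemma kaehler_product_curvature:
  assumes F: "hermitian_sym F"
  shows "kaehler_curvature_tensor j (kaehler_product h j F)"
proof -
  note F' = hermitian_symD[OF F] and H' = hermitian_symD[OF hermitian_sym_h]
  have "multilinear4 (kaehler_product h j F)"
    unfolding multilinear4_def kaehler_product_def
    by (intro allI conjI linear_intros F'(6,7) H'(6,7) linear_comp[OF F'(7) linear_j]
        linear_comp[OF F'(6) linear_j] linear_comp[OF H'(7) linear_j] linear_comp[OF H'(6) linear_j])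
  moreover have "kaehler_product h j F a b c d = - kaehler_product h j F b a c d" for a b c d
    unfolding kaehler_product_def using F'(5)[of b a] H'(5)[of b a] by (simp add: algebra_simps)
  moreover have "kaehler_product h j F a b c d = - kaehler_product h j F a b d c" for a b c d
    unfolding kaehler_product_def using F'(5)[of d c] H'(5)[of d c] by (simp add: algebra_simps)
  moreover have "kaehler_product h j F a b c d + kaehler_product h j F b c a d
      + kaehler_product h j F c a b d = 0" for a b c d
    unfolding kaehler_product_def
    using F'(5)[of c a] H'(5)[of c a] F'(5)[of b a] H'(5)[of b a] F'(5)[of c b] H'(5)[of c b]
      F'(2)[of c a] H'(2)[of c a] F'(2)[of b a] H'(2)[of b a] F'(2)[of c b] H'(2)[of c b]
    by (simp add: algebra_simps)
  moreover have "kaehler_product h j F (j a) (j b) c d = kaehler_product h j F a b c d" for a b c d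
    unfolding kaehler_product_def
    by (simp add: jj j_simps H'(3,4) F'(3,4) h_simps bilinear_lneg[OF F'(1)])
  ultimately show ?thesis unfolding kaehler_curvature_tensor_def by blast
qed

lemma kaehler_product_contraction:
  assumes F: "hermitian_sym F"
  shows "(\<Sum>e\<in>onb. kaehler_product h j F e b c e)
    = (real CARD('n) + 4) * F b c + (\<Sum>e\<in>onb. F e e) * h b c"
proof -
  note F' = hermitian_symD[OF F] and H' = hermitian_symD[OF hermitian_sym_h]
  \<comment> \<open>Where \<open>e\<close> is paired with a fixed vector, \<open>j\<close> is moved
    to the latter, so that the basis expansion applies. The other terms are the traces of
    \<open>F\<close> and \<open>h\<close> and the vanishing traces of \<open>F (j e) e\<close> and
    \<open>h (j e) e\<close>.\<close>
  have eq: "kaehler_product h j F e b c e = h b c * F e e - h e c * F b e + F b c * h e e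
      - F e c * h b e + h (j b) c * F (j e) e + h e (j c) * F (j b) e + F (j b) c * h (j e) e
      + F e (j c) * h (j b) e + 2 * (h e (j b) * F (j c) e) + 2 * (F e (j b) * h (j c) e)" for e
    unfolding kaehler_product_def by (simp add: F'(4) H'(4))
  show ?thesis
    unfolding eq
    by (simp add: sum.distrib sum_subtractf sum_distrib_left[symmetric] onb_expand F'(6,7)
        trace_h trace_hermitian_j[OF F] trace_hermitian_j[OF hermitian_sym_h])
      (simp add: F'(2)[of c b] F'(3) F'(2)[of "j c" "j b"] algebra_simps)
qed

subsection \<open>Contractions of Kaehler curvature tensors\<close>

context
  fixes T :: "'n tensor4"
  assumes T: "kaehler_curvature_tensor j T"
begin

lemmas T_simps = kaehler_curvature_tensorD[OF T]

lemma curvature_bilinear: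
  "bilinear (\<lambda>x y. T x b c y)" "bilinear (\<lambda>x y. T b x c y)" "bilinear (\<lambda>x y. T x y b c)"
  "bilinear (\<lambda>x y. T b c x y)" "bilinear (\<lambda>x y. T x b y c)" "bilinear (\<lambda>x y. T b x y c)"
  by (intro bilinearI multilinear4D[OF T_simps(1)])+

lemma curvature_j_right: "T a b (j c) (j d) = T a b c d"
  using kaehler_curvature_tensor_pair[OF T, of a b "j c" "j d"]
    kaehler_curvature_tensor_pair[OF T, of c d a b] T_simps(5) by simp

lemma curvature_j_left_move: "T (j a) b c d = - T a (j b) c d"
  using T_simps(5)[of a "j b" c d]
  by (simp add: jj linear_real_simps(3)[OF multilinear4D(2)[OF T_simps(1)]])

lemma curvature_j_right_move: "T a b (j c) d = - T a b c (j d)"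
  using curvature_j_right[of a b c "j d"]
  by (simp add: jj linear_real_simps(3)[OF multilinear4D(4)[OF T_simps(1)]])

lemma contraction_sym: "(\<Sum>e\<in>onb. T e b c e) = (\<Sum>e\<in>onb. T e c b e)"
proof (rule sum.cong[OF refl])
  fix e
  show "T e b c e = T e c b e"
    using kaehler_curvature_tensor_pair[OF T, of e b c e] T_simps(2)[of c e e b]
      T_simps(3)[of e c e b] by simp
qed

lemma contraction_j: "(\<Sum>e\<in>onb. T e (j b) (j c) e) = (\<Sum>e\<in>onb. T e b c e)"
proof -
  have "T e (j b) (j c) e = T (j e) b c (j e)" for e
    by (simp add: curvature_j_left_move curvature_j_right_move)
  then show ?thesis using trace_jj[OF curvature_bilinear(1)] by simp
qed

lemma contraction_hermitian: "hermitian_sym (\<lambda>b c. \<Sum>e\<in>onb. T e b c e)"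
  unfolding hermitian_sym_def
  by (intro conjI allI contraction_sym contraction_j bilinearI linear_compose_sum ballI
      multilinear4D[OF T_simps(1)])

text \<open>The first Bianchi identity splits the left side into two contractions, which agree
  because \<open>j\<close> is skew under the trace. With the pairs exchanged this presents the Ricci
  form as a trace over e, Je, the shape in which the second Bianchi identity yields its
  closedness.\<close>

lemma contraction_form: "(\<Sum>e\<in>onb. T e (j e) b c) = - 2 * (\<Sum>e\<in>onb. T e (j b) c e)"
proof -
  have 1: "(\<Sum>e\<in>onb. T (j e) b e c) = - (\<Sum>e\<in>onb. T e b (j e) c)"
    by (rule trace_j[OF curvature_bilinear(5)])
  have 2: "T e b (j e) c = T e b (j c) e" for e
    using curvature_j_right_move[of e b e c] T_simps(3)[of e b e "j c"] by simp
  have "T e (j e) b c = - T (j e) b e c - T b e (j e) c" for e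
    using T_simps(4)[of e "j e" b c] by simp
  also have "\<dots> e = - T (j e) b e c + T e b (j e) c" for e
    using T_simps(2)[of b e "j e" c] by simp
  finally have "(\<Sum>e\<in>onb. T e (j e) b c) = 2 * (\<Sum>e\<in>onb. T e b (j c) e)"
    by (simp add: sum.distrib sum_negf sum_subtractf 1 2)
  then show ?thesis using hermitian_symD(4)[OF contraction_hermitian] by simp
qed

lemma contraction_form': "(\<Sum>e\<in>onb. T b c e (j e)) = - 2 * (\<Sum>e\<in>onb. T e (j b) c e)"
  using contraction_form kaehler_curvature_tensor_pair[OF T, of b c] by simp

end

lemma ricci_contraction_eq:
  assumes "kaehler_curvature_tensor j T"
  shows "ricci_contraction h T u v = (\<Sum>e\<in>onb. T e u v e)"
  unfolding ricci_contraction_def by (rule metric_trace_eq[OF curvature_bilinear(1)[OF assms]])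

text \<open>By the symmetries of \<open>T\<close> each of these is a multiple of a Ricci
  contraction, possibly with \<open>j\<close> in an argument. The list covers the contractions that
  the summands of a Kaehler product produce.\<close>

lemma trace_free_contractions:
  assumes T: "kaehler_curvature_tensor j T" and tf: "\<And>b c. (\<Sum>e\<in>onb. T e b c e) = 0"
  shows "(\<Sum>e\<in>onb. T x e e y) = 0" "(\<Sum>e\<in>onb. T e x e y) = 0" "(\<Sum>e\<in>onb. T x e y e) = 0"
    "(\<Sum>e\<in>onb. T e (j e) x y) = 0" "(\<Sum>e\<in>onb. T x y e (j e)) = 0"
    "(\<Sum>e\<in>onb. T e x y (j e)) = 0" "(\<Sum>e\<in>onb. T x e (j e) y) = 0"
    "(\<Sum>e\<in>onb. T e x (j e) y) = 0" "(\<Sum>e\<in>onb. T x e y (j e)) = 0"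
proof -
  note D = kaehler_curvature_tensorD[OF T]
  have "T x e e y = T e x y e" for e using D(2)[of x e e y] D(3)[of e x e y] by simp
  then show "(\<Sum>e\<in>onb. T x e e y) = 0" using tf by simp
  show "(\<Sum>e\<in>onb. T e x e y) = 0" using tf[of x y] by (simp add: D(3)[of _ x _ y] sum_negf)
  show "(\<Sum>e\<in>onb. T x e y e) = 0" using tf[of x y] by (simp add: D(2)[of x] sum_negf)
  show "(\<Sum>e\<in>onb. T e (j e) x y) = 0" using contraction_form[OF T] tf by simp
  show "(\<Sum>e\<in>onb. T x y e (j e)) = 0" using contraction_form'[OF T] tf by simp
  have 1: "T e x y (j e) = - T e x (j y) e" for e x y
    using curvature_j_right_move[OF T, of e x y e] by simp
  show 2: "(\<Sum>e\<in>onb. T e x y (j e)) = 0" for x y unfolding 1 using tf by (simp add: sum_negf)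
  have "T x e (j e) y = T e x y (j e)" for e using D(2)[of x e "j e" y] D(3)[of e x "j e" y] by simp
  then show "(\<Sum>e\<in>onb. T x e (j e) y) = 0" using 2 by simp
  show "(\<Sum>e\<in>onb. T e x (j e) y) = 0" using 2[of x y] by (simp add: D(3)[of _ x _ y] sum_negf)
  show "(\<Sum>e\<in>onb. T x e y (j e)) = 0" using 2[of x y] by (simp add: D(2)[of x] sum_negf)
qed

subsection \<open>Orthogonal projection to the trace-free part\<close>

lemma tensor4_inner_eq:
  assumes S: "multilinear4 S" and T: "multilinear4 T"
  shows "tensor4_inner h S T
    = (\<Sum>a\<in>onb. \<Sum>b\<in>onb. \<Sum>c\<in>onb. \<Sum>d\<in>onb. S a b c d * T a b c d)"
proof -
  note lin = multilinear4D(1-4)[OF S] multilinear4D(1-4)[OF T]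
  have 1: "metric_trace h (\<lambda>d d'. S a b c d * T a' b' c' d') = (\<Sum>d\<in>onb. S a b c d * T a' b' c' d)"
    for a b c a' b' c'
    by (rule metric_trace_eq) (intro bilinearI linear_rmult linear_lmult lin)
  have 2: "metric_trace h (\<lambda>c c'. \<Sum>d\<in>onb. S a b c d * T a' b' c' d)
      = (\<Sum>c\<in>onb. \<Sum>d\<in>onb. S a b c d * T a' b' c d)" for a b a' b'
    by (rule metric_trace_eq) (intro bilinearI linear_rmult linear_lmult linear_compose_sum ballI lin)
  have 3: "metric_trace h (\<lambda>b b'. \<Sum>c\<in>onb. \<Sum>d\<in>onb. S a b c d * T a' b' c d)
      = (\<Sum>b\<in>onb. \<Sum>c\<in>onb. \<Sum>d\<in>onb. S a b c d * T a' b c d)" for a a'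
    by (rule metric_trace_eq) (intro bilinearI linear_rmult linear_lmult linear_compose_sum ballI lin)
  have 4: "metric_trace h (\<lambda>a a'. \<Sum>b\<in>onb. \<Sum>c\<in>onb. \<Sum>d\<in>onb. S a b c d * T a' b c d)
      = (\<Sum>a\<in>onb. \<Sum>b\<in>onb. \<Sum>c\<in>onb. \<Sum>d\<in>onb. S a b c d * T a b c d)"
    by (rule metric_trace_eq) (intro bilinearI linear_rmult linear_lmult linear_compose_sum ballI lin)
  show ?thesis unfolding tensor4_inner_def 1 2 3 4 ..
qed

lemma tensor4_inner_definite:
  assumes T: "multilinear4 T" and 0: "tensor4_inner h T T = 0"
  shows "T a b c d = 0"
proof -
  note lin = multilinear4D(1-4)[OF T]
  have "T a b c d = 0" if "a \<in> onb" "b \<in> onb" "c \<in> onb" "d \<in> onb" for a b c d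
    using 0 that unfolding tensor4_inner_eq[OF T T]
    by (simp add: sum_nonneg_eq_0_iff sum_nonneg)
  then have "T a b c d = 0" if "a \<in> onb" "b \<in> onb" "c \<in> onb" for a b c d
    using onb_expand(1)[OF lin(4), of d a b c] that by simp
  then have "T a b c d = 0" if "a \<in> onb" "b \<in> onb" for a b c d
    using onb_expand(1)[OF lin(3), of c a b d] that by simp
  then have "T a b c d = 0" if "a \<in> onb" for a b c d
    using onb_expand(1)[OF lin(2), of b a c d] that by simp
  then show ?thesis
    using onb_expand(1)[OF lin(1), of a b c d] by simp
qed

lemma
  fixes f :: "_ \<Rightarrow> _ \<Rightarrow> _ \<Rightarrow> _ \<Rightarrow> real"
  shows sum4_swap12: "(\<Sum>a\<in>A. \<Sum>b\<in>A. \<Sum>c\<in>A. \<Sum>d\<in>A. f a b c d) = (\<Sum>b\<in>A. \<Sum>a\<in>A. \<Sum>c\<in>A. \<Sum>d\<in>A. f a b c d)"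
    and sum4_swap23: "(\<Sum>a\<in>A. \<Sum>b\<in>A. \<Sum>c\<in>A. \<Sum>d\<in>A. f a b c d) = (\<Sum>a\<in>A. \<Sum>c\<in>A. \<Sum>b\<in>A. \<Sum>d\<in>A. f a b c d)"
    and sum4_swap34: "(\<Sum>a\<in>A. \<Sum>b\<in>A. \<Sum>c\<in>A. \<Sum>d\<in>A. f a b c d) = (\<Sum>a\<in>A. \<Sum>b\<in>A. \<Sum>d\<in>A. \<Sum>c\<in>A. f a b c d)"
  by (rule sum.swap, rule sum.cong[OF refl], rule sum.swap,
      rule sum.cong[OF refl], rule sum.cong[OF refl], rule sum.swap)

text \<open>Every summand of the product has a factor \<open>h (p _) _\<close> with \<open>p\<close>
  the identity or \<open>j\<close>. Summing over the two slots of that factor contracts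
  \<open>S\<close> there, which gives zero.\<close>

lemma kaehler_product_orthogonal:
  assumes S: "kaehler_curvature_tensor j S" and tf: "\<And>b c. (\<Sum>e\<in>onb. S e b c e) = 0"
  shows "(\<Sum>a\<in>onb. \<Sum>b\<in>onb. \<Sum>c\<in>onb. \<Sum>d\<in>onb. kaehler_product h j F a b c d * S a b c d) = 0"
proof -
  note lin = multilinear4D(1-4)[OF kaehler_curvature_tensorD(1)[OF S]]
  note z = tf trace_free_contractions[OF S tf]
  define sm where "sm f = (\<Sum>a\<in>onb. \<Sum>b\<in>onb. \<Sum>c\<in>onb. \<Sum>d\<in>onb. f a b c d)"
    for f :: "real ^ 'n \<Rightarrow> real ^ 'n \<Rightarrow> real ^ 'n \<Rightarrow> real ^ 'n \<Rightarrow> real"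
  \<comment> \<open>One fact for each pair of slots. The swaps bring the two sums of the pair
    innermost; the expansion removes one of them and the other is a vanishing contraction.\<close>
  have bc: "sm (\<lambda>a b c d. Y a d * (h (p b) c * S a b c d)) = 0"
    if "\<And>a d. (\<Sum>b\<in>onb. S a b (p b) d) = 0" for Y p
    unfolding sm_def by (subst sum4_swap34, subst sum4_swap23)
      (simp add: sum_distrib_left[symmetric] onb_expand lin that)
  have ac: "sm (\<lambda>a b c d. Y b d * (h (p a) c * S a b c d)) = 0"
    if "\<And>b d. (\<Sum>a\<in>onb. S a b (p a) d) = 0" for Y p
    unfolding sm_def by (subst sum4_swap12, subst sum4_swap34, subst sum4_swap23)
      (simp add: sum_distrib_left[symmetric] onb_expand lin that)
  have ad: "sm (\<lambda>a b c d. Y b c * (h (p a) d * S a b c d)) = 0"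
    if "\<And>b c. (\<Sum>a\<in>onb. S a b c (p a)) = 0" for Y p
    unfolding sm_def by (subst sum4_swap12, subst sum4_swap23)
      (simp add: sum_distrib_left[symmetric] onb_expand lin that)
  have bd: "sm (\<lambda>a b c d. Y a c * (h (p b) d * S a b c d)) = 0"
    if "\<And>a c. (\<Sum>b\<in>onb. S a b c (p b)) = 0" for Y p
    unfolding sm_def by (subst sum4_swap23)
      (simp add: sum_distrib_left[symmetric] onb_expand lin that)
  have ab: "sm (\<lambda>a b c d. Y c d * (h (p a) b * S a b c d)) = 0"
    if "\<And>c d. (\<Sum>a\<in>onb. S a (p a) c d) = 0" for Y p
    unfolding sm_def by (subst sum4_swap23, subst sum4_swap12, subst sum4_swap34, subst sum4_swap23)
      (simp add: sum_distrib_left[symmetric] onb_expand lin that)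
  have cd: "sm (\<lambda>a b c d. Y a b * (h (p c) d * S a b c d)) = 0"
    if "\<And>a b. (\<Sum>c\<in>onb. S a b c (p c)) = 0" for Y p
    unfolding sm_def by (simp add: sum_distrib_left[symmetric] onb_expand lin that)
  have "kaehler_product h j F a b c d * S a b c d =
      F a d * (h b c * S a b c d) - F b d * (h a c * S a b c d)
    + F b c * (h a d * S a b c d) - F a c * (h b d * S a b c d)
    + F (j a) d * (h (j b) c * S a b c d) - F (j b) d * (h (j a) c * S a b c d)
    + F (j b) c * (h (j a) d * S a b c d) - F (j a) c * (h (j b) d * S a b c d)
    - 2 * F (j c) d * (h (j a) b * S a b c d) - 2 * F (j a) b * (h (j c) d * S a b c d)" for a b c d
    unfolding kaehler_product_def by (simp add: algebra_simps)
  then have "sm (\<lambda>a b c d. kaehler_product h j F a b c d * S a b c d) =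
      sm (\<lambda>a b c d. F a d * (h b c * S a b c d)) - sm (\<lambda>a b c d. F b d * (h a c * S a b c d))
    + sm (\<lambda>a b c d. F b c * (h a d * S a b c d)) - sm (\<lambda>a b c d. F a c * (h b d * S a b c d))
    + sm (\<lambda>a b c d. F (j a) d * (h (j b) c * S a b c d)) - sm (\<lambda>a b c d. F (j b) d * (h (j a) c * S a b c d))
    + sm (\<lambda>a b c d. F (j b) c * (h (j a) d * S a b c d)) - sm (\<lambda>a b c d. F (j a) c * (h (j b) d * S a b c d))
    - sm (\<lambda>a b c d. 2 * F (j c) d * (h (j a) b * S a b c d)) - sm (\<lambda>a b c d. 2 * F (j a) b * (h (j c) d * S a b c d))"
    unfolding sm_def by (simp add: sum.distrib sum_subtractf)
  also have "\<dots> = 0"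
    using bc[where p = "\<lambda>x. x" and Y = F] ac[where p = "\<lambda>x. x" and Y = F]
      ad[where p = "\<lambda>x. x" and Y = F] bd[where p = "\<lambda>x. x" and Y = F]
      bc[where p = j and Y = "\<lambda>x. F (j x)"] ac[where p = j and Y = "\<lambda>x. F (j x)"]
      ad[where p = j and Y = "\<lambda>x. F (j x)"] bd[where p = j and Y = "\<lambda>x. F (j x)"]
      ab[where p = j and Y = "\<lambda>x y. 2 * F (j x) y"] cd[where p = j and Y = "\<lambda>x y. 2 * F (j x) y"]
    by (simp add: z)
  finally show ?thesis by (simp add: sm_def)
qed

text \<open>For a second candidate \<open>V\<close> the difference V - W is trace-free, and since
  the Kaehler product is orthogonal to trace-free tensors it is orthogonal to itself; definiteness
  finishes the uniqueness.\<close>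

lemma trace_free_part_eqI:
  assumes W: "kaehler_curvature_tensor j W" and tf: "\<And>b c. (\<Sum>e\<in>onb. W e b c e) = 0"
    and T: "\<And>a b c d. T a b c d = W a b c d + kaehler_product h j F a b c d"
    and F: "hermitian_sym F"
  shows "trace_free_part h j T = W"
proof -
  have lin: "multilinear4 S" if "kaehler_curvature_tensor j S" for S
    using kaehler_curvature_tensorD(1)[OF that] .
  note K = kaehler_product_curvature[OF F]
  have iff: "trace_free_kaehler_curvature_tensor h j S \<longleftrightarrow>
      kaehler_curvature_tensor j S \<and> (\<forall>b c. (\<Sum>e\<in>onb. S e b c e) = 0)" for S
    unfolding trace_free_kaehler_curvature_tensor_def using ricci_contraction_eq by auto
  have orth: "tensor4_inner h (\<lambda>a b c d. T a b c d - W a b c d) S = 0"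
    if "trace_free_kaehler_curvature_tensor h j S" for S
    using that kaehler_product_orthogonal[of S F] unfolding iff
    by (simp add: T tensor4_inner_eq[OF lin[OF K] lin])
  have uniq: "V = W" if V: "trace_free_kaehler_curvature_tensor h j V"
    and o: "\<And>S. trace_free_kaehler_curvature_tensor h j S \<Longrightarrow>
      tensor4_inner h (\<lambda>a b c d. T a b c d - V a b c d) S = 0" for V
  proof -
    let ?D = "\<lambda>a b c d. V a b c d - W a b c d"
    have VW: "kaehler_curvature_tensor j V" "kaehler_curvature_tensor j ?D"
      using V W kaehler_curvature_tensor_diff unfolding iff by auto
    have D: "trace_free_kaehler_curvature_tensor h j ?D"
      unfolding iff using V VW(2) tf unfolding iff by (simp add: sum_subtractf)
    have "(\<lambda>a b c d. T a b c d - V a b c d) = (\<lambda>a b c d. kaehler_product h j F a b c d - ?D a b c d)"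
      by (simp add: T fun_eq_iff)
    then have "tensor4_inner h (\<lambda>a b c d. kaehler_product h j F a b c d - ?D a b c d) ?D = 0"
      using o[OF D] by (simp only:)
    moreover have "tensor4_inner h (\<lambda>a b c d. kaehler_product h j F a b c d) ?D = 0"
      using orth[OF D] by (simp add: T)
    ultimately have "tensor4_inner h ?D ?D = 0"
      using VW(2) K
      by (simp add: tensor4_inner_eq lin kaehler_curvature_tensor_diff left_diff_distrib sum_subtractf)
    from tensor4_inner_definite[OF lin[OF VW(2)] this] show "V = W" by (simp add: fun_eq_iff)
  qed
  have W': "trace_free_kaehler_curvature_tensor h j W" unfolding iff using W tf by simp
  show ?thesis unfolding trace_free_part_def
  proof (rule the_equality)
    show "trace_free_kaehler_curvature_tensor h j W \<and>
      (\<forall>S. trace_free_kaehler_curvature_tensor h j S \<longrightarrow>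
        tensor4_inner h (\<lambda>a b c d. T a b c d - W a b c d) S = 0)"
      using W' orth by blast
  qed (use uniq in blast)
qed

lemma hermitian_sym_lincomb:
  assumes "hermitian_sym E" "hermitian_sym F"
  shows "hermitian_sym (\<lambda>u v. a * E u v + b * F u v)"
proof -
  note E' = hermitian_symD[OF assms(1)] and F' = hermitian_symD[OF assms(2)]
  have "bilinear (\<lambda>u v. a * E u v + b * F u v)"
    by (intro bilinearI linear_compose_add linear_lmult E'(6,7) F'(6,7))
  moreover have "a * E u v + b * F u v = a * E v u + b * F v u" for u v
    using E'(2)[of u v] F'(2)[of u v] by simp
  ultimately show ?thesis unfolding hermitian_sym_def by (simp add: E'(3) F'(3))
qed

text \<open>The constants are chosen so that the Kaehler product of \<open>schouten E\<close> has Ricci contraction \<open>E\<close>.\<close>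

definition schouten :: "(real ^ 'n \<Rightarrow> real ^ 'n \<Rightarrow> real) \<Rightarrow> real ^ 'n \<Rightarrow> real ^ 'n \<Rightarrow> real" where
  "schouten E u v = (E u v - (\<Sum>e\<in>onb. E e e) / (2 * real CARD('n) + 4) * h u v) / (real CARD('n) + 4)"

lemma hermitian_sym_schouten:
  assumes "hermitian_sym E"
  shows "hermitian_sym (schouten E)"
proof -
  let ?n = "real CARD('n)"
  have "schouten E = (\<lambda>u v. (1 / (?n + 4)) * E u v
      + (- ((\<Sum>e\<in>onb. E e e) / (2 * ?n + 4)) / (?n + 4)) * h u v)"
    by (simp add: schouten_def fun_eq_iff diff_divide_distrib)
  then show ?thesis by (simp only: hermitian_sym_lincomb[OF assms hermitian_sym_h])
qed

lemma schouten_contraction: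
  assumes "hermitian_sym E"
  shows "(\<Sum>e\<in>onb. kaehler_product h j (schouten E) e b c e) = E b c"
proof -
  let ?n = "real CARD('n)" and ?s = "\<Sum>e\<in>onb. E e e"
  have n: "?n + 4 > 0" "2 * ?n + 4 > 0" by simp_all
  have "(\<Sum>e\<in>onb. schouten E e e) = (?s - ?s / (2 * ?n + 4) * ?n) / (?n + 4)"
    unfolding schouten_def
    by (simp add: sum_divide_distrib[symmetric] sum_subtractf sum_distrib_left[symmetric] trace_h)
  also have "\<dots> = ?s / (2 * ?n + 4)"
    using n by (simp add: divide_simps) (simp add: algebra_simps)
  finally show ?thesis
    unfolding kaehler_product_contraction[OF hermitian_sym_schouten[OF assms]]
    using n by (simp add: schouten_def)
qed

lemma trace_free_part_eq:
  assumes T: "kaehler_curvature_tensor j T"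
  shows "trace_free_part h j T a b c d
    = T a b c d - kaehler_product h j (schouten (\<lambda>u v. \<Sum>e\<in>onb. T e u v e)) a b c d"
proof -
  let ?F = "schouten (\<lambda>u v. \<Sum>e\<in>onb. T e u v e)"
  note E = contraction_hermitian[OF T]
  note F = hermitian_sym_schouten[OF E]
  have "trace_free_part h j T = (\<lambda>a b c d. T a b c d - kaehler_product h j ?F a b c d)"
    using kaehler_curvature_tensor_diff[OF T kaehler_product_curvature[OF F]] F
    by (intro trace_free_part_eqI[where F = ?F]) (simp_all add: sum_subtractf schouten_contraction[OF E])
  then show ?thesis by simp
qed

subsection \<open>The Hamiltonian equation for the Ricci form\<close>

text \<open>Total symmetry allows \<open>j\<close> in any two slots. Inserting it at b, c and then
  at a, c puts it twice on c, which costs a sign; removing it again at a, b gives T = - T.\<close>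

lemma trace_free_jinv_totally_symmetric:
  assumes sym: "\<And>w b c. T w b c = T w c b" and inv: "\<And>w b c. T w (j b) (j c) = T w b c"
    and tot: "\<And>w b c. T w b c = T b w c" and lin: "\<And>a b. linear (\<lambda>c. T a b c :: real)"
  shows "T a b c = 0"
proof -
  have "T a b c = T (j b) a (j c)" using inv[of a b c] tot[of a "j b" "j c"] by simp
  also have "\<dots> = T (j b) (j a) (j (j c))" by (simp add: inv)
  also have "\<dots> = - T (j b) (j a) c" by (simp add: jj linear_real_simps(3)[OF lin])
  also have "T (j b) (j a) c = T c a b" using tot[of "j b" "j a" c] sym tot inv by metis
  also have "T c a b = T a b c" using tot[of c a b] sym[of a c b] by simp
  finally show ?thesis by simp
qed

text \<open>Once \<open>j\<close> is carried away from the summation vector, each summand is either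
  an expansion by \<open>h\<close>, which moves a free vector into the derivative slot, or contains
  the divergence \<delta>.\<close>

lemma kaehler_product_divergence:
  assumes N: "\<And>w. hermitian_sym (N w)" and lin: "\<And>b c. linear (\<lambda>w. N w b c)"
  defines "\<delta> \<equiv> \<lambda>d. \<Sum>e\<in>onb. N e e d"
  shows "(\<Sum>e\<in>onb. kaehler_product h j (N e) e b c d) =
      h b c * \<delta> d - N c b d + N d b c - \<delta> c * h b d
    - h (j b) c * \<delta> (j d) + N (j c) (j b) d - N (j d) (j b) c + \<delta> (j c) * h (j b) d
    + 2 * N (j b) (j c) d + 2 * (\<delta> (j b) * h (j c) d)"
proof -
  note N' = hermitian_symD[OF N]
  have "kaehler_product h j (N e) e b c d =
      h b c * N e e d - h e c * N e b d + N e b c * h e d - N e e c * h b d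
    - h (j b) c * N e e (j d) + h e (j c) * N e (j b) d - N e (j b) c * h e (j d) + N e e (j c) * h (j b) d
    + 2 * (h e (j b) * N e (j c) d) + 2 * (N e e (j b) * h (j c) d)" for e
    unfolding kaehler_product_def by (simp add: N'(4) h_j_right)
  then show ?thesis
    by (simp add: \<delta>_def sum.distrib sum_subtractf sum_distrib_left[symmetric]
        sum_distrib_right[symmetric] onb_expand lin)
qed

text \<open>The hypothesis \<open>W\<close> says that the divergence of the curvature tensor, which the second Bianchi
  identity expresses by the derivative \<open>D\<close> of the Ricci form, equals the divergence of its
  non-Bochner part.\<close>

lemma hamiltonian_equation:
  assumes D: "\<And>w. hermitian_sym (D w)" and lin: "\<And>b c. linear (\<lambda>w. D w b c)"
    and closed: "\<And>x y z. D x (j y) z + D y (j z) x + D z (j x) y = 0"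
    and W: "\<And>b c d. D d b c - D c b d = (\<Sum>e\<in>onb. kaehler_product h j (schouten (D e)) e b c d)"
  defines "v \<equiv> \<lambda>w. (\<Sum>e\<in>onb. D w e e) / (2 * (real CARD('n) + 2))"
  shows "D w b c = 2 * v w * h b c + h w b * v c + v b * h w c - h (j w) b * v (j c) - v (j b) * h (j w) c"
proof -
  let ?n = "real CARD('n)"
  define \<sigma> where "\<sigma> w = (\<Sum>e\<in>onb. D w e e)" for w
  define \<epsilon> where "\<epsilon> = 1 / (2 * ?n + 4)"
  note D' = hermitian_symD[OF D] and H' = hermitian_symD[OF hermitian_sym_h]
  have s: "D w p q = D w q p" and inv: "D w (j p) (j q) = D w p q"
    and neg: "D w (- p) q = - D w p q" for w p q
    using D'(2,3) bilinear_lneg[OF D'(1)] by auto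
  have r: "D w p (j q) = - D w (j p) q" for w p q by (rule D'(4))
  have lin\<sigma>: "linear \<sigma>" unfolding \<sigma>_def by (intro linear_compose_sum ballI lin)
  have b: "bilinear (\<lambda>x y. D x y d)" for d by (intro bilinearI D'(7) lin)
  \<comment> \<open>The contracted Bianchi identity, from \<open>closed\<close> at e and Je: the
    divergence is half the derivative \<sigma> of the trace.\<close>
  have div: "(\<Sum>e\<in>onb. D e e d) = \<sigma> d / 2" for d
  proof -
    have "D d e e = D e e d + D (j e) (j e) d" for e
      using closed[of d e "j e"] s[of "j e" "j d" e] r[of "j e" e d] by (simp add: jj inv neg)
    then show ?thesis unfolding \<sigma>_def using trace_jj[OF b] by (simp add: sum.distrib)
  qed
  have sch: "(?n + 4) * schouten (D w) p q = D w p q - \<epsilon> * (\<sigma> w * h p q)" for w p q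
    unfolding schouten_def \<sigma>_def[symmetric] \<epsilon>_def by simp
  have linN: "linear (\<lambda>w. schouten (D w) p q)" for p q
    unfolding schouten_def \<sigma>_def[symmetric] divide_inverse
    by (intro linear_rmult linear_lmult linear_compose_sub lin lin\<sigma>)
  define \<delta> where "\<delta> d = (\<Sum>e\<in>onb. schouten (D e) e d)" for d
  have \<delta>: "(?n + 4) * \<delta> d = \<sigma> d / 2 - \<epsilon> * \<sigma> d" for d
    unfolding \<delta>_def sum_distrib_left sch
    by (simp add: sum_subtractf div sum_distrib_left[symmetric] onb_expand lin\<sigma>)
  define C where "C d c b = D d b c - D c b d" for d c b
  \<comment> \<open>Closedness turns the derivative twisted by \<open>j\<close> into the
    antisymmetrized one, so all derivative terms on the right of \<open>W\<close> become multiples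
    of \<open>C\<close>.\<close>
  have c1: "D (j b) (j c) d = C d c b" for b c d
    using closed[of "j b" c d] s[of c d b] by (simp add: jj C_def inv neg)
  have c2: "D (j c) (j b) d - D (j d) (j b) c = C d c b" for b c d
    unfolding c1 using s[of d c b] s[of c d b] s[of b c d] by (simp add: C_def)
  define \<Theta> where "\<Theta> d c b = \<sigma> d * h b c - \<sigma> c * h b d - \<sigma> (j d) * h (j b) c + \<sigma> (j c) * h (j b) d
    + 2 * (\<sigma> (j b) * h (j c) d)" for b c d
  \<comment> \<open>Multiplication by n + 4 clears a denominator of \<open>schouten\<close>. On the
    right \<open>C\<close> occurs 1 + 1 + 2 times; \<epsilon> enters twice, through \<delta> and
    through the trace part of \<open>schouten\<close>.\<close>
  have main: "(?n + 4) * C d c b = 4 * C d c b + (1 / 2 - 2 * \<epsilon>) * \<Theta> d c b" for d c b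
  proof -
    have "(?n + 4) * C d c b =
        h b c * ((?n + 4) * \<delta> d) - (?n + 4) * schouten (D c) b d + (?n + 4) * schouten (D d) b c
      - ((?n + 4) * \<delta> c) * h b d - h (j b) c * ((?n + 4) * \<delta> (j d))
      + (?n + 4) * schouten (D (j c)) (j b) d - (?n + 4) * schouten (D (j d)) (j b) c
      + ((?n + 4) * \<delta> (j c)) * h (j b) d + 2 * ((?n + 4) * schouten (D (j b)) (j c) d)
      + 2 * (((?n + 4) * \<delta> (j b)) * h (j c) d)"
      unfolding C_def W kaehler_product_divergence[OF hermitian_sym_schouten[OF D] linN] \<delta>_def[symmetric]
      by (simp only: ring_distribs mult_ac)
    also have "\<dots> = C d c b + (D (j c) (j b) d - D (j d) (j b) c) + 2 * D (j b) (j c) d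
        + (1 / 2 - 2 * \<epsilon>) * \<Theta> d c b"
      unfolding sch \<delta> C_def \<Theta>_def by (simp add: algebra_simps)
    finally show ?thesis unfolding c2 unfolding c1 by simp
  qed
  \<comment> \<open>After the cancellation of 4 C a factor n is left on the left side, and the same
    n is the numerator here.\<close>
  have "1 / 2 - 2 * \<epsilon> = ?n / (2 * (?n + 2))"
    unfolding \<epsilon>_def by (simp add: divide_simps)
  then have "?n * C d c b = ?n * (\<Theta> d c b / (2 * (?n + 2)))" for d c b
    using main[of d c b] by (simp only: distrib_right) simp
  then have C: "C d c b = \<Theta> d c b / (2 * (?n + 2))" for d c b
    by (rule mult_left_cancel[THEN iffD1, of ?n, rotated]) simp
  have v: "v w = \<sigma> w / (2 * (?n + 2))" for w by (simp add: v_def \<sigma>_def)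
  have linv: "linear v" unfolding v divide_inverse by (intro linear_rmult lin\<sigma>)
  have C: "D d b c - D c b d = v d * h b c - v c * h b d - v (j d) * h (j b) c + v (j c) * h (j b) d
    + 2 * (v (j b) * h (j c) d)" for d c b
    unfolding C_def[symmetric] C v \<Theta>_def by (simp add: add_divide_distrib diff_divide_distrib)
  \<comment> \<open>The deviation from the model solution. By \<open>C\<close> the model has the
    same antisymmetrization as \<open>D\<close>, so \<open>T\<close> is totally symmetric; the
    normalization of \<open>v\<close> is the one for which both also have the same trace.\<close>
  define T where "T w b c = D w b c - (2 * v w * h b c + h w b * v c + v b * h w c
    - h (j w) b * v (j c) - v (j b) * h (j w) c)" for w b c
  have "T w b c = 0"
  proof (rule trace_free_jinv_totally_symmetric)
    show "T w b c = T w c b" for w b c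
      unfolding T_def using s[of w b c] h_sym[of b c] by simp
    show "T w (j b) (j c) = T w b c" for w b c
      unfolding T_def by (simp add: inv jj h_j h_j_right[of w] h_simps linear_real_simps[OF linv])
    show "T w b c = T b w c" for w b c
      unfolding T_def
      using C[of w c b] s[of w b c] s[of b w c] h_sym[of b c] h_sym[of w c] h_sym[of w b]
        h_j_swap[of w b] h_j_swap[of w c] h_j_swap[of b c]
      by (simp add: algebra_simps)
    show "linear (\<lambda>c. T a b c)" for a b
      unfolding T_def
      by (intro linear_compose_sub linear_compose_add linear_rmult linear_lmult D'(6) H'(6) linv
          linear_comp[OF linv linear_j])
  qed
  then show ?thesis unfolding T_def by simp
qed

text \<open>The right-hand side of the equation for \<nabla>A, evaluated at \<open>Y\<close>, with
  \<open>V\<close> in the place of \<Lambda>. The derivative of the Ricci endomorphism will have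
  this shape up to a multiple of the identity.\<close>

definition cproj :: "real ^ 'n \<Rightarrow> real ^ 'n \<Rightarrow> real ^ 'n \<Rightarrow> real ^ 'n" where
  "cproj V X Y = h X Y *\<^sub>R V + h V Y *\<^sub>R X + h (j X) Y *\<^sub>R j V + h (j V) Y *\<^sub>R j X"

text \<open>The left side of \<open>eq\<close> must commute with \<open>j\<close> as a function of
  X. Comparing X = JL with J applied to the case X = L, and pairing with JV, leaves a vanishing sum
  of two squares and |L|^2 |V|^2.\<close>

lemma gradient_vanishes:
  assumes S: "\<And>X. S (j X) = j (S X)" and L: "L \<noteq> 0"
    and eq: "\<And>X. (2 * h V X) *\<^sub>R L + cproj V X L = S X"
  shows "V = 0"
proof -
  have "(2 * h V (j L)) *\<^sub>R L + cproj V (j L) L = j ((2 * h V L) *\<^sub>R L + cproj V L L)"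
    using S eq by simp
  then have "h (j V) ((2 * h V (j L)) *\<^sub>R L + cproj V (j L) L)
      = h (j V) (j ((2 * h V L) *\<^sub>R L + cproj V L L))" by simp
  then have "(h V (j L))\<^sup>2 + (h V L)\<^sup>2 + h L L * h V V = 0"
    by (simp add: cproj_def j_simps jj h_simps h_j h_j_self h_j_skew[of V L] power2_eq_square)
  then have "h L L * h V V \<le> 0" by (smt (verit) zero_le_power2)
  then show ?thesis using h_pos[OF L] h_pos[of V] by (smt (verit) mult_pos_pos)
qed

text \<open>At Y = L the right side of \<open>eq\<close> is zero, and on the left every term except
  |L|^2 X lies in the span of L and JL, which \<open>Q\<close> kills.\<close>

lemma cproj_commutant_vanishes:
  assumes Q: "linear Q" "Q L = 0" "\<And>X. Q (j X) = j (Q X)" and L: "L \<noteq> 0"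
    and eq: "\<And>X Y. Q (cproj L X Y) = cproj L X (Q Y)"
  shows "Q X = 0"
proof -
  have "h L L *\<^sub>R Q X = 0"
    using eq[of X L] Q(2,3)
    by (simp add: cproj_def h_simps h_j_self linear_add[OF Q(1)] linear_cmul[OF Q(1)] linear_0[OF linear_j])
  then show ?thesis using h_pos[OF L] by simp
qed

end

section \<open>Riemannian geometry in a chart\<close>

lemma
  fixes b :: "'e::real_normed_vector \<Rightarrow> real ^ 'n::finite \<Rightarrow> real ^ 'm::finite \<Rightarrow> 'b::real_normed_vector"
  assumes S: "open S" and bil: "\<And>y. y \<in> S \<Longrightarrow> bilinear (b y)"
    and sm: "\<And>u v. smooth_on_open (\<lambda>y. b y u v) S"
    and V: "smooth_on_open V S" and W: "smooth_on_open W S"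
  shows smooth_on_open_apply2: "smooth_on_open (\<lambda>y. b y (V y) (W y)) S"
    and dderiv_apply2: "x \<in> S \<Longrightarrow> dderiv (\<lambda>y. b y (V y) (W y)) x w =
      dderiv (\<lambda>y. b y (V x) (W x)) x w + b x (dderiv V x w) (W x) + b x (V x) (dderiv W x w)"
proof -
  have lin: "linear (b y u)" "linear (\<lambda>u. b y u v)" if "y \<in> S" for y u v
    using bil[OF that] by (auto simp: bilinear_def)
  have 1: "smooth_on_open (\<lambda>y. b y u (W y)) S" for u
    by (rule smooth_on_open_apply[OF S lin(1) sm W])
  show "smooth_on_open (\<lambda>y. b y (V y) (W y)) S"
    by (rule smooth_on_open_apply[where T = "\<lambda>y u. b y u (W y)", OF S lin(2) 1 V])
  assume x: "x \<in> S"
  show "dderiv (\<lambda>y. b y (V y) (W y)) x w =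
      dderiv (\<lambda>y. b y (V x) (W x)) x w + b x (dderiv V x w) (W x) + b x (V x) (dderiv W x w)"
    using dderiv_apply[where T = "\<lambda>y u. b y u (W y)" and w = w, OF S lin(2) 1 V x]
      dderiv_apply[OF S lin(1) sm W x, of "V x" w] by simp
qed

text \<open>This cancels the Christoffel corrections when a trace is differentiated in
  coordinates.\<close>

lemma coordinate_trace_commute:
  fixes S T :: "real ^ 'n::finite \<Rightarrow> real ^ 'n"
  assumes "linear S" "linear T"
  shows "(\<Sum>i\<in>UNIV. S (T (axis i 1)) $ i) = (\<Sum>i\<in>UNIV. T (S (axis i 1)) $ i)"
proof -
  have *: "S (T (axis i 1)) $ i = (\<Sum>k\<in>UNIV. T (axis i 1) $ k * S (axis k 1) $ i)"
    if "linear S" "linear T" for S T :: "real ^ 'n \<Rightarrow> real ^ 'n" and i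
    by (subst linear_axis_expansion[OF that(1)]) (simp add: sum_component)
  show ?thesis
    unfolding *[OF assms] *[OF assms(2,1)] by (subst sum.swap) (simp add: mult.commute)
qed

locale riemannian_chart =
  fixes U :: "(real ^ 'n::finite) set" and G :: "real ^ 'n \<Rightarrow> real ^ 'n \<Rightarrow> real ^ 'n \<Rightarrow> real"
  assumes open_U: "open U"
    and G_bilinear: "x \<in> U \<Longrightarrow> bilinear (G x)"
    and G_sym: "x \<in> U \<Longrightarrow> G x u v = G x v u"
    and G_pos: "x \<in> U \<Longrightarrow> u \<noteq> 0 \<Longrightarrow> G x u u > 0"
    and G_smooth: "smooth_on_open (\<lambda>x. G x u v) U"
begin

lemma inner_form_G: "x \<in> U \<Longrightarrow> inner_form (G x)"
  by unfold_locales (use G_bilinear G_sym G_pos in auto)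

lemma G_linear: "x \<in> U \<Longrightarrow> linear (G x u)" "x \<in> U \<Longrightarrow> linear (\<lambda>v. G x v u)"
  using G_bilinear by (auto simp: bilinear_def)

section \<open>Existence and smoothness of the Levi-Civita connection\<close>

abbreviation \<Gamma> where "\<Gamma> \<equiv> christoffel G"

text \<open>Koszul's formula for coordinate fields, whose brackets vanish; as a covector in
  \<open>v\<close> it represents the Christoffel symbol.\<close>

definition koszul where
  "koszul x w u v = (dderiv (\<lambda>y. G y u v) x w + dderiv (\<lambda>y. G y w v) x u - dderiv (\<lambda>y. G y w u) x v) / 2"

lemma koszul_linear:
  assumes x: "x \<in> U"
  shows "linear (koszul x w u)" "linear (\<lambda>u. koszul x w u v)" "linear (\<lambda>w. koszul x w u v)"
proof -
  have d: "(\<lambda>y. G y u v) differentiable at x" for u v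
    by (rule smooth_on_open_differentiable[OF G_smooth x])
  have l: "linear (\<lambda>u. dderiv (\<lambda>y. G y u v) x w)" "linear (\<lambda>u. dderiv (\<lambda>y. G y v u) x w)"
    "linear (\<lambda>w. dderiv (\<lambda>y. G y u v) x w)" for u v w
    by (rule linear_dderiv_param[OF open_U x], auto intro: G_linear d)+ (rule linear_dderiv[OF d])
  show "linear (koszul x w u)" "linear (\<lambda>u. koszul x w u v)" "linear (\<lambda>w. koszul x w u v)"
    unfolding koszul_def[abs_def] divide_inverse
    by (intro linear_rmult linear_compose_add linear_compose_sub l)+
qed

lemma christoffel_unique:
  assumes x: "x \<in> U" and b: "bilinear C" and s: "\<And>u v. C u v = C v u"
    and c: "\<And>w u v. dderiv (\<lambda>y. G y u v) x w = G x (C w u) v + G x u (C w v)"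
  shows "G x (C w u) v = koszul x w u v"
  unfolding koszul_def c using G_sym[OF x, of u "C w v"] G_sym[OF x, of v "C u w"] G_sym[OF x, of w "C u v"]
    G_sym[OF x, of u "C v w"] G_sym[OF x, of w "C v u"] s[of u w] s[of v w] s[of u v] by simp

text \<open>Riesz representation of the Koszul covector gives a candidate, and any competitor has
  the same covector. This makes the definite description \<open>christoffel\<close>
  meaningful.\<close>

lemma christoffel:
  assumes x: "x \<in> U"
  shows christoffel_bilinear: "bilinear (\<Gamma> x)" and christoffel_sym: "\<Gamma> x u v = \<Gamma> x v u"
    and christoffel_metric: "dderiv (\<lambda>y. G y u v) x w = G x (\<Gamma> x w u) v + G x u (\<Gamma> x w v)"
    and christoffel_koszul: "G x (\<Gamma> x w u) v = koszul x w u v"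
proof -
  interpret h: inner_form "G x" by (rule inner_form_G[OF x])
  define C where "C w u = (THE t. \<forall>v. G x t v = koszul x w u v)" for w u
  have C: "G x (C w u) v = koszul x w u v" for w u v
    using theI'[OF h.riesz[OF koszul_linear(1)[OF x]], of w u] unfolding C_def by blast
  have dsym: "dderiv (\<lambda>y. G y u v) x w = dderiv (\<lambda>y. G y v u) x w" for u v w
    by (rule dderiv_cong[OF _ open_U x]) (auto simp: G_sym smooth_on_open_differentiable[OF G_smooth x])
  have "bilinear C"
    unfolding bilinear_def
  proof (intro conjI allI linearI)
    note l = linear_real_simps[OF koszul_linear(2)[OF x]] linear_real_simps[OF koszul_linear(3)[OF x]]
    show "C a (u + v) = C a u + C a v" "C (u + v) a = C u a + C v a"
      "C a (r *\<^sub>R u) = r *\<^sub>R C a u" "C (r *\<^sub>R u) a = r *\<^sub>R C u a" for a u v r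
      by (rule h.h_eqI; simp add: h.h_simps C l)+
  qed
  moreover have Cs: "C u v = C v u" for u v
    by (rule h.h_eqI) (simp add: C koszul_def dsym[of u v])
  moreover have "dderiv (\<lambda>y. G y u v) x w = G x (C w u) v + G x u (C w v)" for u v w
    unfolding h.h_sym[of u] C by (simp add: koszul_def dsym[of v u] field_simps)
  ultimately have ex: "bilinear C \<and> (\<forall>u v. C u v = C v u) \<and>
      (\<forall>w u v. dderiv (\<lambda>y. G y u v) x w = G x (C w u) v + G x u (C w v))" by blast
  have uniq: "C' = C" if "bilinear C' \<and> (\<forall>u v. C' u v = C' v u) \<and>
      (\<forall>w u v. dderiv (\<lambda>y. G y u v) x w = G x (C' w u) v + G x u (C' w v))" for C'
  proof (intro ext)
    fix w u
    show "C' w u = C w u"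
    proof (rule h.h_eqI)
      show "G x (C' w u) v = G x (C w u) v" for v
        unfolding C by (rule christoffel_unique[OF x]) (use that in blast)+
    qed
  qed
  have *: "\<Gamma> x = C"
    unfolding christoffel_def by (rule the_equality, rule ex, rule uniq)
  show "bilinear (\<Gamma> x)" "\<Gamma> x u v = \<Gamma> x v u" "G x (\<Gamma> x w u) v = koszul x w u v"
    "dderiv (\<lambda>y. G y u v) x w = G x (\<Gamma> x w u) v + G x u (\<Gamma> x w v)"
    unfolding * using ex Cs[of u v] C[of w u v] by blast+
qed

lemma \<Gamma>_linear: "x \<in> U \<Longrightarrow> linear (\<Gamma> x u)" "x \<in> U \<Longrightarrow> linear (\<lambda>v. \<Gamma> x v u)"
  using christoffel_bilinear by (auto simp: bilinear_def)

text \<open>By Cramer's rule the components of \<open>V\<close> are quotients of determinants with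
  smooth entries, and the Gram determinant has no zeros. It serves both the Christoffel symbols and
  the Ricci endomorphism.\<close>

lemma smooth_riesz:
  assumes V: "\<And>y v. y \<in> U \<Longrightarrow> G y (V y) v = f v y" and f: "\<And>v. smooth_on_open (f v) U"
  shows "smooth_on_open V U"
proof -
  define A :: "real ^ 'n \<Rightarrow> real ^ 'n ^ 'n" where "A y = (\<chi> i k. G y (axis k 1) (axis i 1))" for y
  define N :: "'n \<Rightarrow> real ^ 'n \<Rightarrow> real ^ 'n ^ 'n" where
    "N k y = (\<chi> i l. if l = k then f (axis i 1) y else A y $ i $ l)" for k y
  have A: "(A y *v u) $ i = G y u (axis i 1)" if "y \<in> U" for y u i
    using linear_axis_expansion[OF G_linear(2)[OF that], of u "axis i 1"]
    by (simp add: A_def matrix_vector_mult_def mult.commute)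
  have det: "det (A y) \<noteq> 0" if y: "y \<in> U" for y
  proof -
    have "u = 0" if "A y *v u = 0" for u
    proof -
      have "G y u u = 0"
        using linear_axis_expansion[OF G_linear(1)[OF y], of u u] A[OF y, of u] that by simp
      then show ?thesis using G_pos[OF y, of u] by force
    qed
    then show ?thesis
      using matrix_left_invertible_ker invertible_left_inverse invertible_det_nz by blast
  qed
  have eq: "V y $ k = det (N k y) / det (A y)" if y: "y \<in> U" for y k
  proof -
    have "A y *v V y = (\<chi> i. f (axis i 1) y)" using A[OF y] V[OF y] by (simp add: vec_eq_iff)
    then show ?thesis unfolding cramer[OF det[OF y]] by (simp add: N_def cong: if_cong)
  qed
  have sm: "smooth_on_open (\<lambda>y. det (N k y) / det (A y)) U" for k
  proof (intro smooth_on_open_divide smooth_on_open_det open_U det)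
    show "smooth_on_open (\<lambda>y. N k y $ i $ l) U" for i l
      by (cases "l = k") (simp_all add: N_def A_def G_smooth f)
    show "smooth_on_open (\<lambda>y. A y $ i $ l) U" for i l by (simp add: A_def G_smooth)
  qed
  have "smooth_on_open (\<lambda>y. V y $ k) U" for k
    by (rule smooth_on_open_cong[OF open_U sm[of k]]) (simp add: eq)
  then show ?thesis by (rule smooth_on_open_vec[OF open_U])
qed

lemma \<Gamma>_smooth: "smooth_on_open (\<lambda>y. \<Gamma> y u v) U"
proof (rule smooth_riesz)
  show "G y (\<Gamma> y u v) w = koszul y u v w" if "y \<in> U" for y w
    by (rule christoffel_koszul[OF that])
  show "smooth_on_open (\<lambda>y. koszul y u v w) U" for w
    unfolding koszul_def
    by (intro smooth_on_open_divide smooth_on_open_diff smooth_on_open_add smooth_on_open_dderiv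
        G_smooth open_U smooth_on_open_const) simp
qed

subsection \<open>Covariant derivatives of vector fields\<close>

abbreviation nabla where "nabla \<equiv> nabla_vec G"

abbreviation smooth where "smooth f \<equiv> smooth_on_open f U"

definition endo :: "(real ^ 'n \<Rightarrow> real ^ 'n \<Rightarrow> real ^ 'n) \<Rightarrow> bool" where
  "endo T \<longleftrightarrow> (\<forall>y\<in>U. linear (T y)) \<and> (\<forall>u. smooth (\<lambda>y. T y u))"

lemma endoD: "endo T \<Longrightarrow> y \<in> U \<Longrightarrow> linear (T y)" "endo T \<Longrightarrow> smooth (\<lambda>y. T y u)"
  by (auto simp: endo_def)

lemma smooth_endo_apply: "endo T \<Longrightarrow> smooth V \<Longrightarrow> smooth (\<lambda>y. T y (V y))"
  by (rule smooth_on_open_apply[OF open_U]) (auto simp: endo_def)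

lemma endo_\<Gamma>: "endo (\<lambda>y. \<Gamma> y w)"
  unfolding endo_def using \<Gamma>_linear \<Gamma>_smooth by auto

lemma smooth_nabla: "smooth V \<Longrightarrow> smooth (\<lambda>y. nabla V y w)"
  unfolding nabla_vec_def
  by (intro smooth_on_open_add open_U smooth_on_open_dderiv smooth_endo_apply[OF endo_\<Gamma>])

lemma nabla_cong:
  assumes "x \<in> U" "smooth V" "\<And>y. y \<in> U \<Longrightarrow> V y = W y"
  shows "nabla V x w = nabla W x w"
  unfolding nabla_vec_def
  using dderiv_cong[OF _ open_U assms(1), of V W] smooth_on_open_differentiable[OF assms(2,1)] assms by auto

lemma nabla_const: "nabla (\<lambda>y. u) x w = \<Gamma> x w u"
  by (simp add: nabla_vec_def)

lemma nabla_linear_direction: "x \<in> U \<Longrightarrow> smooth V \<Longrightarrow> linear (nabla V x)"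
  unfolding nabla_vec_def[abs_def]
  by (intro linear_compose_add linear_dderiv smooth_on_open_differentiable \<Gamma>_linear)

lemma nabla_add:
  assumes "x \<in> U" "smooth V" "smooth W"
  shows "nabla (\<lambda>y. V y + W y) x w = nabla V x w + nabla W x w"
  unfolding nabla_vec_def
  by (simp add: dderiv_add smooth_on_open_differentiable[OF assms(2,1)]
      smooth_on_open_differentiable[OF assms(3,1)] linear_add[OF \<Gamma>_linear(1)[OF assms(1)]])

lemma nabla_diff:
  assumes "x \<in> U" "smooth V" "smooth W"
  shows "nabla (\<lambda>y. V y - W y) x w = nabla V x w - nabla W x w"
  unfolding nabla_vec_def
  by (simp add: dderiv_diff smooth_on_open_differentiable[OF assms(2,1)]
      smooth_on_open_differentiable[OF assms(3,1)] linear_diff[OF \<Gamma>_linear(1)[OF assms(1)]])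

lemma nabla_scaleR:
  assumes "x \<in> U" "smooth f" "smooth V"
  shows "nabla (\<lambda>y. f y *\<^sub>R V y) x w = dderiv f x w *\<^sub>R V x + f x *\<^sub>R nabla V x w"
  unfolding nabla_vec_def
  by (simp add: dderiv_scaleR smooth_on_open_differentiable[OF assms(2,1)]
      smooth_on_open_differentiable[OF assms(3,1)] linear_cmul[OF \<Gamma>_linear(1)[OF assms(1)]] algebra_simps)

lemma nabla_cmul:
  assumes "x \<in> U" "smooth V"
  shows "nabla (\<lambda>y. c *\<^sub>R V y) x w = c *\<^sub>R nabla V x w"
  using nabla_scaleR[OF assms(1) smooth_on_open_const assms(2), of c] by simp

lemma nabla_metric:
  assumes x: "x \<in> U" and V: "smooth V" and W: "smooth W"
  shows "dderiv (\<lambda>y. G y (V y) (W y)) x w = G x (nabla V x w) (W x) + G x (V x) (nabla W x w)"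
  using dderiv_apply2[OF open_U G_bilinear G_smooth V W x, of w]
  by (simp add: nabla_vec_def christoffel_metric[OF x] linear_add[OF G_linear(1)[OF x]]
      linear_add[OF G_linear(2)[OF x]])

lemma smooth_metric: "smooth V \<Longrightarrow> smooth W \<Longrightarrow> smooth (\<lambda>y. G y (V y) (W y))"
  by (rule smooth_on_open_apply2[OF open_U G_bilinear G_smooth])

lemma nabla_endo_apply:
  assumes x: "x \<in> U" and T: "endo T" and V: "smooth V"
  shows "nabla (\<lambda>y. T y (V y)) x w = nabla_endo G T x w (V x) + T x (nabla V x w)"
  using dderiv_apply[OF open_U endoD[OF T] V x, of w]
  by (simp add: nabla_vec_def nabla_endo_def linear_add[OF endoD(1)[OF T x]])

lemma nabla_endo_eq:
  assumes "x \<in> U" "endo T"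
  shows "nabla_endo G T x w u = nabla (\<lambda>y. T y u) x w - T x (\<Gamma> x w u)"
  by (simp add: nabla_endo_def nabla_vec_def)

lemma nabla_param_linear:
  assumes "x \<in> U" "\<And>y. y \<in> U \<Longrightarrow> linear (\<lambda>u. T u y)" "\<And>u. smooth (T u)"
  shows "linear (\<lambda>u. nabla (T u) x w)"
  unfolding nabla_vec_def
  by (intro linear_compose_add linear_dderiv_param[OF open_U assms(1)]
      linear_comp[OF \<Gamma>_linear(1)[OF assms(1)]] assms(1,2) smooth_on_open_differentiable[OF assms(3,1)])

subsection \<open>Curvature\<close>

abbreviation R where "R \<equiv> curvature_endo G"

text \<open>For constant \<open>u\<close> and \<open>v\<close> there is no bracket term. The second
  derivatives of \<open>V\<close> cancel by symmetry, and so do the terms with one derivative of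
  \<open>V\<close>.\<close>

lemma ricci_identity:
  assumes x: "x \<in> U" and V: "smooth V"
  shows "nabla (\<lambda>y. nabla V y v) x u - nabla (\<lambda>y. nabla V y u) x v = R x u v (V x)"
proof -
  note d = smooth_on_open_differentiable[OF _ x]
  have 1: "nabla (\<lambda>y. nabla V y v) x u = dderiv (\<lambda>y. dderiv V y v) x u
      + dderiv (\<lambda>y. \<Gamma> y v (V x)) x u + \<Gamma> x v (dderiv V x u) + \<Gamma> x u (dderiv V x v)
      + \<Gamma> x u (\<Gamma> x v (V x))" for u v
    unfolding nabla_vec_def
    by (simp add: dderiv_add d smooth_on_open_dderiv V smooth_endo_apply[OF endo_\<Gamma>]
        dderiv_apply[OF open_U \<Gamma>_linear(1) \<Gamma>_smooth V x] linear_add[OF \<Gamma>_linear(1)[OF x]])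
  show ?thesis
    unfolding 1 curvature_endo_def unfolding nabla_vec_def
    using dderiv_commute[OF open_U x V, of u v] by simp
qed

lemma R_smooth: "smooth (\<lambda>y. R y u v w)"
  unfolding curvature_endo_def by (intro smooth_on_open_diff open_U smooth_nabla \<Gamma>_smooth)

lemma R_antisym: "R x u v w = - R x v u w"
  by (simp add: curvature_endo_def)

lemma R_linear:
  assumes x: "x \<in> U"
  shows "linear (R x u v)" "linear (\<lambda>u. R x u v w)" "linear (\<lambda>v. R x u v w)"
proof -
  have l: "linear (\<lambda>v. nabla (\<lambda>y. \<Gamma> y v w) x u)" "linear (\<lambda>w. nabla (\<lambda>y. \<Gamma> y v w) x u)" for u v w
    by (rule nabla_param_linear[where T = "\<lambda>v y. \<Gamma> y v w", OF x \<Gamma>_linear(2) \<Gamma>_smooth], assumption,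
        rule nabla_param_linear[where T = "\<lambda>w y. \<Gamma> y v w", OF x \<Gamma>_linear(1) \<Gamma>_smooth])
  note d = nabla_linear_direction[OF x \<Gamma>_smooth]
  show "linear (R x u v)" unfolding curvature_endo_def[abs_def] by (intro linear_compose_sub l)
  show "linear (\<lambda>u. R x u v w)" unfolding curvature_endo_def by (intro linear_compose_sub l d)
  show "linear (\<lambda>v. R x u v w)" unfolding curvature_endo_def by (intro linear_compose_sub l d)
qed

lemma endo_R: "endo (\<lambda>y. R y u v)"
  unfolding endo_def using R_linear(1) R_smooth by auto

lemma R_bianchi:
  assumes x: "x \<in> U"
  shows "R x u v w + R x v w u + R x w u v = 0"
proof -
  have "nabla (\<lambda>y. \<Gamma> y a b) x c = nabla (\<lambda>y. \<Gamma> y b a) x c" for a b c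
    by (rule nabla_cong[OF x \<Gamma>_smooth christoffel_sym])
  note * = this[of u v w] this[of v w u] this[of w u v]
  show ?thesis unfolding curvature_endo_def by (simp add: *)
qed

text \<open>The mixed second derivatives of \<open>G y w z\<close> agree. Rewritten by metric
  compatibility, their products of two Christoffel terms cancel on antisymmetrizing.\<close>

lemma R_skew:
  assumes x: "x \<in> U"
  shows "G x (R x u v w) z = - G x (R x u v z) w"
proof -
  have 1: "dderiv (\<lambda>y. dderiv (\<lambda>y. G y w z) y v) x u =
      G x (nabla (\<lambda>y. \<Gamma> y v w) x u) z + G x (\<Gamma> x v w) (\<Gamma> x u z)
      + G x (\<Gamma> x u w) (\<Gamma> x v z) + G x w (nabla (\<lambda>y. \<Gamma> y v z) x u)" for u v
  proof -
    have "dderiv (\<lambda>y. dderiv (\<lambda>y. G y w z) y v) x u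
        = dderiv (\<lambda>y. G y (\<Gamma> y v w) z + G y w (\<Gamma> y v z)) x u"
      by (rule dderiv_cong[OF _ open_U x])
        (auto simp: christoffel_metric intro!: smooth_on_open_differentiable[OF smooth_on_open_dderiv[OF G_smooth] x])
    also have "\<dots> = dderiv (\<lambda>y. G y (\<Gamma> y v w) z) x u + dderiv (\<lambda>y. G y w (\<Gamma> y v z)) x u"
      by (intro dderiv_add smooth_on_open_differentiable[OF _ x] smooth_metric \<Gamma>_smooth smooth_on_open_const)
    finally show ?thesis
      by (simp add: nabla_metric[OF x] \<Gamma>_smooth smooth_on_open_const nabla_const)
  qed
  have "G x w (nabla (\<lambda>y. \<Gamma> y v z) x u) - G x w (nabla (\<lambda>y. \<Gamma> y u z) x v)
     + (G x (nabla (\<lambda>y. \<Gamma> y v w) x u) z - G x (nabla (\<lambda>y. \<Gamma> y u w) x v) z) = 0"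
    using dderiv_commute_real[OF open_U x G_smooth, of w z v u] unfolding 1 by simp
  then show ?thesis
    unfolding curvature_endo_def G_sym[OF x, of _ w]
    by (simp add: linear_diff[OF G_linear(1)[OF x]] linear_diff[OF G_linear(2)[OF x]] G_sym[OF x, of w])
qed

text \<open>The vector \<open>(\<nabla>\<^sub>z R)(u, v) w\<close>. Kept vector valued, so that
  \<open>J\<close> can be moved through it and the Bianchi identities need no metric.\<close>

definition DR where
  "DR x z u v w = nabla (\<lambda>y. R y u v w) x z - R x (\<Gamma> x z u) v w - R x u (\<Gamma> x z v) w - R x u v (\<Gamma> x z w)"

lemma DR_linear:
  assumes x: "x \<in> U"
  shows "linear (\<lambda>z. DR x z u v w)" "linear (\<lambda>u. DR x z u v w)" "linear (\<lambda>v. DR x z u v w)"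
    "linear (DR x z u v)"
  unfolding DR_def[abs_def]
  by (intro linear_compose_sub nabla_linear_direction[OF x R_smooth] R_smooth
      nabla_param_linear[OF x] R_linear
      linear_comp[OF R_linear(1)[OF x]] linear_comp[OF R_linear(2)[OF x]]
      linear_comp[OF R_linear(3)[OF x]] \<Gamma>_linear x; assumption?)+

text \<open>The second Bianchi identity is the Jacobi identity for the operators \<open>\<nabla>\<^sub>z\<close>, \<open>\<nabla>\<^sub>u\<close>, \<open>\<nabla>\<^sub>v\<close>.\<close>

lemma DR_bianchi:
  assumes x: "x \<in> U"
  shows "DR x z u v w + DR x u v z w + DR x v z u w = 0"
proof -
  define V where "V v y = \<Gamma> y v w" for v y
  have V: "smooth (V v)" for v unfolding V_def by (rule \<Gamma>_smooth)
  have 1: "nabla (\<lambda>y. R y u v w) x z = nabla (\<lambda>y. nabla (V v) y u) x z - nabla (\<lambda>y. nabla (V u) y v) x z"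
    for u v z
    unfolding curvature_endo_def V_def[symmetric] by (intro nabla_diff x smooth_nabla V)
  have "nabla (\<lambda>y. R y u v w) x z + nabla (\<lambda>y. R y v z w) x u + nabla (\<lambda>y. R y z u w) x v
      = R x z u (\<Gamma> x v w) + R x u v (\<Gamma> x z w) + R x v z (\<Gamma> x u w)"
    unfolding 1 using ricci_identity[OF x V, of v u z] ricci_identity[OF x V, of z v u]
      ricci_identity[OF x V, of u z v] by (simp add: V_def algebra_simps)
  moreover have "R x (\<Gamma> x z u) v w = - R x v (\<Gamma> x u z) w" "R x (\<Gamma> x u v) z w = - R x z (\<Gamma> x v u) w"
    "R x (\<Gamma> x v z) u w = - R x u (\<Gamma> x z v) w"
    using R_antisym christoffel_sym[OF x] by metis+
  ultimately show ?thesis unfolding DR_def by (simp add: algebra_simps)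
qed

lemma riemann_smooth: "smooth (\<lambda>y. riemann G y a b c d)"
  unfolding riemann_def by (intro smooth_metric R_smooth smooth_on_open_const)

lemma nabla_riemann:
  assumes x: "x \<in> U"
  shows "nabla_tensor4 G (riemann G) x z a b c d = G x (DR x z a b c) d"
  unfolding nabla_tensor4_def riemann_def DR_def
  by (simp add: nabla_metric[OF x R_smooth smooth_on_open_const] nabla_const linear_diff[OF G_linear(2)[OF x]])

end

section \<open>Kaehler geometry in a chart\<close>

text \<open>A parallel \<open>J\<close> shows its invariance in the last pair, because R(u, v)
  commutes with \<open>J\<close>; pair symmetry carries it to the first pair, where the definition
  asks for it.\<close>

lemma kaehler_curvature_tensorI:
  fixes T :: "'n::finite tensor4" and j :: "real ^ 'n \<Rightarrow> real ^ 'n"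
  assumes m: "multilinear4 T" and 1: "\<And>a b c d. T a b c d = - T b a c d"
    and 2: "\<And>a b c d. T a b c d = - T a b d c"
    and 3: "\<And>a b c d. T a b c d + T b c a d + T c a b d = 0"
    and 4: "\<And>a b c d. T a b (j c) (j d) = T a b c d"
  shows "kaehler_curvature_tensor j T"
proof -
  note p = curvature_pair_symmetry[where T = T, OF 1 2 3]
  have "T (j a) (j b) c d = T a b c d" for a b c d
    using p[of "j a" "j b" c d] p[of a b c d] 4[of c d a b] by simp
  then show ?thesis unfolding kaehler_curvature_tensor_def using m 1 2 3 by blast
qed

section \<open>Algebraic symmetries of the differentiated curvature\<close>

context riemannian_chart
begin

lemma nabla_minus: "x \<in> U \<Longrightarrow> smooth V \<Longrightarrow> nabla (\<lambda>y. - V y) x w = - nabla V x w"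
  using nabla_cmul[of x V "- 1"] by simp

lemma nabla_zero: "x \<in> U \<Longrightarrow> nabla (\<lambda>y. 0) x w = 0"
  by (simp add: nabla_const linear_0[OF \<Gamma>_linear(1)])

lemma DR_antisym:
  assumes x: "x \<in> U"
  shows "DR x z u v w = - DR x z v u w"
proof -
  have "nabla (\<lambda>y. R y u v w) x z = - nabla (\<lambda>y. R y v u w) x z"
    unfolding nabla_minus[OF x R_smooth, symmetric] by (rule nabla_cong[OF x R_smooth R_antisym])
  then show ?thesis
    unfolding DR_def using R_antisym[of x "\<Gamma> x z u" v w] R_antisym[of x u "\<Gamma> x z v" w]
      R_antisym[of x u v "\<Gamma> x z w"] by simp
qed

lemma DR_cyclic:
  assumes x: "x \<in> U"
  shows "DR x z u v w + DR x z v w u + DR x z w u v = 0"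
proof -
  have "nabla (\<lambda>y. R y u v w) x z + nabla (\<lambda>y. R y v w u) x z + nabla (\<lambda>y. R y w u v) x z
      = nabla (\<lambda>y. R y u v w + R y v w u + R y w u v) x z"
    by (simp add: nabla_add x R_smooth smooth_on_open_add open_U)
  also have "\<dots> = nabla (\<lambda>y. 0) x z"
    by (rule nabla_cong[OF x _ R_bianchi]) (intro smooth_on_open_add open_U R_smooth)
  finally have "nabla (\<lambda>y. R y u v w) x z + nabla (\<lambda>y. R y v w u) x z + nabla (\<lambda>y. R y w u v) x z = 0"
    by (simp add: nabla_zero x)
  \<comment> \<open>Grouped by the slot in which they occur, the Christoffel corrections are three
    instances of the first Bianchi identity.\<close>
  moreover have "DR x z u v w + DR x z v w u + DR x z w u v
      = (nabla (\<lambda>y. R y u v w) x z + nabla (\<lambda>y. R y v w u) x z + nabla (\<lambda>y. R y w u v) x z)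
      - (R x (\<Gamma> x z u) v w + R x v w (\<Gamma> x z u) + R x w (\<Gamma> x z u) v)
      - (R x u (\<Gamma> x z v) w + R x (\<Gamma> x z v) w u + R x w u (\<Gamma> x z v))
      - (R x u v (\<Gamma> x z w) + R x v (\<Gamma> x z w) u + R x (\<Gamma> x z w) u v)"
    by (simp add: DR_def)
  ultimately show ?thesis by (simp only: R_bianchi[OF x] diff_zero)
qed

lemma DR_skew:
  assumes x: "x \<in> U"
  shows "G x (DR x z a b c) d = - G x (DR x z a b d) c"
proof -
  have "dderiv (\<lambda>y. riemann G y a b c d) x z = dderiv (\<lambda>y. - riemann G y a b d c) x z"
    by (rule dderiv_cong[OF disjI1[OF smooth_on_open_differentiable[OF riemann_smooth x]] open_U x])
      (unfold riemann_def, rule R_skew)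
  also have "\<dots> = - dderiv (\<lambda>y. riemann G y a b d c) x z"
    by (rule dderiv_minus[OF smooth_on_open_differentiable[OF riemann_smooth x]])
  finally show ?thesis
    unfolding nabla_riemann[OF x, symmetric] nabla_tensor4_def
    unfolding riemann_def using R_skew[OF x, of "\<Gamma> x z a" b c d] R_skew[OF x, of a "\<Gamma> x z b" c d]
      R_skew[OF x, of a b "\<Gamma> x z c" d] R_skew[OF x, of a b c "\<Gamma> x z d"] by simp
qed

end

locale kaehler_chart = riemannian_chart U G
  for U :: "(real ^ 'n::finite) set" and G :: "real ^ 'n \<Rightarrow> real ^ 'n \<Rightarrow> real ^ 'n \<Rightarrow> real" +
  fixes J :: "real ^ 'n \<Rightarrow> real ^ 'n \<Rightarrow> real ^ 'n"
  assumes J_endo: "endo J"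
    and JJ: "x \<in> U \<Longrightarrow> J x (J x u) = - u"
    and G_J: "x \<in> U \<Longrightarrow> G x (J x u) (J x v) = G x u v"
    and nabla_J: "x \<in> U \<Longrightarrow> nabla_endo G J x w u = 0"
begin

lemma hermitian_form_G: "x \<in> U \<Longrightarrow> hermitian_form (G x) (J x)"
  using inner_form_G by (intro hermitian_form.intro hermitian_form_axioms.intro)
    (auto intro: endoD(1)[OF J_endo] JJ G_J)

lemma J_smooth: "smooth V \<Longrightarrow> smooth (\<lambda>y. J y (V y))"
  by (rule smooth_endo_apply[OF J_endo])

lemma nabla_J_apply: "x \<in> U \<Longrightarrow> smooth V \<Longrightarrow> nabla (\<lambda>y. J y (V y)) x w = J x (nabla V x w)"
  by (simp add: nabla_endo_apply[OF _ J_endo] nabla_J)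

text \<open>In the Ricci identity for the field J w, the parallel \<open>J\<close> passes through
  both covariant derivatives.\<close>

lemma R_J:
  assumes x: "x \<in> U"
  shows "R x u v (J x w) = J x (R x u v w)"
proof -
  have "nabla (\<lambda>y. nabla (\<lambda>z. J z w) y v) x u = J x (nabla (\<lambda>y. \<Gamma> y v w) x u)" for u v
  proof -
    have "nabla (\<lambda>y. nabla (\<lambda>z. J z w) y v) x u = nabla (\<lambda>y. J y (\<Gamma> y v w)) x u"
      by (rule nabla_cong[OF x smooth_nabla[OF endoD(2)[OF J_endo]]])
        (simp add: nabla_J_apply smooth_on_open_const nabla_const)
    then show ?thesis by (simp add: nabla_J_apply x \<Gamma>_smooth)
  qed
  then show ?thesis
    using ricci_identity[OF x J_smooth[OF smooth_on_open_const[of w]], of v u]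
    by (simp add: curvature_endo_def linear_diff[OF endoD(1)[OF J_endo x]])
qed

lemma DR_J:
  assumes x: "x \<in> U"
  shows "DR x z u v (J x w) = J x (DR x z u v w)"
proof -
  have "nabla (\<lambda>y. R y u v (J y w)) x z = nabla (\<lambda>y. J y (R y u v w)) x z"
    by (rule nabla_cong[OF x smooth_endo_apply[OF endo_R endoD(2)[OF J_endo]] R_J])
  then have "nabla_endo G (\<lambda>y. R y u v) x z (J x w) + R x u v (J x (\<Gamma> x z w)) = J x (nabla (\<lambda>y. R y u v w) x z)"
    by (simp add: nabla_J_apply x R_smooth nabla_endo_apply[OF x endo_R] J_smooth smooth_on_open_const nabla_const)
  then have "nabla_endo G (\<lambda>y. R y u v) x z (J x w) = J x (nabla (\<lambda>y. R y u v w) x z) - J x (R x u v (\<Gamma> x z w))"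
    by (simp add: R_J x eq_diff_eq)
  moreover have "DR x z u v t = nabla_endo G (\<lambda>y. R y u v) x z t - R x (\<Gamma> x z u) v t - R x u (\<Gamma> x z v) t" for t
    by (simp add: DR_def nabla_endo_eq[OF x endo_R])
  ultimately show ?thesis
    by (simp add: R_J x nabla_endo_eq[OF x endo_R, of u v z w] linear_diff[OF endoD(1)[OF J_endo x]])
qed

lemma riemann_curvature:
  assumes x: "x \<in> U"
  shows "kaehler_curvature_tensor (J x) (riemann G x)"
proof (rule kaehler_curvature_tensorI)
  show "multilinear4 (riemann G x)"
    unfolding multilinear4_def riemann_def
    by (intro allI conjI linear_comp[OF G_linear(2)[OF x]] R_linear G_linear x)
  show "riemann G x a b c d = - riemann G x b a c d" for a b c d
    unfolding riemann_def using R_antisym[of x a b c] linear_real_simps(3)[OF G_linear(2)[OF x]] by simp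
  show "riemann G x a b c d = - riemann G x a b d c" for a b c d
    unfolding riemann_def by (rule R_skew[OF x])
  show "riemann G x a b c d + riemann G x b c a d + riemann G x c a b d = 0" for a b c d
    unfolding riemann_def
    using R_bianchi[OF x, of a b c] linear_real_simps(1,5)[OF G_linear(2)[OF x]] by metis
  show "riemann G x a b (J x c) (J x d) = riemann G x a b c d" for a b c d
    unfolding riemann_def by (simp add: R_J x G_J)
qed

lemma DR_curvature:
  assumes x: "x \<in> U"
  shows "kaehler_curvature_tensor (J x) (\<lambda>a b c d. G x (DR x z a b c) d)"
proof (rule kaehler_curvature_tensorI)
  show "multilinear4 (\<lambda>a b c d. G x (DR x z a b c) d)"
    unfolding multilinear4_def
    by (intro allI conjI linear_comp[OF G_linear(2)[OF x]] DR_linear G_linear x)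
  show "G x (DR x z a b c) d = - G x (DR x z b a c) d" for a b c d
    using DR_antisym[OF x, of z a b c] linear_real_simps(3)[OF G_linear(2)[OF x]] by simp
  show "G x (DR x z a b c) d = - G x (DR x z a b d) c" for a b c d
    by (rule DR_skew[OF x])
  show "G x (DR x z a b c) d + G x (DR x z b c a) d + G x (DR x z c a b) d = 0" for a b c d
    using DR_cyclic[OF x, of z a b c] linear_real_simps(1,5)[OF G_linear(2)[OF x]] by metis
  show "G x (DR x z a b (J x c)) (J x d) = G x (DR x z a b c) d" for a b c d
    by (simp add: DR_J x G_J)
qed

subsection \<open>The Ricci endomorphism\<close>

abbreviation onb where "onb x \<equiv> inner_form.onb (G x)"

lemma ricci_onb: "x \<in> U \<Longrightarrow> ricci G x u v = (\<Sum>e\<in>onb x. riemann G x e u v e)"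
  unfolding ricci_def by (rule hermitian_form.ricci_contraction_eq[OF hermitian_form_G riemann_curvature])

lemma ricci_coordinates: "x \<in> U \<Longrightarrow> ricci G x u v = (\<Sum>i\<in>UNIV. R x (axis i 1) u v $ i)"
  unfolding ricci_onb riemann_def
  by (rule inner_form.coordinate_trace[symmetric]) (auto intro: inner_form_G R_linear)

lemma ricci_smooth: "smooth (\<lambda>y. ricci G y u v)"
  by (rule smooth_on_open_cong[where f = "\<lambda>y. \<Sum>i\<in>UNIV. R y (axis i 1) u v $ i", OF open_U])
    (intro smooth_on_open_sum smooth_on_open_nth open_U R_smooth, simp add: ricci_coordinates)

lemma ricci_hermitian:
  assumes x: "x \<in> U"
  shows "hermitian_form.hermitian_sym (J x) (ricci G x)"
proof -
  have "ricci G x = (\<lambda>u v. \<Sum>e\<in>onb x. riemann G x e u v e)"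
    by (simp add: fun_eq_iff ricci_onb x)
  then show ?thesis
    using hermitian_form.contraction_hermitian[OF hermitian_form_G[OF x] riemann_curvature[OF x]] by simp
qed

text \<open>Ricci as an endomorphism, since the argument differentiates its action on \<Lambda> and
  its commutation with \<open>A\<close>.\<close>

definition Q where "Q x u = (THE t. \<forall>v. G x t v = ricci G x u v)"

lemma G_Q:
  assumes x: "x \<in> U"
  shows "G x (Q x u) v = ricci G x u v"
proof -
  interpret h: hermitian_form "G x" "J x" by (rule hermitian_form_G[OF x])
  show ?thesis
    using theI'[OF h.riesz[OF h.hermitian_symD(6)[OF ricci_hermitian[OF x]]], of u] unfolding Q_def by blast
qed

lemma Q_endo: "endo Q"
  unfolding endo_def
proof (intro conjI ballI allI)
  fix x assume x: "x \<in> U"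
  interpret h: hermitian_form "G x" "J x" by (rule hermitian_form_G[OF x])
  note l = linear_real_simps[OF h.hermitian_symD(7)[OF ricci_hermitian[OF x]]]
  show "linear (Q x)"
    by (intro linearI; rule h.h_eqI; simp add: h.h_simps G_Q[OF x] l)
next
  show "smooth (\<lambda>y. Q y u)" for u
    by (rule smooth_riesz[OF G_Q ricci_smooth])
qed

lemma Q_J:
  assumes x: "x \<in> U"
  shows "Q x (J x u) = J x (Q x u)"
proof -
  interpret h: hermitian_form "G x" "J x" by (rule hermitian_form_G[OF x])
  note r = h.hermitian_symD[OF ricci_hermitian[OF x]]
  show ?thesis
    by (rule h.h_eqI) (simp add: h.h_j_skew G_Q x r(4))
qed

definition DRic where "DRic x w u v = G x (nabla_endo G Q x w u) v"

lemma nabla_endo_linear: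
  assumes "x \<in> U" "endo T"
  shows "linear (nabla_endo G T x w)" "linear (\<lambda>w. nabla_endo G T x w u)"
proof -
  note l = endoD[OF assms(2)]
  have "linear (\<lambda>u. nabla (\<lambda>y. T y u) x w)"
    by (rule nabla_param_linear[where T = "\<lambda>u y. T y u", OF assms(1) l])
  then show "linear (nabla_endo G T x w)"
    unfolding nabla_endo_eq[OF assms, abs_def]
    by (intro linear_compose_sub linear_comp[OF l(1)] \<Gamma>_linear assms)
  show "linear (\<lambda>w. nabla_endo G T x w u)"
    unfolding nabla_endo_eq[OF assms, abs_def]
    by (intro linear_compose_sub nabla_linear_direction linear_comp[OF l(1)] \<Gamma>_linear l assms)
qed

lemma DRic_linear:
  assumes "x \<in> U"
  shows "linear (\<lambda>w. DRic x w u v)"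
  unfolding DRic_def
  by (intro linear_comp[OF G_linear(2)[OF assms]] nabla_endo_linear assms Q_endo)

lemma DRic_eq:
  assumes x: "x \<in> U"
  shows "DRic x w u v = dderiv (\<lambda>y. ricci G y u v) x w - ricci G x (\<Gamma> x w u) v - ricci G x u (\<Gamma> x w v)"
proof -
  have "dderiv (\<lambda>y. ricci G y u v) x w = dderiv (\<lambda>y. G y (Q y u) v) x w"
    by (rule dderiv_cong[OF _ open_U x]) (auto simp: G_Q smooth_on_open_differentiable[OF ricci_smooth x])
  also have "\<dots> = G x (nabla (\<lambda>y. Q y u) x w) v + G x (Q x u) (\<Gamma> x w v)"
    using nabla_metric[OF x endoD(2)[OF Q_endo] smooth_on_open_const] by (simp add: nabla_const)
  finally show ?thesis
    unfolding DRic_def nabla_endo_eq[OF x Q_endo]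
    by (simp add: linear_real_simps[OF G_linear(2)[OF x]] G_Q[OF x])
qed

text \<open>Contraction commutes with \<nabla>. The sum over \<open>onb x\<close> is traded for a
  coordinate trace, in which the two remaining Christoffel terms are traces of products in opposite
  order and cancel.\<close>

lemma DRic_contraction:
  assumes x: "x \<in> U"
  shows "DRic x w u v = (\<Sum>e\<in>onb x. G x (DR x w e u v) e)"
proof -
  have "(\<Sum>e\<in>onb x. G x (DR x w e u v) e) = (\<Sum>i\<in>UNIV. DR x w (axis i 1) u v $ i)"
    by (rule inner_form.coordinate_trace[symmetric]) (auto intro: inner_form_G DR_linear x)
  also have "\<dots> = (\<Sum>i\<in>UNIV. dderiv (\<lambda>y. R y (axis i 1) u v $ i) x w)
      + (\<Sum>i\<in>UNIV. \<Gamma> x w (R x (axis i 1) u v) $ i) - (\<Sum>i\<in>UNIV. R x (\<Gamma> x w (axis i 1)) u v $ i)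
      - ricci G x (\<Gamma> x w u) v - ricci G x u (\<Gamma> x w v)"
    unfolding DR_def nabla_vec_def
    by (simp add: sum.distrib sum_subtractf ricci_coordinates[OF x]
        dderiv_nth[OF smooth_on_open_differentiable[OF R_smooth x]])
  also have "(\<Sum>i\<in>UNIV. \<Gamma> x w (R x (axis i 1) u v) $ i) = (\<Sum>i\<in>UNIV. R x (\<Gamma> x w (axis i 1)) u v $ i)"
    by (rule coordinate_trace_commute) (intro \<Gamma>_linear R_linear x)+
  also have "(\<Sum>i\<in>UNIV. dderiv (\<lambda>y. R y (axis i 1) u v $ i) x w) = dderiv (\<lambda>y. ricci G y u v) x w"
  proof -
    have d: "(\<lambda>y. R y (axis i 1) u v $ i) differentiable at x" for i
      by (rule smooth_on_open_differentiable[OF smooth_on_open_nth[OF open_U R_smooth] x])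
    have "dderiv (\<lambda>y. ricci G y u v) x w = dderiv (\<lambda>y. \<Sum>i\<in>UNIV. R y (axis i 1) u v $ i) x w"
      by (rule dderiv_cong[OF _ open_U x])
        (auto simp: ricci_coordinates smooth_on_open_differentiable[OF ricci_smooth x])
    then show ?thesis by (simp add: dderiv_sum[OF d])
  qed
  finally show ?thesis by (simp add: DRic_eq[OF x])
qed

lemma DRic_hermitian:
  assumes x: "x \<in> U"
  shows "hermitian_form.hermitian_sym (J x) (DRic x w)"
proof -
  have "DRic x w = (\<lambda>u v. \<Sum>e\<in>onb x. G x (DR x w e u v) e)"
    by (simp add: fun_eq_iff DRic_contraction x)
  then show ?thesis
    using hermitian_form.contraction_hermitian[OF hermitian_form_G[OF x] DR_curvature[OF x]] by simp
qed

text \<open>Closedness of the Ricci form: as a trace of the curvature over e, Je it inherits the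
  second Bianchi identity term by term.\<close>

lemma DRic_closed:
  assumes x: "x \<in> U"
  shows "DRic x a (J x b) c + DRic x b (J x c) a + DRic x c (J x a) b = 0"
proof -
  interpret h: hermitian_form "G x" "J x" by (rule hermitian_form_G[OF x])
  have 1: "DRic x a (J x b) c = - (1/2) * (\<Sum>e\<in>onb x. G x (DR x a b c e) (J x e))" for a b c
    using h.contraction_form'[OF DR_curvature[OF x], of a b c] by (simp add: DRic_contraction[OF x])
  have "G x (DR x a b c e) (J x e) + G x (DR x b c a e) (J x e) + G x (DR x c a b e) (J x e) = 0" for e
    using DR_bianchi[OF x, of a b c e] linear_real_simps(1,5)[OF G_linear(2)[OF x]] by metis
  then have "(\<Sum>e\<in>onb x. G x (DR x a b c e) (J x e)) + (\<Sum>e\<in>onb x. G x (DR x b c a e) (J x e))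
      + (\<Sum>e\<in>onb x. G x (DR x c a b e) (J x e)) = 0"
    by (simp add: sum.distrib[symmetric])
  then show ?thesis unfolding 1 by simp
qed

text \<open>Pair symmetry puts the free vectors \<open>c\<close> and \<open>d\<close> next to the
  derivative index, where the second Bianchi identity exchanges them; the other two terms are Ricci
  contractions of the differentiated curvature.\<close>

lemma DR_divergence:
  assumes x: "x \<in> U"
  shows "(\<Sum>e\<in>onb x. G x (DR x e e b c) d) = DRic x d b c - DRic x c b d"
proof -
  interpret h: hermitian_form "G x" "J x" by (rule hermitian_form_G[OF x])
  note K = kaehler_curvature_tensorD[OF DR_curvature[OF x]]
  have "G x (DR x e e b c) d = G x (DR x d e b c) e - G x (DR x c e b d) e" for e
  proof -
    have "G x (DR x e e b c) d = G x (DR x e c d e) b"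
      by (rule kaehler_curvature_tensor_pair[OF DR_curvature[OF x]])
    moreover have "G x (DR x e c d e) b + G x (DR x c d e e) b + G x (DR x d e c e) b = 0"
      using DR_bianchi[OF x, of e c d e] linear_real_simps(1,5)[OF G_linear(2)[OF x]] by metis
    moreover have "G x (DR x c d e e) b = G x (DR x c e b d) e"
      using kaehler_curvature_tensor_pair[OF DR_curvature[OF x], of c e b d e]
        K(2)[of c d e e b] K(3)[of c e d e b] kaehler_curvature_tensor_pair[OF DR_curvature[OF x], of c e d b e]
        K(2)[of c b e e d] K(3)[of c e b e d] by simp
    moreover have "G x (DR x d e c e) b = - G x (DR x d e b c) e"
      using kaehler_curvature_tensor_pair[OF DR_curvature[OF x], of d e c e b]
        K(3)[of d e b e c] by simp
    ultimately show ?thesis by simp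
  qed
  then show ?thesis by (simp add: sum_subtractf DRic_contraction[OF x])
qed

abbreviation kprod where "kprod x \<equiv> kaehler_product (G x) (J x)"

abbreviation schouten where "schouten x \<equiv> hermitian_form.schouten (G x)"

subsection \<open>Covariant derivatives of bilinear forms\<close>

definition nabla2 where
  "nabla2 F x w a b = dderiv (\<lambda>y. F y a b) x w - F x (\<Gamma> x w a) b - F x a (\<Gamma> x w b)"

definition form2 :: "(real ^ 'n \<Rightarrow> real ^ 'n \<Rightarrow> real ^ 'n \<Rightarrow> real) \<Rightarrow> bool" where
  "form2 F \<longleftrightarrow> (\<forall>x\<in>U. bilinear (F x)) \<and> (\<forall>a b. smooth (\<lambda>y. F y a b))"

lemma form2D: "form2 F \<Longrightarrow> x \<in> U \<Longrightarrow> bilinear (F x)" "form2 F \<Longrightarrow> smooth (\<lambda>y. F y a b)"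
  by (auto simp: form2_def)

lemma form2_G: "form2 G"
  unfolding form2_def using G_bilinear G_smooth by blast

lemma nabla2_G: "x \<in> U \<Longrightarrow> nabla2 G x w a b = 0"
  by (simp add: nabla2_def christoffel_metric)

lemma form2_derivative:
  assumes F: "form2 F" and x: "x \<in> U"
  shows "((\<lambda>y. F y a b) has_derivative
      (\<lambda>w. nabla2 F x w a b + F x (\<Gamma> x w a) b + F x a (\<Gamma> x w b))) (at x)"
    and "((\<lambda>y. F y (J y a) b) has_derivative
      (\<lambda>w. nabla2 F x w (J x a) b + F x (J x (\<Gamma> x w a)) b + F x (J x a) (\<Gamma> x w b))) (at x)"
proof -
  note d = has_derivative_dderiv[OF smooth_on_open_differentiable[OF _ x]]
  show "((\<lambda>y. F y a b) has_derivative
      (\<lambda>w. nabla2 F x w a b + F x (\<Gamma> x w a) b + F x a (\<Gamma> x w b))) (at x)"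
    using d[OF form2D(2)[OF F], of a b] by (simp add: nabla2_def)
  have "dderiv (\<lambda>y. F y (J y a) b) x w = dderiv (\<lambda>y. F y (J x a) b) x w + F x (dderiv (\<lambda>y. J y a) x w) b" for w
    using dderiv_apply2[OF open_U form2D[OF F] endoD(2)[OF J_endo] smooth_on_open_const x, of a b w]
    by (simp add: bilinear_rzero[OF form2D(1)[OF F x]])
  moreover have "dderiv (\<lambda>y. J y a) x w = J x (\<Gamma> x w a) - \<Gamma> x w (J x a)" for w
    using nabla_J[OF x, of w a] by (simp add: nabla_endo_def algebra_simps)
  ultimately have "dderiv (\<lambda>y. F y (J y a) b) x w
      = nabla2 F x w (J x a) b + F x (J x (\<Gamma> x w a)) b + F x (J x a) (\<Gamma> x w b)" for w
    by (simp add: nabla2_def bilinear_lsub[OF form2D(1)[OF F x]])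
  then show "((\<lambda>y. F y (J y a) b) has_derivative
      (\<lambda>w. nabla2 F x w (J x a) b + F x (J x (\<Gamma> x w a)) b + F x (J x a) (\<Gamma> x w b))) (at x)"
    using d[OF smooth_on_open_apply2[OF open_U form2D[OF F] endoD(2)[OF J_endo] smooth_on_open_const], of a b]
    by simp
qed

text \<open>\<open>G\<close> and \<open>J\<close> are parallel, so only \<open>F\<close> is
  differentiated covariantly. With the Christoffel terms of all factors displayed, the product rule
  collects them into one correction per slot.\<close>

lemma kprod_derivative:
  assumes F: "form2 F" and x: "x \<in> U"
  shows "((\<lambda>y. kprod y (F y) a b c d) has_derivative
      (\<lambda>w. kprod x (nabla2 F x w) a b c d + kprod x (F x) (\<Gamma> x w a) b c d + kprod x (F x) a (\<Gamma> x w b) c d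
        + kprod x (F x) a b (\<Gamma> x w c) d + kprod x (F x) a b c (\<Gamma> x w d))) (at x)"
proof -
  have GD: "((\<lambda>y. G y a b) has_derivative (\<lambda>w. G x (\<Gamma> x w a) b + G x a (\<Gamma> x w b))) (at x)"
    "((\<lambda>y. G y (J y a) b) has_derivative (\<lambda>w. G x (J x (\<Gamma> x w a)) b + G x (J x a) (\<Gamma> x w b))) (at x)" for a b
    using form2_derivative[OF form2_G x, of a b] by (simp_all add: nabla2_G x)
  note FD = form2_derivative[OF F x]
  show ?thesis
    unfolding kaehler_product_def
    by (rule has_derivative_eq_rhs)
      ((rule has_derivative_add has_derivative_diff has_derivative_mult has_derivative_const GD FD)+,
       simp add: fun_eq_iff algebra_simps)
qed

lemma nabla_kprod:
  assumes F: "form2 F" and x: "x \<in> U"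
  shows "nabla_tensor4 G (\<lambda>y. kprod y (F y)) x w a b c d = kprod x (nabla2 F x w) a b c d"
  unfolding nabla_tensor4_def using dderiv_eqI[OF kprod_derivative[OF F x], of a b c d w] by simp

subsection \<open>The Bochner tensor\<close>

text \<open>The scalar curvature as a coordinate trace of \<open>Q\<close>, which is visibly
  smooth.\<close>

definition scal where "scal x = (\<Sum>i\<in>UNIV. Q x (axis i 1) $ i)"

lemma scal_smooth: "smooth scal"
  unfolding scal_def by (intro smooth_on_open_sum smooth_on_open_nth open_U endoD(2)[OF Q_endo])

lemma scal_onb: "x \<in> U \<Longrightarrow> scal x = (\<Sum>e\<in>onb x. ricci G x e e)"
  unfolding scal_def
  by (simp add: inner_form.coordinate_trace[OF inner_form_G endoD(1)[OF Q_endo]] G_Q)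

lemma dderiv_scal:
  assumes x: "x \<in> U"
  shows "dderiv scal x w = (\<Sum>e\<in>onb x. DRic x w e e)"
proof -
  have "(\<Sum>e\<in>onb x. DRic x w e e) = (\<Sum>i\<in>UNIV. nabla_endo G Q x w (axis i 1) $ i)"
    unfolding DRic_def
    by (rule inner_form.coordinate_trace[symmetric]) (intro inner_form_G nabla_endo_linear Q_endo x)+
  also have "\<dots> = (\<Sum>i\<in>UNIV. dderiv (\<lambda>y. Q y (axis i 1)) x w $ i)"
    unfolding nabla_endo_def
    using coordinate_trace_commute[OF \<Gamma>_linear(1)[OF x] endoD(1)[OF Q_endo x], of w]
    by (simp add: sum.distrib sum_subtractf)
  also have "\<dots> = dderiv scal x w"
    unfolding scal_def
    by (simp add: dderiv_sum dderiv_nth smooth_on_open_differentiable[OF _ x] smooth_on_open_nth open_U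
        endoD(2)[OF Q_endo])
  finally show ?thesis ..
qed

lemma schouten_eq:
  "x \<in> U \<Longrightarrow> schouten x (ricci G x) a b = (ricci G x a b - scal x / (2 * real CARD('n) + 4) * G x a b) / (real CARD('n) + 4)"
  by (simp add: hermitian_form.schouten_def[OF hermitian_form_G] scal_onb)

lemma form2_schouten: "form2 (\<lambda>x. schouten x (ricci G x))"
  unfolding form2_def
proof (intro conjI ballI allI)
  fix x assume x: "x \<in> U"
  interpret h: hermitian_form "G x" "J x" by (rule hermitian_form_G[OF x])
  show "bilinear (schouten x (ricci G x))"
    by (rule h.hermitian_symD(1)[OF h.hermitian_sym_schouten[OF ricci_hermitian[OF x]]])
next
  show "smooth (\<lambda>y. schouten y (ricci G y) a b)" for a b
  proof (rule smooth_on_open_cong[OF open_U _ schouten_eq[symmetric]])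
    show "smooth (\<lambda>x. (ricci G x a b - scal x / (2 * real CARD('n) + 4) * G x a b) / (real CARD('n) + 4))"
      by (intro smooth_on_open_divide smooth_on_open_diff smooth_on_open_mult smooth_on_open_const
          open_U ricci_smooth scal_smooth G_smooth) (simp_all add: add_pos_pos less_imp_neq[symmetric])
  qed
qed

lemma nabla2_schouten:
  assumes x: "x \<in> U"
  shows "nabla2 (\<lambda>x. schouten x (ricci G x)) x w a b = schouten x (DRic x w) a b"
proof -
  let ?n = "real CARD('n)"
  note d = smooth_on_open_differentiable[OF _ x]
  have "((\<lambda>y. (ricci G y a b - scal y / (2 * ?n + 4) * G y a b) / (?n + 4)) has_derivative
    (\<lambda>w. (dderiv (\<lambda>y. ricci G y a b) x w - (scal x / (2 * ?n + 4) * dderiv (\<lambda>y. G y a b) x w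
      + dderiv scal x w / (2 * ?n + 4) * G x a b)) / (?n + 4))) (at x)"
    unfolding divide_inverse
    by (intro has_derivative_mult_left has_derivative_diff has_derivative_mult has_derivative_dderiv d
        ricci_smooth scal_smooth G_smooth)
  from dderiv_eqI[OF this]
  have D: "dderiv (\<lambda>y. schouten y (ricci G y) a b) x w =
      (dderiv (\<lambda>y. ricci G y a b) x w - (scal x / (2 * ?n + 4) * dderiv (\<lambda>y. G y a b) x w
      + dderiv scal x w / (2 * ?n + 4) * G x a b)) / (?n + 4)"
    using dderiv_cong[OF disjI1[OF d[OF form2D(2)[OF form2_schouten]]] open_U x schouten_eq, of a b] by simp
  have S: "schouten x (DRic x w) a b
      = (DRic x w a b - dderiv scal x w / (2 * ?n + 4) * G x a b) / (?n + 4)"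
    by (simp add: hermitian_form.schouten_def[OF hermitian_form_G[OF x]] dderiv_scal[OF x])
  \<comment> \<open>Here q g1 and q g2 are the Christoffel corrections of the metric in the trace
    term; metric compatibility makes them cancel.\<close>
  have *: "(A - (q * (g1 + g2) + t * g)) / m - (r1 - q * g1) / m - (r2 - q * g2) / m
      = (A - r1 - r2 - t * g) / m" for A q g1 g2 t g m r1 r2 :: real
    by (simp add: diff_divide_distrib add_divide_distrib distrib_left)
  show ?thesis
    unfolding nabla2_def D S schouten_eq[OF x] christoffel_metric[OF x] DRic_eq[OF x]
    by (rule *)
qed

lemma bochner_eq:
  assumes x: "x \<in> U"
  shows "bochner G J x a b c d = riemann G x a b c d - kprod x (schouten x (ricci G x)) a b c d"
proof -
  have "ricci G x = (\<lambda>u v. \<Sum>e\<in>onb x. riemann G x e u v e)"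
    by (simp add: fun_eq_iff ricci_onb x)
  then show ?thesis
    unfolding bochner_def
    using hermitian_form.trace_free_part_eq[OF hermitian_form_G[OF x] riemann_curvature[OF x]] by simp
qed

lemma nabla_bochner:
  assumes x: "x \<in> U"
  shows "nabla_tensor4 G (bochner G J) x w a b c d
    = G x (DR x w a b c) d - kprod x (schouten x (DRic x w)) a b c d"
proof -
  let ?F = "\<lambda>y. schouten y (ricci G y)"
  have dR: "(\<lambda>y. riemann G y a b c d) differentiable at x"
    by (rule smooth_on_open_differentiable[OF riemann_smooth x])
  have dK: "(\<lambda>y. kprod y (?F y) a b c d) differentiable at x"
    using kprod_derivative[OF form2_schouten x] by (rule differentiableI)
  have "dderiv (\<lambda>y. bochner G J y a b c d) x w
      = dderiv (\<lambda>y. riemann G y a b c d - kprod y (?F y) a b c d) x w"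
    by (rule dderiv_cong[OF disjI2[OF differentiable_diff[OF dR dK]] open_U x bochner_eq])
  also have "\<dots> = dderiv (\<lambda>y. riemann G y a b c d) x w - dderiv (\<lambda>y. kprod y (?F y) a b c d) x w"
    by (rule dderiv_diff[OF dR dK])
  finally have "nabla_tensor4 G (bochner G J) x w a b c d
      = nabla_tensor4 G (riemann G) x w a b c d - nabla_tensor4 G (\<lambda>y. kprod y (?F y)) x w a b c d"
    unfolding nabla_tensor4_def by (simp add: bochner_eq x)
  moreover have "nabla2 ?F x w = schouten x (DRic x w)"
    by (simp add: fun_eq_iff nabla2_schouten x)
  ultimately show ?thesis by (simp add: nabla_riemann nabla_kprod form2_schouten x)
qed

text \<open>Co-closedness and the contracted Bianchi identity together are the hypothesis
  \<open>W\<close> of \<open>hamiltonian_equation\<close>; \<open>V\<close> is the Riesz vector of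
  the functional \<open>v\<close> there.\<close>

lemma weakly_bochner_flat_ricci:
  assumes x: "x \<in> U"
    and W: "\<And>X Y Z. metric_trace (G x) (\<lambda>u v. nabla_tensor4 G (bochner G J) x u v X Y Z) = 0"
  shows "\<exists>V. \<forall>w b. nabla_endo G Q x w b = (2 * G x V w) *\<^sub>R b + hermitian_form.cproj (G x) (J x) V w b"
proof -
  interpret h: hermitian_form "G x" "J x" by (rule hermitian_form_G[OF x])
  note lin = DRic_linear[OF x]
  note K = multilinear4D[OF kaehler_curvature_tensorD(1)[OF h.kaehler_product_curvature[OF
        h.hermitian_sym_schouten[OF DRic_hermitian[OF x]]]]]
  have linS: "linear (\<lambda>w. schouten x (DRic x w) a b)" for a b
    unfolding h.schouten_def divide_inverse
    by (intro linear_rmult linear_lmult linear_compose_sub linear_compose_sum ballI lin)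
  \<comment> \<open>Bilinearity is what replaces the coordinate contraction by a sum over the
    orthonormal basis.\<close>
  have "bilinear (\<lambda>u v. G x (DR x u v b c) d - kprod x (schouten x (DRic x u)) v b c d)" for b c d
  proof (intro bilinearI linear_compose_sub K(1) linear_comp[OF G_linear(2)[OF x]] DR_linear x)
    show "linear (\<lambda>u. kprod x (schouten x (DRic x u)) v b c d)" for v
      unfolding kaehler_product_def
      by (intro linear_compose_sub linear_compose_add linear_lmult linear_rmult linS)
  qed
  from h.metric_trace_eq[OF this] W
  have "(\<Sum>e\<in>onb x. G x (DR x e e b c) d) = (\<Sum>e\<in>onb x. kprod x (schouten x (DRic x e)) e b c d)" for b c d
    by (simp add: nabla_bochner[OF x] sum_subtractf)
  then have main: "DRic x d b c - DRic x c b d = (\<Sum>e\<in>onb x. kprod x (schouten x (DRic x e)) e b c d)" for b c d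
    by (simp add: DR_divergence[OF x])
  define v where "v w = (\<Sum>e\<in>onb x. DRic x w e e) / (2 * (real CARD('n) + 2))" for w
  have "linear v" unfolding v_def divide_inverse by (intro linear_rmult linear_compose_sum ballI lin)
  then obtain V where V: "G x V u = v u" for u using h.riesz by blast
  have "nabla_endo G Q x w b = (2 * G x V w) *\<^sub>R b + h.cproj V w b" for w b
  proof (rule h.h_eqI)
    fix c
    have "DRic x w b c = 2 * v w * G x b c + G x w b * v c + v b * G x w c - G x (J x w) b * v (J x c)
        - v (J x b) * G x (J x w) c"
      unfolding v_def
      by (rule h.hamiltonian_equation) (intro DRic_hermitian lin x DRic_closed main)+
    then show "G x (nabla_endo G Q x w b) c = G x ((2 * G x V w) *\<^sub>R b + h.cproj V w b) c"
      unfolding DRic_def by (simp add: h.cproj_def h.h_simps h.h_j_skew[of V] V)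
  qed
  then show ?thesis by blast
qed

text \<open>The constant inverts the Ricci factor 2 (n + 2) of the Kaehler product of the metric
  with itself.\<close>

lemma schouten_einstein:
  assumes x: "x \<in> U" and E: "\<And>u v. ricci G x u v = k * G x u v"
  shows "schouten x (ricci G x) a b = k / (2 * (real CARD('n) + 2)) * G x a b"
proof -
  let ?n = "real CARD('n)"
  have "scal x = k * ?n"
    by (simp add: scal_onb[OF x] E sum_distrib_left[symmetric] inner_form.trace_h[OF inner_form_G[OF x]])
  then show ?thesis
    unfolding schouten_eq[OF x] E by (simp add: divide_simps) (simp add: algebra_simps)
qed

end

section \<open>The C-projective system\<close>

locale cc_chart = kaehler_chart U G J
  for U :: "(real ^ 'n::finite) set" and G :: "real ^ 'n \<Rightarrow> real ^ 'n \<Rightarrow> real ^ 'n \<Rightarrow> real"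
    and J :: "real ^ 'n \<Rightarrow> real ^ 'n \<Rightarrow> real ^ 'n" +
  fixes A :: "real ^ 'n \<Rightarrow> real ^ 'n \<Rightarrow> real ^ 'n" and \<Lambda> :: "real ^ 'n \<Rightarrow> real ^ 'n"
    and \<mu> :: "real ^ 'n \<Rightarrow> real" and B :: real
  assumes A_endo: "endo A" and \<Lambda>_smooth: "smooth \<Lambda>" and \<mu>_smooth: "smooth \<mu>"
    and A_sym: "x \<in> U \<Longrightarrow> G x (A x u) v = G x u (A x v)"
    and A_J: "x \<in> U \<Longrightarrow> A x (J x u) = J x (A x u)"
    and nabla_A: "x \<in> U \<Longrightarrow> nabla_endo G A x X Y = hermitian_form.cproj (G x) (J x) (\<Lambda> x) X Y"
    and nabla_\<Lambda>: "x \<in> U \<Longrightarrow> nabla \<Lambda> x X = \<mu> x *\<^sub>R X + B *\<^sub>R A x X"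
    and dderiv_\<mu>: "x \<in> U \<Longrightarrow> dderiv \<mu> x X = 2 * B * G x (\<Lambda> x) X"
begin

section \<open>Covariant derivatives of the operators in the system\<close>

abbreviation P where "P x X \<equiv> \<mu> x *\<^sub>R X + B *\<^sub>R A x X"

text \<open>A copy of \<open>cproj\<close> with the base point as an argument. It unfolds without
  knowing \<open>x \<in> U\<close>, so it can be treated as a field and differentiated.\<close>

definition N where
  "N x V X Y = G x X Y *\<^sub>R V + G x V Y *\<^sub>R X + G x (J x X) Y *\<^sub>R J x V + G x (J x V) Y *\<^sub>R J x X"

lemma N_eq: "x \<in> U \<Longrightarrow> hermitian_form.cproj (G x) (J x) V X Y = N x V X Y"
  by (simp add: hermitian_form.cproj_def[OF hermitian_form_G] N_def)

lemma N_linear: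
  assumes x: "x \<in> U"
  shows "linear (\<lambda>V. N x V X Y)" "linear (\<lambda>X. N x V X Y)" "linear (\<lambda>Y. N x V X Y)"
  unfolding N_def
  by (intro linearI; simp add: linear_real_simps[OF G_linear(1)[OF x]] linear_real_simps[OF G_linear(2)[OF x]]
      linear_add[OF endoD(1)[OF J_endo x]] linear_cmul[OF endoD(1)[OF J_endo x]] algebra_simps)+

lemma G_N: "x \<in> U \<Longrightarrow> G x (N x V X Y) Z =
    G x X Y * G x V Z + G x V Y * G x X Z + G x (J x X) Y * G x (J x V) Z + G x (J x V) Y * G x (J x X) Z"
  by (simp add: N_def linear_real_simps[OF G_linear(2)])

lemma N_smooth: "smooth V \<Longrightarrow> smooth X \<Longrightarrow> smooth Y \<Longrightarrow> smooth (\<lambda>y. N y (V y) (X y) (Y y))"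
  unfolding N_def
  by (intro smooth_on_open_add smooth_on_open_scaleR open_U smooth_metric J_smooth)

lemma nabla_N:
  assumes x: "x \<in> U" and V: "smooth V" and X: "smooth X" and Y: "smooth Y"
  shows "nabla (\<lambda>y. N y (V y) (X y) (Y y)) x w
    = N x (nabla V x w) (X x) (Y x) + N x (V x) (nabla X x w) (Y x) + N x (V x) (X x) (nabla Y x w)"
proof -
  have *: "nabla (\<lambda>y. G y (a y) (b y) *\<^sub>R c y) x w
      = (G x (nabla a x w) (b x) + G x (a x) (nabla b x w)) *\<^sub>R c x + G x (a x) (b x) *\<^sub>R nabla c x w"
    if "smooth a" "smooth b" "smooth c" for a b c
    by (simp add: nabla_scaleR[OF x smooth_metric] that nabla_metric[OF x])
  define t where "t a b c y = G y (a y) (b y) *\<^sub>R c y" for a b c :: "real ^ 'n \<Rightarrow> real ^ 'n" and y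
  have t: "smooth (t a b c)" if "smooth a" "smooth b" "smooth c" for a b c
    unfolding t_def by (intro smooth_on_open_scaleR open_U smooth_metric that)
  let ?JX = "\<lambda>y. J y (X y)" and ?JV = "\<lambda>y. J y (V y)"
  note JX = J_smooth[OF X] and JV = J_smooth[OF V]
  note s = t[OF X Y V] t[OF V Y X] t[OF JX Y JV] t[OF JV Y JX]
  have "nabla (\<lambda>y. N y (V y) (X y) (Y y)) x w
      = nabla (t X Y V) x w + nabla (t V Y X) x w + nabla (t ?JX Y ?JV) x w + nabla (t ?JV Y ?JX) x w"
    unfolding nabla_add[OF x s(1,2), symmetric]
      nabla_add[OF x smooth_on_open_add[OF open_U s(1,2)] s(3), symmetric]
      nabla_add[OF x smooth_on_open_add[OF open_U smooth_on_open_add[OF open_U s(1,2)] s(3)] s(4), symmetric]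
    by (simp only: N_def t_def)
  also have "\<dots> = N x (nabla V x w) (X x) (Y x) + N x (V x) (nabla X x w) (Y x) + N x (V x) (X x) (nabla Y x w)"
    unfolding t_def *[OF X Y V] *[OF V Y X] *[OF JX Y JV] *[OF JV Y JX] nabla_J_apply[OF x X] nabla_J_apply[OF x V]
    unfolding N_def by (simp add: algebra_simps)
  finally show ?thesis .
qed

lemma P_smooth: "smooth V \<Longrightarrow> smooth (\<lambda>y. P y (V y))"
  by (intro smooth_on_open_add smooth_on_open_scaleR smooth_on_open_const smooth_endo_apply[OF A_endo]
      \<mu>_smooth open_U)

lemma nabla_P:
  assumes x: "x \<in> U" and V: "smooth V"
  shows "nabla (\<lambda>y. P y (V y)) x w = (2 * B * G x (\<Lambda> x) w) *\<^sub>R V x + B *\<^sub>R N x (\<Lambda> x) w (V x) + P x (nabla V x w)"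
proof -
  note s = smooth_endo_apply[OF A_endo V]
  have "nabla (\<lambda>y. P y (V y)) x w = nabla (\<lambda>y. \<mu> y *\<^sub>R V y) x w + nabla (\<lambda>y. B *\<^sub>R A y (V y)) x w"
    by (rule nabla_add[OF x]) (intro smooth_on_open_scaleR smooth_on_open_const s V \<mu>_smooth open_U)+
  then show ?thesis
    by (simp add: nabla_scaleR[OF x \<mu>_smooth V] nabla_cmul[OF x s] nabla_endo_apply[OF x A_endo V]
        nabla_A[OF x] N_eq[OF x] dderiv_\<mu>[OF x] scaleR_add_right)
qed

text \<open>The Ricci identity with \<nabla>\<Lambda> = P; the Christoffel terms drop by symmetry.
  Collected, the right side is - B K(u, v) \<Lambda>.\<close>

lemma R_\<Lambda>:
  assumes x: "x \<in> U"
  shows "R x u v (\<Lambda> x) = (2 * B * G x (\<Lambda> x) u) *\<^sub>R v - (2 * B * G x (\<Lambda> x) v) *\<^sub>R u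
    + B *\<^sub>R (N x (\<Lambda> x) u v - N x (\<Lambda> x) v u)"
proof -
  have 1: "nabla (\<lambda>y. nabla \<Lambda> y v) x u = (2 * B * G x (\<Lambda> x) u) *\<^sub>R v + B *\<^sub>R N x (\<Lambda> x) u v + P x (\<Gamma> x u v)" for u v
    using nabla_cong[OF x smooth_nabla[OF \<Lambda>_smooth] nabla_\<Lambda>, of v u] nabla_P[OF x smooth_on_open_const, of v u]
    by (simp add: nabla_const)
  show ?thesis
    unfolding ricci_identity[OF x \<Lambda>_smooth, symmetric] 1 christoffel_sym[OF x, of v u]
    by (simp add: scaleR_diff_right)
qed

text \<open>The contraction has the coefficients 2 - 2 n + n - 4 = - (n + 2), the last two from the
  two traces of \<open>N\<close>.\<close>

lemma ricci_\<Lambda>: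
  assumes x: "x \<in> U"
  shows "Q x (\<Lambda> x) = (- (real CARD('n) + 2) * B) *\<^sub>R \<Lambda> x"
proof -
  interpret h: hermitian_form "G x" "J x" by (rule hermitian_form_G[OF x])
  note tr = sum.distrib sum_subtractf sum_distrib_left[symmetric] sum_distrib_right[symmetric]
    h.onb_expand[OF h.linear_h(1)] h.onb_expand[OF h.linear_h(2)] h.trace_h
    h.trace_hermitian_j[OF h.hermitian_sym_h]
  have "ricci G x u (\<Lambda> x) = - (real CARD('n) + 2) * B * G x u (\<Lambda> x)" for u
  proof -
    have 1: "(\<Sum>e\<in>h.onb. G x (N x (\<Lambda> x) e u) e) = real CARD('n) * G x u (\<Lambda> x)"
      unfolding G_N[OF x] by (simp add: h.h_j_skew[of _ u] tr h.h_simps sum_negf)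
        (simp add: h.h_j h.h_sym[of u] h.h_j_skew[of "\<Lambda> x"] h.h_simps)
    have 2: "(\<Sum>e\<in>h.onb. G x (N x (\<Lambda> x) u e) e) = 4 * G x u (\<Lambda> x)"
      unfolding G_N[OF x] by (simp add: tr) (simp add: h.h_j h.h_sym[of "\<Lambda> x" u] h.h_sym[of "J x (\<Lambda> x)"])
    have "ricci G x u (\<Lambda> x) = 2 * B * (\<Sum>e\<in>h.onb. G x (\<Lambda> x) e * G x u e) - 2 * B * G x (\<Lambda> x) u * real CARD('n)
        + B * (\<Sum>e\<in>h.onb. G x (N x (\<Lambda> x) e u) e) - B * (\<Sum>e\<in>h.onb. G x (N x (\<Lambda> x) u e) e)"
      unfolding ricci_onb[OF x] riemann_def R_\<Lambda>[OF x]
      by (simp add: h.h_simps tr right_diff_distrib mult.assoc)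
    then show ?thesis
      unfolding 1 2 by (simp add: tr h.h_sym[of "\<Lambda> x" u] algebra_simps)
  qed
  then show ?thesis
    using h.hermitian_symD(2)[OF ricci_hermitian[OF x]]
    by (intro h.h_eqI) (simp add: G_Q[OF x] h.h_simps h.h_sym[of "\<Lambda> x"])
qed

text \<open>The Ricci identity for the fields A w. Since \<open>N\<close> is symmetric in the two
  vectors following the base point, the \<mu> part of \<open>P\<close> drops out and the commutator
  of R(u, v) with \<open>A\<close> equals - B times that of K(u, v).\<close>

lemma R_A:
  assumes x: "x \<in> U"
  shows "R x u v (A x w) = A x (R x u v w) + N x (P x u) v w - N x (P x v) u w"
proof -
  note s = endoD(2)[OF A_endo]
  have 1: "nabla (\<lambda>y. A y w) y v = N y (\<Lambda> y) v w + A y (\<Gamma> y v w)" if "y \<in> U" for y v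
    using nabla_endo_apply[OF that A_endo smooth_on_open_const, of w v]
    by (simp add: nabla_A[OF that] N_eq[OF that] nabla_const)
  have "nabla (\<lambda>y. nabla (\<lambda>y. A y w) y v) x u = N x (P x u) v w + N x (\<Lambda> x) (\<Gamma> x u v) w
      + (N x (\<Lambda> x) v (\<Gamma> x u w) + N x (\<Lambda> x) u (\<Gamma> x v w)) + A x (nabla (\<lambda>y. \<Gamma> y v w) x u)" for u v
  proof -
    note sN = N_smooth[OF \<Lambda>_smooth smooth_on_open_const smooth_on_open_const]
    note sA = smooth_endo_apply[OF A_endo \<Gamma>_smooth]
    have "nabla (\<lambda>y. nabla (\<lambda>y. A y w) y v) x u = nabla (\<lambda>y. N y (\<Lambda> y) v w + A y (\<Gamma> y v w)) x u"
      by (rule nabla_cong[OF x smooth_nabla[OF s] 1])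
    also have "\<dots> = nabla (\<lambda>y. N y (\<Lambda> y) v w) x u + nabla (\<lambda>y. A y (\<Gamma> y v w)) x u"
      by (rule nabla_add[OF x sN sA])
    finally show ?thesis
      by (simp add: nabla_N[OF x \<Lambda>_smooth smooth_on_open_const smooth_on_open_const] nabla_const
          nabla_\<Lambda>[OF x] nabla_endo_apply[OF x A_endo \<Gamma>_smooth] nabla_A[OF x] N_eq[OF x])
  qed
  then show ?thesis
    using ricci_identity[OF x s, of w v u] christoffel_sym[OF x, of u v]
    by (simp add: curvature_endo_def linear_diff[OF endoD(1)[OF A_endo x]] algebra_simps)
qed

text \<open>Contracting the commutator identity writes Ric(v, A w) as a sum of forms symmetric in v
  and w. As \<open>A\<close> and Ricci are symmetric, this symmetry means that \<open>Q\<close> and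
  \<open>A\<close> commute.\<close>

lemma Q_A:
  assumes x: "x \<in> U"
  shows "Q x (A x u) = A x (Q x u)"
proof -
  interpret h: hermitian_form "G x" "J x" by (rule hermitian_form_G[OF x])
  note tr = sum.distrib sum_subtractf sum_distrib_left[symmetric] sum_distrib_right[symmetric]
    h.onb_expand[OF h.linear_h(1)] h.onb_expand[OF h.linear_h(2)] h.trace_h
    h.trace_hermitian_j[OF h.hermitian_sym_h]
  note T = kaehler_curvature_tensorD[OF riemann_curvature[OF x]]
  note pair = kaehler_curvature_tensor_pair[OF riemann_curvature[OF x]]
  note r = h.hermitian_symD[OF ricci_hermitian[OF x]]
  define p where "p u = P x u" for u
  have GP: "G x (p u) v = \<mu> x * G x u v + B * G x (A x u) v" for u v by (simp add: p_def h.h_simps)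
  have PJ: "J x (p u) = p (J x u)" for u by (simp add: p_def h.j_simps A_J[OF x])
  have Psym: "G x (p u) v = G x (p v) u" for u v
    unfolding GP using h.h_sym[of u v] A_sym[OF x, of u v] h.h_sym[of u "A x v"] by simp
  have Pj: "G x (p (J x u)) u = 0" for u
    using Psym[of "J x u" u] h.h_j_swap[of "p u" u] PJ[of u] h.h_sym[of "J x u" "p u"] by simp
  define t where "t = (\<Sum>e\<in>h.onb. G x (p e) e)"
  \<comment> \<open>The symmetric \<open>A\<close> moves to the first slot under the trace, and pair
    symmetry then exchanges the free vectors.\<close>
  have S: "(\<Sum>e\<in>h.onb. riemann G x e v w (A x e)) = (\<Sum>e\<in>h.onb. riemann G x e w v (A x e))" for v w
  proof -
    have "(\<Sum>e\<in>h.onb. riemann G x e v w (A x e)) = (\<Sum>e\<in>h.onb. riemann G x (A x e) v w e)"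
      by (rule h.trace_adjoint[symmetric, OF h.curvature_bilinear(1)[OF riemann_curvature[OF x]] A_sym[OF x]])
    moreover have "riemann G x (A x e) v w e = riemann G x e w v (A x e)" for e
      using pair[of "A x e" v w e] T(2)[of w e "A x e" v] T(3)[of e w "A x e" v] by simp
    ultimately show ?thesis by simp
  qed
  have "ricci G x v (A x w) = (\<Sum>e\<in>h.onb. riemann G x e v w (A x e))
      + (\<Sum>e\<in>h.onb. G x (N x (p e) v w) e) - (\<Sum>e\<in>h.onb. G x (N x (p v) e w) e)" for v w
    unfolding ricci_onb[OF x] riemann_def R_A[OF x, folded p_def]
    by (simp add: h.h_simps(1,3) sum.distrib sum_subtractf A_sym[OF x])
  moreover have "(\<Sum>e\<in>h.onb. G x (N x (p e) v w) e) = t * G x v w" for v w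
  proof -
    have "G x (N x (p e) v w) e = G x v w * G x (p e) e + G x (p w) e * G x v e
        + G x (p (J x w)) (- e) * G x (J x v) e" for e
      unfolding G_N[OF x] PJ using Pj[of e] Psym[of e w] Psym[of "J x e" w] h.h_j_skew[of e "p w"]
        PJ[of w] h.h_sym[of "p w" "J x e"] h.h_sym[of e "p (J x w)"]
      by (simp only: h.h_simps)
    then have "(\<Sum>e\<in>h.onb. G x (N x (p e) v w) e)
        = t * G x v w + G x (p w) v - G x (p (J x w)) (J x v)"
      by (simp only: h.h_simps) (simp add: tr t_def sum_negf mult.commute)
    then show ?thesis using PJ[of w] h.h_j[of "p w" v] by simp
  qed
  moreover have "(\<Sum>e\<in>h.onb. G x (N x (p v) e w) e) = real CARD('n) * G x (p v) w" for v w
  proof -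
    have "G x (N x (p v) e w) e = G x w e * G x (p v) e + G x (p v) w * G x e e
        - G x (J x w) e * G x (J x (p v)) e + G x (J x (p v)) w * G x (J x e) e" for e
      unfolding G_N[OF x] using h.h_j_skew[of e w] h.h_sym[of e "J x w"] h.h_sym[of e w] by simp
    then have "(\<Sum>e\<in>h.onb. G x (N x (p v) e w) e)
        = G x (p v) w + G x (p v) w * real CARD('n) - G x (J x (p v)) (J x w)"
      by (simp add: tr)
    then show ?thesis using h.h_j[of "p v" w] by simp
  qed
  ultimately have "ricci G x v (A x w) = ricci G x w (A x v)" for v w
    using S[of v w] h.h_sym[of v w] Psym[of v w] by simp
  then show ?thesis
    using r(2) by (intro h.h_eqI) (simp add: G_Q[OF x] A_sym[OF x] r(2)[of "A x u"])
qed

lemma ricci_of_nonzero: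
  assumes x: "x \<in> U" and L: "\<Lambda> x \<noteq> 0"
    and W: "\<And>X Y Z. metric_trace (G x) (\<lambda>u v. nabla_tensor4 G (bochner G J) x u v X Y Z) = 0"
  shows "ricci G x u v = - (real CARD('n) + 2) * B * G x u v"
proof -
  interpret h: hermitian_form "G x" "J x" by (rule hermitian_form_G[OF x])
  let ?k = "- (real CARD('n) + 2) * B"
  note Ql = linear_add[OF endoD(1)[OF Q_endo x]] linear_cmul[OF endoD(1)[OF Q_endo x]]
  obtain V where V: "nabla_endo G Q x w b = (2 * G x V w) *\<^sub>R b + h.cproj V w b" for w b
    using weakly_bochner_flat_ricci[OF x W] by blast
  \<comment> \<open>The derivative of the eigenvector equation for \<open>Q\<close> and \<Lambda>.
    Its right side commutes with \<open>J\<close>, because \<open>Q\<close> and \<open>P\<close>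
    do.\<close>
  have "(2 * G x V X) *\<^sub>R \<Lambda> x + h.cproj V X (\<Lambda> x) = ?k *\<^sub>R P x X - Q x (P x X)" for X
  proof -
    have "nabla (\<lambda>y. Q y (\<Lambda> y)) x X = ?k *\<^sub>R P x X"
      using nabla_cong[OF x smooth_endo_apply[OF Q_endo \<Lambda>_smooth] ricci_\<Lambda>, of X]
        nabla_cmul[OF x \<Lambda>_smooth, of ?k X] nabla_\<Lambda>[OF x, of X] by simp
    then show ?thesis
      using nabla_endo_apply[OF x Q_endo \<Lambda>_smooth, of X] nabla_\<Lambda>[OF x, of X] V[of X "\<Lambda> x"]
      by (simp add: algebra_simps)
  qed
  moreover have "?k *\<^sub>R P x (J x X) - Q x (P x (J x X)) = J x (?k *\<^sub>R P x X - Q x (P x X))" for X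
    by (simp add: A_J[OF x] Q_J[OF x] Ql h.j_simps)
  ultimately have "V = 0"
    by (intro h.gradient_vanishes[where L = "\<Lambda> x", OF _ L]) auto
  then have Q0: "nabla_endo G Q x w b = 0" for w b
    unfolding V h.cproj_def by (simp add: h.h_simps linear_0[OF h.linear_j])
  \<comment> \<open>With the derivative of \<open>Q\<close> zero at \<open>x\<close>,
    differentiating the commutation of \<open>Q\<close> and \<open>A\<close> leaves only
    \<nabla>A.\<close>
  have comm: "Q x (h.cproj (\<Lambda> x) X Y) = h.cproj (\<Lambda> x) X (Q x Y)" for X Y
  proof -
    have "nabla (\<lambda>y. Q y (A y Y)) x X = nabla (\<lambda>y. A y (Q y Y)) x X"
      by (rule nabla_cong[OF x smooth_endo_apply[OF Q_endo endoD(2)[OF A_endo]] Q_A])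
    moreover have "nabla (\<lambda>y. Q y (A y Y)) x X = Q x (h.cproj (\<Lambda> x) X Y + A x (\<Gamma> x X Y))"
      using nabla_endo_apply[OF x A_endo smooth_on_open_const, of Y X]
      by (simp add: nabla_endo_apply[OF x Q_endo endoD(2)[OF A_endo]] Q0 nabla_A[OF x] nabla_const)
    moreover have "nabla (\<lambda>y. A y (Q y Y)) x X = h.cproj (\<Lambda> x) X (Q x Y) + A x (Q x (\<Gamma> x X Y))"
      using nabla_endo_apply[OF x Q_endo smooth_on_open_const, of Y X]
      by (simp add: nabla_endo_apply[OF x A_endo endoD(2)[OF Q_endo]] Q0 nabla_A[OF x] nabla_const)
    ultimately show ?thesis by (simp add: Ql Q_A[OF x])
  qed
  have "Q x u - ?k *\<^sub>R u = 0" for u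
  proof (rule h.cproj_commutant_vanishes[where Q = "\<lambda>u. Q x u - ?k *\<^sub>R u", OF _ _ _ L])
    show "linear (\<lambda>u. Q x u - ?k *\<^sub>R u)"
      by (intro linear_compose_sub endoD(1)[OF Q_endo x] linear_compose_scale_right linear_id[unfolded id_def])
    show "Q x (\<Lambda> x) - ?k *\<^sub>R \<Lambda> x = 0" using ricci_\<Lambda>[OF x] by simp
    show "Q x (J x X) - ?k *\<^sub>R J x X = J x (Q x X - ?k *\<^sub>R X)" for X
      by (simp only: h.j_simps Q_J[OF x])
    show "Q x (h.cproj (\<Lambda> x) X Y) - ?k *\<^sub>R h.cproj (\<Lambda> x) X Y = h.cproj (\<Lambda> x) X (Q x Y - ?k *\<^sub>R Y)" for X Y
      using linear_diff[OF N_linear(3)[OF x]] linear_cmul[OF N_linear(3)[OF x]] comm[of X Y]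
      by (simp add: N_eq[OF x])
  qed
  then have "Q x u = ?k *\<^sub>R u" by simp
  then show ?thesis using G_Q[OF x, of u v] by (simp add: h.h_simps)
qed

end

subsection \<open>Unique continuation\<close>

text \<open>The product of \<phi> with exp(- K t) is nonincreasing and starts at 0.\<close>

lemma gronwall_zero:
  fixes \<phi> :: "real \<Rightarrow> real"
  assumes der: "\<And>t. 0 \<le> t \<Longrightarrow> t \<le> 1 \<Longrightarrow> (\<phi> has_real_derivative \<phi>' t) (at t)"
    and le: "\<And>t. 0 \<le> t \<Longrightarrow> t \<le> 1 \<Longrightarrow> \<phi>' t \<le> K * \<phi> t"
    and 0: "\<phi> 0 = 0"
  shows "\<phi> 1 \<le> 0"
proof -
  have "exp (- K * 1) * \<phi> 1 \<le> exp (- K * 0) * \<phi> 0"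
  proof (rule DERIV_nonpos_imp_nonincreasing[where f = "\<lambda>t. exp (- K * t) * \<phi> t"])
    fix t :: real assume t: "0 \<le> t" "t \<le> 1"
    have "((\<lambda>t. exp (- K * t) * \<phi> t) has_real_derivative exp (- K * t) * (\<phi>' t - K * \<phi> t)) (at t)"
      by (rule derivative_eq_intros der t refl | simp add: algebra_simps)+
    moreover have "exp (- K * t) * (\<phi>' t - K * \<phi> t) \<le> 0"
      using le[OF t] by (intro mult_nonneg_nonpos) auto
    ultimately show "\<exists>y. ((\<lambda>t. exp (- K * t) * \<phi> t) has_real_derivative y) (at t) \<and> y \<le> 0" by blast
  qed simp
  then show ?thesis by (simp add: 0 mult_le_0_iff)
qed

text \<open>Compactness bounds the images of the finitely many basis vectors, and by linearity these
  bounds add up to one uniform in the point.\<close>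

lemma linear_field_bound:
  fixes T :: "'e::topological_space \<Rightarrow> real ^ 'n::finite \<Rightarrow> 'b::real_normed_vector"
  assumes K: "compact K" and lin: "\<And>y. y \<in> K \<Longrightarrow> linear (T y)"
    and cont: "\<And>u. continuous_on K (\<lambda>y. T y u)"
  shows "\<exists>C\<ge>0. \<forall>y\<in>K. \<forall>v. norm (T y v) \<le> C * norm v"
proof -
  have "\<exists>M\<ge>0. \<forall>y\<in>K. norm (T y (axis i 1)) \<le> M" for i
    using compact_imp_bounded[OF compact_continuous_image[OF cont[of "axis i 1"] K]]
    unfolding bounded_pos by (meson imageI less_imp_le)
  then obtain M where M: "M i \<ge> 0" "y \<in> K \<Longrightarrow> norm (T y (axis i 1)) \<le> M i" for i y by metis
  have "norm (T y v) \<le> (\<Sum>i\<in>UNIV. M i) * norm v" if "y \<in> K" for y v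
  proof -
    have "norm (T y v) \<le> (\<Sum>i\<in>UNIV. norm ((v $ i) *\<^sub>R T y (axis i 1)))"
      by (subst linear_axis_expansion[OF lin[OF that]]) (rule norm_sum)
    also have "\<dots> \<le> (\<Sum>i\<in>UNIV. norm v * M i)"
      using M(2)[OF that] component_le_norm_cart[of v] by (intro sum_mono) (simp add: mult_mono)
    finally show ?thesis by (simp add: sum_distrib_left mult.commute)
  qed
  then show ?thesis using M(1) by (intro exI[of _ "\<Sum>i\<in>UNIV. M i"]) (auto intro: sum_nonneg)
qed

lemma inner_le_bound:
  fixes u v :: "'a::real_inner"
  assumes "norm u \<le> s" "norm v \<le> c * s"
  shows "u \<bullet> v \<le> c * s\<^sup>2"
proof -
  have "u \<bullet> v \<le> norm u * norm v" by (rule norm_cauchy_schwarz)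
  also have "\<dots> \<le> s * (c * s)"
    using assms order_trans[OF norm_ge_zero assms(1)] by (intro mult_mono) auto
  finally show ?thesis by (simp add: power2_eq_square mult_ac)
qed

lemma has_real_derivative_norm_square_along:
  fixes f :: "'e::real_normed_vector \<Rightarrow> 'b::real_inner"
  assumes "f differentiable at (p + t *\<^sub>R w)"
  shows "((\<lambda>s. f (p + s *\<^sub>R w) \<bullet> f (p + s *\<^sub>R w)) has_real_derivative
    2 * (f (p + t *\<^sub>R w) \<bullet> dderiv f (p + t *\<^sub>R w) w)) (at t)"
proof -
  have d: "(\<lambda>y. f y \<bullet> f y) differentiable at (p + t *\<^sub>R w)"
    by (rule differentiable_bounded_bilinear[OF bounded_bilinear_inner assms assms])
  show ?thesis
    using has_real_derivative_along[OF d]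
    by (simp add: dderiv_bounded_bilinear[OF bounded_bilinear_inner assms assms] inner_commute)
qed

section \<open>Propagation of the zeros of \<Lambda> inside a chart\<close>

context cc_chart
begin

lemma P_linear: "x \<in> U \<Longrightarrow> linear (P x)"
  by (intro linearI) (simp_all add: linear_add[OF endoD(1)[OF A_endo]] linear_cmul[OF endoD(1)[OF A_endo]] algebra_simps)

text \<open>\<open>\<Lambda>\<close> and \<open>P\<close> together satisfy a linear first order system along each segment.\<close>

lemma continuation:
  assumes W: "convex W" "W \<subseteq> U" and y: "y \<in> W" and z: "z \<in> W"
    and \<Lambda>0: "\<Lambda> y = 0" and P0: "\<And>X. P y X = 0"
  shows "\<Lambda> z = 0"
proof -
  define w where "w = z - y"
  define e :: "'n \<Rightarrow> real ^ 'n" where "e i = axis i 1" for i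
  define p where "p i x = P x (e i)" for i x
  define K where "K = (\<lambda>t. y + t *\<^sub>R w) ` {0..1}"
  have mem: "y + t *\<^sub>R w \<in> W" if "0 \<le> t" "t \<le> 1" for t
    using convexD[OF W(1) y z, of "1 - t" t] that by (simp add: w_def algebra_simps)
  have KU: "K \<subseteq> U" using mem W(2) by (auto simp: K_def)
  have K: "compact K"
    unfolding K_def by (intro compact_continuous_image continuous_intros) auto
  have cont: "continuous_on K f" if "smooth f" for f :: "real ^ 'n \<Rightarrow> real ^ 'n"
    using smooth_on_open_continuous[OF that] continuous_on_subset KU by blast
  note cs = smooth_on_open_const
  obtain C where C: "C \<ge> 0" "\<And>x v. x \<in> K \<Longrightarrow> norm (\<Gamma> x w v) \<le> C * norm v"
    using linear_field_bound[OF K, of "\<lambda>x. \<Gamma> x w"] \<Gamma>_linear(1) cont[OF \<Gamma>_smooth] KU by blast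
  \<comment> \<open>The part of the derivative of the i-th column of \<open>P\<close> that is driven
    by \<Lambda>; it is linear in \<Lambda>, which closes the system.\<close>
  define S where "S i x l = (2 * B * G x l w) *\<^sub>R e i + B *\<^sub>R N x l w (e i)" for i x l
  have "linear (S i x)" if "x \<in> U" for i x
    unfolding S_def using linear_add[OF N_linear(1)[OF that]] linear_cmul[OF N_linear(1)[OF that]]
    by (intro linearI) (simp_all add: linear_real_simps[OF G_linear(2)[OF that]] algebra_simps)
  moreover have "smooth (\<lambda>x. S i x l)" for i l
    unfolding S_def
    by (intro smooth_on_open_add smooth_on_open_scaleR smooth_on_open_mult smooth_metric N_smooth cs open_U)
  ultimately have "\<exists>D\<ge>0. \<forall>x\<in>K. \<forall>v. norm (S i x v) \<le> D * norm v" for i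
    using linear_field_bound[OF K, of "S i"] cont KU by blast
  then obtain D where D: "D i \<ge> 0" "\<And>x v. x \<in> K \<Longrightarrow> norm (S i x v) \<le> D i * norm v" for i
    by metis
  have ps: "smooth (p i)" for i unfolding p_def by (rule P_smooth[OF cs])
  have d\<Lambda>: "dderiv \<Lambda> x w = P x w - \<Gamma> x w (\<Lambda> x)" if "x \<in> U" for x
    using nabla_\<Lambda>[OF that, of w] by (simp add: nabla_vec_def eq_diff_eq)
  have dp: "dderiv (p i) x w = S i x (\<Lambda> x) + P x (\<Gamma> x w (e i)) - \<Gamma> x w (p i x)" if "x \<in> U" for x i
    using nabla_P[OF that cs, of "e i" w] unfolding nabla_const
    unfolding nabla_vec_def p_def[symmetric] S_def by (simp add: eq_diff_eq)
  \<comment> \<open>The squared Euclidean length of all unknowns, \<Lambda> and the columns of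
    \<open>P\<close>. Its square root bounds each of them, hence also their derivatives up to
    constants.\<close>
  define \<phi> where "\<phi> x = \<Lambda> x \<bullet> \<Lambda> x + (\<Sum>i\<in>UNIV. p i x \<bullet> p i x)" for x
  define \<phi>' where "\<phi>' x = 2 * (\<Lambda> x \<bullet> dderiv \<Lambda> x w) + (\<Sum>i\<in>UNIV. 2 * (p i x \<bullet> dderiv (p i) x w))" for x
  define n where "n = real CARD('n)"
  \<comment> \<open>The summands bound, in turn, P w expanded in columns and the Christoffel term;
    in \<open>c2\<close> the \<Lambda> term, \<open>P\<close> applied to a Christoffel vector, and
    again the Christoffel term.\<close>
  define c1 where "c1 = n * norm w + C"
  define c2 where "c2 i = D i + n * C + C" for i
  have bound: "\<phi>' x \<le> (2 * c1 + (\<Sum>i\<in>UNIV. 2 * c2 i)) * \<phi> x" if x: "x \<in> K" for x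
  proof -
    have xU: "x \<in> U" using x KU by blast
    define s where "s = sqrt (\<phi> x)"
    have nn: "0 \<le> (\<Sum>i\<in>UNIV. p i x \<bullet> p i x)" by (intro sum_nonneg) simp
    then have "\<phi> x \<ge> 0" by (simp add: \<phi>_def)
    then have s2: "s\<^sup>2 = \<phi> x" "s \<ge> 0" by (auto simp: s_def)
    have "\<Lambda> x \<bullet> \<Lambda> x \<le> \<phi> x" using nn by (simp add: \<phi>_def)
    then have l: "norm (\<Lambda> x) \<le> s" unfolding norm_eq_sqrt_inner s_def by simp
    have "p i x \<bullet> p i x \<le> \<phi> x" for i
      unfolding \<phi>_def using member_le_sum[of i UNIV "\<lambda>i. p i x \<bullet> p i x"] by (simp add: add_increasing)
    then have pi: "norm (p i x) \<le> s" for i unfolding norm_eq_sqrt_inner s_def by simp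
    have PX: "norm (P x X) \<le> n * norm X * s" for X
    proof -
      have "norm (P x X) \<le> (\<Sum>i\<in>UNIV. norm ((X $ i) *\<^sub>R p i x))"
        unfolding p_def e_def by (subst linear_axis_expansion[OF P_linear[OF xU]]) (rule norm_sum)
      also have "\<dots> \<le> (\<Sum>i\<in>(UNIV :: 'n set). norm X * s)"
        using pi component_le_norm_cart[of X] by (intro sum_mono) (simp add: mult_mono)
      finally show ?thesis by (simp add: n_def mult.assoc)
    qed
    have \<Gamma>s: "norm (\<Gamma> x w v) \<le> C * s" if "norm v \<le> s" for v
      using C(2)[OF x, of v] mult_left_mono[OF that C(1)] by simp
    have "norm (dderiv \<Lambda> x w) \<le> norm (P x w) + norm (\<Gamma> x w (\<Lambda> x))"
      unfolding d\<Lambda>[OF xU] by (rule norm_triangle_ineq4)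
    also have "\<dots> \<le> c1 * s" using PX[of w] \<Gamma>s[OF l] by (simp add: c1_def distrib_right)
    finally have 1: "\<Lambda> x \<bullet> dderiv \<Lambda> x w \<le> c1 * s\<^sup>2" by (rule inner_le_bound[OF l])
    have 2: "p i x \<bullet> dderiv (p i) x w \<le> c2 i * s\<^sup>2" for i
    proof (rule inner_le_bound[OF pi])
      have "norm (dderiv (p i) x w) \<le> norm (S i x (\<Lambda> x)) + norm (P x (\<Gamma> x w (e i))) + norm (\<Gamma> x w (p i x))"
        unfolding dp[OF xU]
        by (rule order_trans[OF norm_triangle_ineq4]) (intro add_mono norm_triangle_ineq order_refl)
      moreover have "norm (S i x (\<Lambda> x)) \<le> D i * s"
        using D(2)[OF x, of i "\<Lambda> x"] mult_left_mono[OF l D(1)] order_trans by blast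
      moreover have "norm (P x (\<Gamma> x w (e i))) \<le> n * C * s"
      proof -
        have "norm (\<Gamma> x w (e i)) \<le> C" using C(2)[OF x, of "e i"] by (simp add: e_def)
        then have "n * norm (\<Gamma> x w (e i)) * s \<le> n * C * s"
          using s2(2) by (intro mult_right_mono mult_left_mono) (simp_all add: n_def)
        then show ?thesis using PX[of "\<Gamma> x w (e i)"] by linarith
      qed
      ultimately show "norm (dderiv (p i) x w) \<le> c2 i * s"
        using \<Gamma>s[OF pi, of i] by (simp add: c2_def distrib_right)
    qed
    have "\<phi>' x \<le> 2 * (c1 * s\<^sup>2) + (\<Sum>i\<in>UNIV. 2 * (c2 i * s\<^sup>2))"
      unfolding \<phi>'_def using 1 2 by (intro add_mono sum_mono) auto
    then show ?thesis by (simp add: s2 distrib_right sum_distrib_right mult.assoc)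
  qed
  have "\<phi> (y + 1 *\<^sub>R w) \<le> 0"
  proof (rule gronwall_zero[where \<phi> = "\<lambda>t. \<phi> (y + t *\<^sub>R w)"])
    fix t :: real assume t: "0 \<le> t" "t \<le> 1"
    note d = smooth_on_open_differentiable[OF _ subsetD[OF W(2) mem[OF t]]]
    show "((\<lambda>t. \<phi> (y + t *\<^sub>R w)) has_real_derivative \<phi>' (y + t *\<^sub>R w)) (at t)"
      unfolding \<phi>_def \<phi>'_def
      by (intro DERIV_add DERIV_sum has_real_derivative_norm_square_along d \<Lambda>_smooth ps)
    show "\<phi>' (y + t *\<^sub>R w) \<le> (2 * c1 + (\<Sum>i\<in>UNIV. 2 * c2 i)) * \<phi> (y + t *\<^sub>R w)"
      by (rule bound) (use t in \<open>auto simp: K_def\<close>)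
  next
    show "\<phi> (y + 0 *\<^sub>R w) = 0" by (simp add: \<phi>_def \<Lambda>0 p_def P0)
  qed
  moreover have "0 \<le> (\<Sum>i\<in>UNIV. p i z \<bullet> p i z)" by (intro sum_nonneg) simp
  ultimately have "\<Lambda> z \<bullet> \<Lambda> z \<le> 0" by (simp add: \<phi>_def w_def)
  then show ?thesis by (metis inner_eq_zero_iff inner_ge_zero order_antisym)
qed

text \<open>On an open set of zeros the derivative of \<Lambda> vanishes too, so P =
  \<nabla>\<Lambda> is zero at \<open>y\<close> and the initial data are complete.\<close>

lemma continuation_open:
  assumes W: "convex W" "W \<subseteq> U" and V: "open V" "V \<subseteq> U" "y \<in> V" "y \<in> W" and z: "z \<in> W"
    and 0: "\<And>x. x \<in> V \<Longrightarrow> \<Lambda> x = 0"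
  shows "\<Lambda> z = 0"
proof (rule continuation[OF W V(4) z 0[OF V(3)]])
  have y: "y \<in> U" using V by blast
  have "dderiv \<Lambda> y X = dderiv (\<lambda>x. 0) y X" for X
    by (rule dderiv_cong[OF _ V(1,3)]) (use 0 in auto)
  then show "P y X = 0" for X
    using nabla_\<Lambda>[OF y, of X] 0[OF V(3)] linear_0[OF \<Gamma>_linear(1)[OF y]] by (simp add: nabla_vec_def)
qed

text \<open>The points where the identity fails form an open set; if nonempty, it would contain a
  point with \<Lambda> nonzero, where the identity is known.\<close>

lemma ricci_of_dense:
  assumes dense: "\<And>W. open W \<Longrightarrow> W \<subseteq> U \<Longrightarrow> W \<noteq> {} \<Longrightarrow> \<exists>y\<in>W. \<Lambda> y \<noteq> 0"
    and W: "\<And>x X Y Z. x \<in> U \<Longrightarrow> metric_trace (G x) (\<lambda>u v. nabla_tensor4 G (bochner G J) x u v X Y Z) = 0"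
    and x: "x \<in> U"
  shows "ricci G x u v = - (real CARD('n) + 2) * B * G x u v"
proof -
  let ?f = "\<lambda>y. ricci G y u v - - (real CARD('n) + 2) * B * G y u v"
  have "smooth ?f"
    by (intro smooth_on_open_diff smooth_on_open_mult smooth_on_open_const open_U ricci_smooth G_smooth)
  from continuous_open_preimage[OF smooth_on_open_continuous[OF this] open_U
      open_Compl[OF closed_singleton[of 0]]]
  have op: "open (U \<inter> ?f -` (- {0}))" .
  show ?thesis
  proof (rule ccontr)
    assume "\<not> ?thesis"
    then have "x \<in> U \<inter> ?f -` (- {0})" using x by simp
    then obtain y where y: "y \<in> U" "?f y \<noteq> 0" "\<Lambda> y \<noteq> 0"
      using dense[OF op] by blast
    then show False using ricci_of_nonzero[OF y(1,3) W[OF y(1)]] by simp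
  qed
qed

end

section \<open>Consequences of Bochner flatness in a chart\<close>

context kaehler_chart
begin

lemma bochner_flat_einstein_curvature:
  assumes x: "x \<in> U" and E: "\<And>u v. ricci G x u v = k * G x u v"
    and flat: "\<And>X Y Z W. bochner G J x X Y Z W = 0" and u: "u \<noteq> 0"
  shows "sectional_curvature G x u (J x u) = 4 * k / (real CARD('n) + 2)"
proof -
  interpret h: hermitian_form "G x" "J x" by (rule hermitian_form_G[OF x])
  define \<kappa> where "\<kappa> = k / (2 * (real CARD('n) + 2))"
  have F: "schouten x (ricci G x) a b = \<kappa> * G x a b" for a b
    using schouten_einstein[OF x E] by (simp add: \<kappa>_def)
  \<comment> \<open>On u, Ju, Ju, u the Kaehler product of the metric with itself is 8 |u|^4: the
    plain terms give 2, the terms with \<open>J\<close> give 2, the doubled ones 4.\<close>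
  have "riemann G x u (J x u) (J x u) u = 8 * \<kappa> * (G x u u)\<^sup>2"
    using bochner_eq[OF x] flat unfolding kaehler_product_def F
    by (simp add: h.jj h.h_simps h.h_j h.h_j_self power2_eq_square)
  then have "sectional_curvature G x u (J x u) = 8 * \<kappa>"
    unfolding sectional_curvature_def using h.h_pos[OF u]
    by (simp add: h.h_j h.h_j_self power2_eq_square)
  then show ?thesis by (simp add: \<kappa>_def divide_simps) (simp add: algebra_simps)
qed

lemma bochner_flat_imp_weakly:
  assumes "\<And>x X Y Z W. x \<in> U \<Longrightarrow> bochner G J x X Y Z W = 0" and x: "x \<in> U"
  shows "metric_trace (G x) (\<lambda>u v. nabla_tensor4 G (bochner G J) x u v X Y Z) = 0"
proof -
  have "dderiv (\<lambda>y. bochner G J y a b c d) x w = dderiv (\<lambda>y. 0) x w" for a b c d w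
    by (rule dderiv_cong[OF _ open_U x]) (simp_all add: assms(1))
  then show ?thesis by (simp add: nabla_tensor4_def assms metric_trace_def)
qed

end

subsection \<open>Charts\<close>

lemma is_chart_preimage_open:
  assumes c: "is_chart M c" and W: "open W" "W \<subseteq> coord_dom c"
  shows "openin M {p \<in> fst c. snd c p \<in> W}"
proof -
  have o: "openin M (fst c)" and h: "homeomorphic_map (subtopology M (fst c)) (top_of_set (coord_dom c)) (snd c)"
    using c by (auto simp: is_chart_def)
  have "openin (top_of_set (coord_dom c)) W" using W by (simp add: openin_open) blast
  from openin_continuous_map_preimage[OF homeomorphic_imp_continuous_map[OF h] this]
  have "openin (subtopology M (fst c)) {p \<in> fst c. snd c p \<in> W}"
    unfolding topspace_subtopology_subset[OF openin_subset[OF o]] .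
  then show ?thesis using openin_open_subtopology[OF o] by blast
qed

lemma is_chart_image_open:
  assumes c: "is_chart M c" and Z: "openin M Z"
  shows "open (snd c ` (fst c \<inter> Z))"
proof -
  have o: "open (coord_dom c)" and h: "homeomorphic_map (subtopology M (fst c)) (top_of_set (coord_dom c)) (snd c)"
    using c by (auto simp: is_chart_def)
  have "openin (subtopology M (fst c)) (fst c \<inter> Z)"
    using Z by (metis inf_commute openin_subtopology_Int)
  then have "openin (top_of_set (coord_dom c)) (snd c ` (fst c \<inter> Z))"
    using homeomorphic_imp_open_map[OF h] by (simp add: open_map_def)
  then show ?thesis using o openin_open_eq by blast
qed

lemma is_chart_inv:
  assumes c: "is_chart M c" and p: "p \<in> fst c"
  shows "chart_inv c (snd c p) = p"
proof -
  have o: "openin M (fst c)" and h: "homeomorphic_map (subtopology M (fst c)) (top_of_set (coord_dom c)) (snd c)"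
    using c by (auto simp: is_chart_def)
  have "inj_on (snd c) (fst c)"
    using homeomorphic_imp_injective_map[OF h]
    unfolding topspace_subtopology_subset[OF openin_subset[OF o]] .
  then show ?thesis unfolding chart_inv_def using p by (rule inv_into_f_f)
qed

lemma kaehler_manifold_chart:
  assumes "kaehler_manifold M \<A> g J" and c: "c \<in> \<A>"
  shows "kaehler_chart (coord_dom c) (g c) (J c)"
proof -
  have r: "riemannian_chart (coord_dom c) (g c)"
    using assms unfolding kaehler_manifold_def smooth_manifold_def is_chart_def riemannian_metric_def
    by unfold_locales auto
  show ?thesis
    using assms unfolding kaehler_manifold_def endomorphism_field_def
    by (intro kaehler_chart.intro r kaehler_chart_axioms.intro)
      (auto simp: riemannian_chart.endo_def[OF r])
qed

section \<open>From charts to a connected manifold\<close>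

locale cc_manifold =
  fixes M :: "'a topology" and \<A> :: "('a, 'n::finite) chart set"
    and g :: "('a, 'n) formfield" and J :: "('a, 'n) endofield" and B :: real
    and A :: "('a, 'n) endofield" and \<Lambda> :: "('a, 'n) vfield" and \<mu> :: "'a \<Rightarrow> real"
  assumes kaehler: "kaehler_manifold M \<A> g J" and connected: "connected_space M"
    and hermitian: "hermitian_endomorphism \<A> g J A"
    and vector_field_\<Lambda>: "vector_field \<A> \<Lambda>"
    and smooth_\<mu>: "smooth_function \<A> \<mu>"
    and nonzero: "\<exists>c\<in>\<A>. \<exists>x\<in>coord_dom c. \<Lambda> c x \<noteq> 0"
    and eq_A: "\<forall>c\<in>\<A>. \<forall>x\<in>coord_dom c. \<forall>X Y.
        nabla_endo (g c) (A c) x X Y =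
            g c x X Y *\<^sub>R \<Lambda> c x + g c x (\<Lambda> c x) Y *\<^sub>R X
          + g c x (J c x X) Y *\<^sub>R J c x (\<Lambda> c x) + g c x (J c x (\<Lambda> c x)) Y *\<^sub>R J c x X"
    and eq_\<Lambda>: "\<forall>c\<in>\<A>. \<forall>x\<in>coord_dom c. \<forall>X.
        nabla_vec (g c) (\<Lambda> c) x X = \<mu> (chart_inv c x) *\<^sub>R X + B *\<^sub>R A c x X"
    and eq_\<mu>: "\<forall>c\<in>\<A>. \<forall>x\<in>coord_dom c. \<forall>X.
        frechet_derivative (\<mu> \<circ> chart_inv c) (at x) X = 2 * B * g c x (\<Lambda> c x) X"
begin

lemma chart: "c \<in> \<A> \<Longrightarrow> is_chart M c"
  using kaehler unfolding kaehler_manifold_def smooth_manifold_def by blast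

lemma cc_chart:
  assumes c: "c \<in> \<A>"
  shows "cc_chart (coord_dom c) (g c) (J c) (A c) (\<Lambda> c) (\<mu> \<circ> chart_inv c) B"
proof -
  interpret k: kaehler_chart "coord_dom c" "g c" "J c" by (rule kaehler_manifold_chart[OF kaehler c])
  show ?thesis
  proof
    show "k.endo (A c)"
      using hermitian c unfolding hermitian_endomorphism_def endomorphism_field_def k.endo_def by blast
    show "k.smooth (\<Lambda> c)" using vector_field_\<Lambda> c unfolding vector_field_def by blast
    show "k.smooth (\<mu> \<circ> chart_inv c)" using smooth_\<mu> c unfolding smooth_function_def by blast
    fix x u v X Y assume x: "x \<in> coord_dom c"
    show "g c x (A c x u) v = g c x u (A c x v)" "A c x (J c x u) = J c x (A c x u)"
      using hermitian c x unfolding hermitian_endomorphism_def by blast+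
    show "nabla_endo (g c) (A c) x X Y = hermitian_form.cproj (g c x) (J c x) (\<Lambda> c x) X Y"
      using eq_A c x by (simp add: hermitian_form.cproj_def[OF k.hermitian_form_G[OF x]])
    show "nabla_vec (g c) (\<Lambda> c) x X = (\<mu> \<circ> chart_inv c) x *\<^sub>R X + B *\<^sub>R A c x X"
      using eq_\<Lambda> c x by simp
    show "dderiv (\<mu> \<circ> chart_inv c) x X = 2 * B * g c x (\<Lambda> c x) X"
      using eq_\<mu> c x by blast
  qed
qed

text \<open>All charts at \<open>p\<close> are quantified to have a subset of the manifold; by the
  transformation law one of them decides.\<close>

definition zeros where
  "zeros = {p \<in> topspace M. \<forall>c\<in>\<A>. p \<in> fst c \<longrightarrow> \<Lambda> c (snd c p) = 0}"

lemma zeros_chart: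
  assumes c: "c \<in> \<A>" and p: "p \<in> fst c"
  shows "p \<in> zeros \<longleftrightarrow> \<Lambda> c (snd c p) = 0"
proof
  assume 0: "\<Lambda> c (snd c p) = 0"
  have "\<Lambda> d (snd d p) = 0" if d: "d \<in> \<A>" "p \<in> fst d" for d
  proof -
    let ?x = "snd c p"
    have x: "?x \<in> coord_overlap c d" using p d by (simp add: coord_overlap_def)
    have "transition c d differentiable at ?x"
      using kaehler c d x unfolding kaehler_manifold_def smooth_manifold_def
      by (blast intro: smooth_on_open_differentiable)
    then have "jacobian c d ?x 0 = 0"
      unfolding jacobian_def by (rule linear_0[OF linear_frechet_derivative])
    moreover have "\<Lambda> d (transition c d ?x) = jacobian c d ?x (\<Lambda> c ?x)"
      using vector_field_\<Lambda> c d x unfolding vector_field_def by blast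
    ultimately show ?thesis using 0 is_chart_inv[OF chart[OF c] p] by (simp add: transition_def)
  qed
  moreover have "p \<in> topspace M" using chart[OF c] p openin_subset unfolding is_chart_def by blast
  ultimately show "p \<in> zeros" by (simp add: zeros_def)
qed (use c p in \<open>simp add: zeros_def\<close>)

text \<open>A coordinate ball around a closure point is convex and meets the interior, so
  continuation fills the whole ball with zeros.\<close>

lemma interior_zeros_closed: "M closure_of (M interior_of zeros) \<subseteq> M interior_of zeros"
proof
  let ?Z = "M interior_of zeros"
  fix p assume p: "p \<in> M closure_of ?Z"
  then have "p \<in> topspace M" by (simp add: in_closure_of)
  then obtain c where c: "c \<in> \<A>" "p \<in> fst c"
    using kaehler unfolding kaehler_manifold_def smooth_manifold_def by blast
  interpret cc: cc_chart "coord_dom c" "g c" "J c" "A c" "\<Lambda> c" "\<mu> \<circ> chart_inv c" B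
    by (rule cc_chart[OF c(1)])
  let ?x = "snd c p"
  have "?x \<in> coord_dom c" using c by (simp add: coord_dom_def)
  then obtain r where r: "r > 0" "ball ?x r \<subseteq> coord_dom c"
    using cc.open_U open_contains_ball by blast
  let ?N = "{q \<in> fst c. snd c q \<in> ball ?x r}"
  have N: "openin M ?N" by (rule is_chart_preimage_open[OF chart[OF c(1)] _ r(2)]) simp
  have pN: "p \<in> ?N" using c r by simp
  obtain q where q: "q \<in> ?Z" "q \<in> ?N"
    using p[unfolded in_closure_of, THEN conjunct2, rule_format, OF conjI[OF pN N]] by (elim exE conjE)
  have ball: "\<Lambda> c z = 0" if z: "z \<in> ball ?x r" for z
  proof (rule cc.continuation_open[OF convex_ball r(2) _ _ _ _ z])
    let ?V = "snd c ` (fst c \<inter> ?Z)"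
    show "open ?V" by (rule is_chart_image_open[OF chart[OF c(1)] openin_interior_of])
    show "?V \<subseteq> coord_dom c" by (auto simp: coord_dom_def)
    show "snd c q \<in> ?V" "snd c q \<in> ball ?x r" using q by auto
    show "\<Lambda> c x = 0" if "x \<in> ?V" for x
      using that zeros_chart[OF c(1)] interior_of_subset[of M zeros] by blast
  qed
  then have "?N \<subseteq> zeros" using zeros_chart[OF c(1)] by blast
  then show "p \<in> ?Z" using interior_of_maximal[OF _ N] pN by blast
qed

lemma interior_zeros_empty: "M interior_of zeros = {}"
proof -
  let ?Z = "M interior_of zeros"
  have "closedin M ?Z"
    using interior_zeros_closed interior_of_subset_topspace closure_of_subset_eq by metis
  then consider "?Z = {}" | "?Z = topspace M"
    using connected openin_interior_of unfolding connected_space_clopen_in by blast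
  then show ?thesis
  proof cases
    case 2
    obtain c x where c: "c \<in> \<A>" "x \<in> coord_dom c" "\<Lambda> c x \<noteq> 0" using nonzero by blast
    then obtain p where p: "p \<in> fst c" "x = snd c p" by (auto simp: coord_dom_def)
    then have "p \<in> topspace M" using chart[OF c(1)] openin_subset unfolding is_chart_def by blast
    then have "p \<in> ?Z" by (simp add: 2)
    then have "p \<in> zeros" by (rule subsetD[OF interior_of_subset])
    then show ?thesis using zeros_chart[OF c(1) p(1)] c(3) p(2) by simp
  qed
qed

lemma \<Lambda>_dense:
  assumes c: "c \<in> \<A>" and W: "open W" "W \<subseteq> coord_dom c" "W \<noteq> {}"
  shows "\<exists>y\<in>W. \<Lambda> c y \<noteq> 0"
proof (rule ccontr)
  assume "\<not> ?thesis"
  then have "{p \<in> fst c. snd c p \<in> W} \<subseteq> zeros" using zeros_chart[OF c] by blast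
  then have "{p \<in> fst c. snd c p \<in> W} = {}"
    using interior_of_maximal[OF _ is_chart_preimage_open[OF chart[OF c] W(1,2)]] interior_zeros_empty by blast
  then show False using W(2,3) by (auto simp: coord_dom_def)
qed

lemma ricci_eq:
  assumes W: "weakly_bochner_flat \<A> g J" and c: "c \<in> \<A>" and x: "x \<in> coord_dom c"
  shows "ricci (g c) x u v = - (real CARD('n) + 2) * B * g c x u v"
proof -
  interpret cc: cc_chart "coord_dom c" "g c" "J c" "A c" "\<Lambda> c" "\<mu> \<circ> chart_inv c" B
    by (rule cc_chart[OF c])
  show ?thesis
    by (rule cc.ricci_of_dense[OF \<Lambda>_dense[OF c] _ x]) (use W c in \<open>auto simp: weakly_bochner_flat_def\<close>)
qed

end

theorem corollary2:
  fixes M :: "'a topology" and \<A> :: "('a, 'n::finite) chart set"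
    and g :: "('a, 'n) formfield" and J :: "('a, 'n) endofield"
    and B :: real and m :: nat
  assumes "kaehler_manifold M \<A> g J" and "connected_space M"
    and "CARD('n) = 2 * m" and "2 * m \<ge> 4"
    and "metric_CC \<A> g J B"
  shows "(weakly_bochner_flat \<A> g J \<longrightarrow> kaehler_einstein M \<A> g J) \<and>
         (bochner_flat \<A> g J \<longrightarrow> constant_holomorphic_sectional_curvature \<A> g J)"
proof -
  obtain A \<Lambda> \<mu> where "cc_manifold M \<A> g J B A \<Lambda> \<mu>"
    using assms(1,2,5) unfolding metric_CC_def cc_manifold_def by blast
  then interpret cc_manifold M \<A> g J B A \<Lambda> \<mu> .
  \<comment> \<open>This implication gives Bochner-flat metrics the Einstein property, after which
    the Ricci tensor has only its trace part to contribute to the curvature.\<close>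
  have "weakly_bochner_flat \<A> g J" if "bochner_flat \<A> g J"
    unfolding weakly_bochner_flat_def
  proof (intro ballI allI)
    fix c x X Y Z assume c: "c \<in> \<A>" and x: "x \<in> coord_dom c"
    interpret k: kaehler_chart "coord_dom c" "g c" "J c" by (rule kaehler_manifold_chart[OF kaehler c])
    show "metric_trace (g c x) (\<lambda>u v. nabla_tensor4 (g c) (bochner (g c) (J c)) x u v X Y Z) = 0"
      by (rule k.bochner_flat_imp_weakly[OF _ x]) (use that c in \<open>auto simp: bochner_flat_def\<close>)
  qed
  moreover have "kaehler_einstein M \<A> g J" if "weakly_bochner_flat \<A> g J"
    unfolding kaehler_einstein_def einstein_def using kaehler ricci_eq[OF that] by blast
  moreover have "constant_holomorphic_sectional_curvature \<A> g J"
    if W: "weakly_bochner_flat \<A> g J" and flat: "bochner_flat \<A> g J"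
    unfolding constant_holomorphic_sectional_curvature_def
  proof (intro exI ballI allI impI)
    fix c x u assume c: "c \<in> \<A>" and x: "x \<in> coord_dom c" and u: "(u :: real ^ 'n) \<noteq> 0"
    interpret k: kaehler_chart "coord_dom c" "g c" "J c" by (rule kaehler_manifold_chart[OF kaehler c])
    \<comment> \<open>The constant left open by \<open>exI\<close> is fixed here; it simplifies to
      -4 B.\<close>
    show "sectional_curvature (g c) x u (J c x u) = 4 * (- (real CARD('n) + 2) * B) / (real CARD('n) + 2)"
      by (rule k.bochner_flat_einstein_curvature[OF x ricci_eq[OF W c x] _ u])
        (use flat c x in \<open>auto simp: bochner_flat_def\<close>)
  qed
  ultimately show ?thesis by blast
qed

end
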